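(* Let $(M,Y)$ be the Markov additive process described in the context, and for $i,j\in S$, $x\ge0$ let $$H_{ij}(x)=P\big(M(\xi_0^+)=j,\ Y(\xi_0^+)\le x\,\big|\,M(0)=i\big),$$ where $\xi_0^+$ is the first transition instant at or after the hitting time $\tau_0^+=\inf\{t>0:Y(t)\ge0\}$. Then for $j\in S$ and $x\ge 0$: if $i\in S^-$, $$H_{ij}(x)=\frac1{-v(i)}\left(\int_0^xdw\left[\int_w^\infty e^{(y-w)K^{(-)}}(I^{--},L^{-+})D(dy)\right]_{ij}+\sum_{k\in S^+}\int_0^xL^{-+}_{ik}\big(1-e^{-c(k)(x-y)/v(k)}\big)\frac{v(k)}{c(k)}\,U_{kj}(dy)\right),$$ and if $i\in S^+$, $$H_{ij}(x)=\int_0^x\big(1-e^{-c(i)(x-y)/v(i)}\big)\frac1{c(i)}\,U_{ij}(dy).$$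
   Context: Markov additive process. $S$ is a finite set; $C_{ij}\ge0$ ($i\ne j$) and $D_{ij}\ge 0$ ($i,j\in S$), $c(i)=\sum_{j\ne i}C_{ij}+\sum_{j}D_{ij}>0$, $C_{ii}=-c(i)$. $C+D$ is irreducible with stationary distribution $\pi=(\pi_i)$. $v:S\to\mathbb R\setminus\{0\}$; $S^-=\{v<0\}$, $S^+=\{v>0\}$; $\Delta_v$ is the diagonal matrix with entries $v(i)$. $F^{\rm D}_{ij}$ are distributions on $(0,\infty)$. $M$ is a right-continuous Markov chain on $S$ with transitions $i\to j\neq i$ at rate $C_{ij}$ ("type C") and $i\to j$ ($j=i$ allowed) at rate $D_{ij}$ ("type D"); all of these count as transitions. $Y$ is right-continuous, $Y(0)=0$, moves linearly with slope $v(M(t))$ between transitions, does not jump at type C transitions, and at a type D transition $i\to j$ jumps upward by an amount with distribution $F^{\rm D}_{ij}$ (independent of everything else given the transition). For $x\ge0$, $D_{ij}(x)=D_{ij}F^{\rm D}_{ij}(x)$, $C_{ij}(x)=C_{ij}$ (all mass at $0$), $U_{ij}(x)=\mathbb 1(i\neq j)C_{ij}(x)+D_{ij}(x)$, viewed as measures on $[0,\infty)$; integrals $\int_0^x$ include a mass at $0$. Superscripts $-,+$ denote blocks indexed by $S^-,S^+$. Events at $\tau_0^+$ or $\xi_0^+$ include finiteness of these times. (Thus $\xi_0^+=\tau_0^+$ if level $0$ is crossed by a jump; for $M(0)\in S^+$, $\tau_0^+=0$ and $\xi_0^+$ is the first transition after time $0$.) A square matrix is ML if its off-diagonal entries are nonnegative.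 $K^{(-)}$ ($S^-\times S^-$, ML) and $L^{-+}$ ($S^-\times S^+$, nonnegative) are the (entrywise) minimal solutions of $$-K^{(-)}(I^{--},L^{-+})=\int_0^\infty e^{uK^{(-)}}(I^{--},L^{-+})\,(C(du)+D(du))\,\Delta_v^{-1}.$$ Equivalently $K^{(-)}_{ij}=\pi_j\tilde Q^{(-)}_{ji}/\pi_i$ and $L^{-+}_{ij}=\pi_j\tilde R^{+-}_{ji}/\pi_i$, where, for the dual Markov additive process $(\tilde M,\tilde Y)$ with data $\tilde C_{ij}=\pi_jC_{ji}/\pi_i$, $\tilde D_{ij}(x)=\pi_jD_{ji}(x)/\pi_i$ and the same $v$, started from $\tilde Y=0$, and $\tilde\tau^-_{-x}=\inf\{t>0:\tilde Y(t)\le -x\}$, one has $P(\tilde M(\tilde\tau^-_{-x})=j,\tilde\tau^-_{-x}<\infty|\tilde M(0)=i)=[e^{x\tilde Q^{(-)}}]_{ij}$ for $i,j\in S^-$, $x\ge0$, and $\tilde R^{+-}_{ij}=P(\tilde M(\tilde\tau^-_{0})=j,\tilde\tau^-_0<\infty|\tilde M(0)=i)$ for $i\in S^+,j\in S^-$. *)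

theory Defs
  imports "HOL-Probability.Probability"
begin

section \<open>Matrices\<close>

text \<open>The multiplication of the type class \<^class>\<open>times\<close> on \<open>real ^ 's ^ 's\<close> is componentwise, so
  neither \<open>^\<close> nor \<^const>\<open>exp\<close> applies here.\<close>

definition mexp :: "real ^ 's ^ 's \<Rightarrow> real ^ 's ^ ('s::finite)" where
  "mexp X = (\<Sum>n. (1 / fact n) *\<^sub>R (((**) X ^^ n) (mat 1)))"

definition diag_matrix :: "('s \<Rightarrow> real) \<Rightarrow> real ^ 's ^ ('s::finite)" where
  "diag_matrix v = (\<chi> i j. if i = j then v i else 0)"

definition irreducible_matrix :: "real ^ 's ^ ('s::finite) \<Rightarrow> bool" where
  "irreducible_matrix A \<longleftrightarrow> (\<forall>i j. (i, j) \<in> {(k, l). k \<noteq> l \<and> A $ k $ l > 0}\<^sup>*)"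

definition is_ML_matrix :: "real ^ 's ^ ('s::finite) \<Rightarrow> bool" where
  "is_ML_matrix A \<longleftrightarrow> (\<forall>i j. i \<noteq> j \<longrightarrow> 0 \<le> A $ i $ j)"

text \<open>Integral of a matrix-valued function against a matrix of measures,
  \<open>[\<integral>\<^sub>A G(u) \<mu>(du)]\<^sub>i\<^sub>j = \<Sum>\<^sub>k \<integral>\<^sub>A G\<^sub>i\<^sub>k(u) \<mu>\<^sub>k\<^sub>j(du)\<close>.\<close>

definition matrix_integral ::
  "real set \<Rightarrow> (real \<Rightarrow> real ^ 's ^ 's) \<Rightarrow> ('s \<Rightarrow> 's \<Rightarrow> real measure) \<Rightarrow> real ^ 's ^ ('s::finite)" where
  "matrix_integral A G \<mu> = (\<chi> i j. \<Sum>k\<in>UNIV. LINT u:A|\<mu> k j. G u $ i $ k)"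

definition matrix_integrable ::
  "real set \<Rightarrow> (real \<Rightarrow> real ^ 's ^ 's) \<Rightarrow> ('s \<Rightarrow> 's \<Rightarrow> real measure) \<Rightarrow> bool" where
  "matrix_integrable A G \<mu> \<longleftrightarrow> (\<forall>i j k. set_integrable (\<mu> k j) A (\<lambda>u. G u $ i $ k))"


section \<open>Data of a Markov additive process\<close>

definition total_rate :: "real ^ 's ^ 's \<Rightarrow> real ^ 's ^ 's \<Rightarrow> ('s::finite) \<Rightarrow> real" where
  "total_rate C D i = (\<Sum>j\<in>UNIV - {i}. C $ i $ j) + (\<Sum>j\<in>UNIV. D $ i $ j)"

locale map_data =
  fixes C D :: "real ^ 's ^ ('s::finite)"
    and F :: "'s \<Rightarrow> 's \<Rightarrow> real measure"
    and v :: "'s \<Rightarrow> real"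
    and \<pi> :: "real ^ 's"
  assumes C_nonneg: "i \<noteq> j \<Longrightarrow> 0 \<le> C $ i $ j"
    and D_nonneg: "0 \<le> D $ i $ j"
    and total_rate_pos: "0 < total_rate C D i"
    and C_diag: "C $ i $ i = - total_rate C D i"
    and irreducible: "irreducible_matrix (C + D)"
    and \<pi>_nonneg: "0 \<le> \<pi> $ i"
    and \<pi>_sum: "(\<Sum>i\<in>UNIV. \<pi> $ i) = 1"
    and \<pi>_stationary: "\<pi> v* (C + D) = 0"
    and v_nonzero: "v i \<noteq> 0"
    and F_distribution: "real_distribution (F i j)"
    and F_positive: "measure (F i j) {0<..} = 1"

text \<open>The distribution functions \<open>D\<^sub>i\<^sub>j(x)\<close> and \<open>U\<^sub>i\<^sub>j(x)\<close> (extended by \<open>0\<close> to \<open>x < 0\<close>) are turned into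
  measures by Lebesgue-Stieltjes; the mass \<open>U\<^sub>i\<^sub>j(0)\<close> becomes an atom at \<open>0\<close>.\<close>

definition D_measure ::
  "real ^ 's ^ 's \<Rightarrow> ('s \<Rightarrow> 's \<Rightarrow> real measure) \<Rightarrow> 's \<Rightarrow> ('s::finite) \<Rightarrow> real measure" where
  "D_measure D F i j = interval_measure (\<lambda>x. D $ i $ j * cdf (F i j) x)"

definition U_measure ::
  "real ^ 's ^ 's \<Rightarrow> real ^ 's ^ 's \<Rightarrow> ('s \<Rightarrow> 's \<Rightarrow> real measure) \<Rightarrow> 's \<Rightarrow> ('s::finite) \<Rightarrow> real measure" where
  "U_measure C D F i j = interval_measure (\<lambda>x.
     (if i \<noteq> j \<and> 0 \<le> x then C $ i $ j else 0) + D $ i $ j * cdf (F i j) x)"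


section \<open>The process\<close>

datatype transition_type = Type_C | Type_D

text \<open>Probability that a transition out of \<open>i\<close> is of type \<open>e\<close>, leads to \<open>j\<close> and has an additive jump
  in \<open>B\<close>.\<close>

fun transition_prob ::
  "real ^ 's ^ 's \<Rightarrow> real ^ 's ^ 's \<Rightarrow> ('s \<Rightarrow> 's \<Rightarrow> real measure) \<Rightarrow> 's \<Rightarrow> transition_type \<Rightarrow> ('s::finite) \<Rightarrow>
    real set \<Rightarrow> real" where
  "transition_prob C D F i Type_C j B = (if i \<noteq> j then C $ i $ j / total_rate C D i else 0) * indicator B 0"
| "transition_prob C D F i Type_D j B = D $ i $ j / total_rate C D i * measure (F i j) B"

text \<open>\<open>T n\<close> (\<open>n \<ge> 1\<close>) is the instant of the \<open>n\<close>-th transition and \<open>E n\<close> its type; \<open>T 0 = 0\<close> is not a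
  transition. The rates enter through the jump chain and holding times: given the past up to
  \<open>T m\<close> and the current state \<open>i\<close>, the time to the next transition is exponential with parameter
  \<open>c(i)\<close> and independent of the type, target and jump of that transition, which have the law
  \<^const>\<open>transition_prob\<close>.\<close>

locale markov_additive_process = map_data C D F v \<pi> + prob_space P
  for C D :: "real ^ 's ^ ('s::finite)"
    and F :: "'s \<Rightarrow> 's \<Rightarrow> real measure"
    and v :: "'s \<Rightarrow> real"
    and \<pi> :: "real ^ 's"
    and P :: "'a measure" +
  fixes M :: "real \<Rightarrow> 'a \<Rightarrow> 's"
    and Y :: "real \<Rightarrow> 'a \<Rightarrow> real"
    and T :: "nat \<Rightarrow> 'a \<Rightarrow> real"
    and E :: "nat \<Rightarrow> 'a \<Rightarrow> transition_type"
  assumes M_measurable: "0 \<le> t \<Longrightarrow> M t \<in> measurable P (count_space UNIV)"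
    and Y_measurable: "0 \<le> t \<Longrightarrow> Y t \<in> borel_measurable P"
    and T_measurable: "T n \<in> borel_measurable P"
    and E_measurable: "E n \<in> measurable P (count_space UNIV)"
    and T_0: "\<omega> \<in> space P \<Longrightarrow> T 0 \<omega> = 0"
    and T_strict_mono: "\<omega> \<in> space P \<Longrightarrow> strict_mono (\<lambda>n. T n \<omega>)"
    and T_at_top: "\<omega> \<in> space P \<Longrightarrow> filterlim (\<lambda>n. T n \<omega>) at_top sequentially"
    and M_path: "\<omega> \<in> space P \<Longrightarrow> T n \<omega> \<le> t \<Longrightarrow> t < T (Suc n) \<omega> \<Longrightarrow> M t \<omega> = M (T n \<omega>) \<omega>"
    and Y_0: "\<omega> \<in> space P \<Longrightarrow> Y 0 \<omega> = 0"
    and Y_path: "\<omega> \<in> space P \<Longrightarrow> T n \<omega> \<le> t \<Longrightarrow> t < T (Suc n) \<omega> \<Longrightarrow>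
      Y t \<omega> = Y (T n \<omega>) \<omega> + v (M (T n \<omega>) \<omega>) * (t - T n \<omega>)"
    and transition_law:
      "(\<And>m. A m \<in> sets borel) \<Longrightarrow> (\<And>m. B m \<in> sets borel) \<Longrightarrow>
       \<P>(\<omega> in P. M 0 \<omega> = s 0 \<and> (\<forall>m<n.
            T (Suc m) \<omega> - T m \<omega> \<in> A m \<and>
            E (Suc m) \<omega> = e m \<and>
            M (T (Suc m) \<omega>) \<omega> = s (Suc m) \<and>
            Y (T (Suc m) \<omega>) \<omega> - (Y (T m \<omega>) \<omega> + v (M (T m \<omega>) \<omega>) * (T (Suc m) \<omega> - T m \<omega>)) \<in> B m))
       = \<P>(\<omega> in P. M 0 \<omega> = s 0) *
         (\<Prod>m<n. measure (density lborel (\<lambda>t. ennreal (exponential_density (total_rate C D (s m)) t))) (A m) *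
                 transition_prob C D F (s m) (e m) (s (Suc m)) (B m))"

definition hitting_time :: "(real \<Rightarrow> 'a \<Rightarrow> real) \<Rightarrow> 'a \<Rightarrow> ereal" where
  "hitting_time Y \<omega> = (INF t\<in>{t. 0 < t \<and> 0 \<le> Y t \<omega>}. ereal t)"

definition next_transition :: "(real \<Rightarrow> 'a \<Rightarrow> real) \<Rightarrow> (nat \<Rightarrow> 'a \<Rightarrow> real) \<Rightarrow> 'a \<Rightarrow> ereal" where
  "next_transition Y T \<omega> = (INF n\<in>{n. 1 \<le> n \<and> hitting_time Y \<omega> \<le> ereal (T n \<omega>)}. ereal (T n \<omega>))"

definition H ::
  "'a measure \<Rightarrow> (real \<Rightarrow> 'a \<Rightarrow> 's) \<Rightarrow> (real \<Rightarrow> 'a \<Rightarrow> real) \<Rightarrow> (nat \<Rightarrow> 'a \<Rightarrow> real) \<Rightarrow> 's \<Rightarrow> 's \<Rightarrow> real \<Rightarrow> real" where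
  "H P M Y T i j x =
    \<P>(\<omega> in P. next_transition Y T \<omega> < \<infinity> \<and>
              M (real_of_ereal (next_transition Y T \<omega>)) \<omega> = j \<and>
              Y (real_of_ereal (next_transition Y T \<omega>)) \<omega> \<le> x
         \<bar> M 0 \<omega> = i)"


section \<open>The matrices $K^{(-)}$ and $L^{-+}$\<close>

text \<open>Matrices with rows or columns indexed by \<open>S\<^sup>- = {i. v i < 0}\<close> or \<open>S\<^sup>+ = {i. v i > 0}\<close> are
  represented as matrices over \<open>S\<close> vanishing outside the block. The \<open>S\<^sup>- \<times> S\<^sup>-\<close> block of
  \<open>mexp K\<close> is then the exponential of the block; on \<open>S\<^sup>+ \<times> S\<^sup>+\<close> it is the identity, which is
  annihilated by the zero rows of \<open>(I\<^sup>-\<^sup>-, L\<^sup>-\<^sup>+)\<close>.\<close>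

definition supported_on :: "'s set \<Rightarrow> 's set \<Rightarrow> real ^ 's ^ ('s::finite) \<Rightarrow> bool" where
  "supported_on A B X \<longleftrightarrow> (\<forall>i j. \<not> (i \<in> A \<and> j \<in> B) \<longrightarrow> X $ i $ j = 0)"

definition I_L :: "('s \<Rightarrow> real) \<Rightarrow> real ^ 's ^ 's \<Rightarrow> real ^ 's ^ ('s::finite)" where
  "I_L v L = (\<chi> i j. if v i < 0 then (if v j < 0 then (if i = j then 1 else 0) else L $ i $ j) else 0)"

text \<open>Since \<open>C(du)\<close> is concentrated at \<open>0\<close> (with negative diagonal), its part of the integral is
  \<open>(I\<^sup>-\<^sup>-, L\<^sup>-\<^sup>+) C\<close>. Convergence of the \<open>D(du)\<close> part is required explicitly because divergent
  integrals have value \<open>0\<close>.\<close>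

definition KL_solution ::
  "real ^ 's ^ 's \<Rightarrow> real ^ 's ^ 's \<Rightarrow> ('s \<Rightarrow> 's \<Rightarrow> real measure) \<Rightarrow> ('s \<Rightarrow> real) \<Rightarrow>
    real ^ 's ^ 's \<Rightarrow> real ^ 's ^ ('s::finite) \<Rightarrow> bool" where
  "KL_solution C D F v K L \<longleftrightarrow>
     supported_on {i. v i < 0} {i. v i < 0} K \<and> is_ML_matrix K \<and>
     supported_on {i. v i < 0} {i. v i > 0} L \<and> (\<forall>i j. 0 \<le> L $ i $ j) \<and>
     matrix_integrable {0..} (\<lambda>u. mexp (u *\<^sub>R K) ** I_L v L) (D_measure D F) \<and>
     - (K ** I_L v L) =
       (I_L v L ** C + matrix_integral {0..} (\<lambda>u. mexp (u *\<^sub>R K) ** I_L v L) (D_measure D F))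
         ** matrix_inv (diag_matrix v)"

definition minimal_KL_solution ::
  "real ^ 's ^ 's \<Rightarrow> real ^ 's ^ 's \<Rightarrow> ('s \<Rightarrow> 's \<Rightarrow> real measure) \<Rightarrow> ('s \<Rightarrow> real) \<Rightarrow>
    real ^ 's ^ 's \<Rightarrow> real ^ 's ^ ('s::finite) \<Rightarrow> bool" where
  "minimal_KL_solution C D F v K L \<longleftrightarrow> KL_solution C D F v K L \<and>
     (\<forall>K' L'. KL_solution C D F v K' L' \<longrightarrow> (\<forall>i j. K $ i $ j \<le> K' $ i $ j \<and> L $ i $ j \<le> L' $ i $ j))"

end

theory Submission
  imports Defs
begin

text \<open>Jumps are nonnegative, so \<open>\<xi>\<^sub>0\<^sup>+\<close> is almost surely the first transition instant at which \<open>Y \<ge> 0\<close>,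
  and \<open>H\<close> becomes a first passage probability of the Markov renewal chain of the transitions. Before
  that instant the chain is described by the occupation density \<open>G\<^sub>i\<^sub>k(z)\<close> of the level \<open>- z\<close> in state \<open>k\<close>,
  the sum over \<open>n\<close> of the densities contributed by the \<open>n\<close>-th sojourn. Leaving from level \<open>- z < 0\<close> by a
  jump yields the \<open>D\<close>-part of the formula, and crossing level \<open>0\<close> inside a sojourn, at rate
  \<open>v k * G\<^sub>i\<^sub>k(0)\<close>, yields the \<open>U\<close>-part.

  It remains to identify \<open>G\<close> with \<open>e\<^bsup>zK\<^esup>(I,L)/\<bar>v i\<bar>\<close>. This function is a supersolution of the forward
  equation for every solution \<open>(K,L)\<close>, so it dominates \<open>G\<close>. Conversely, since the process is skip-free downwards,
  \<open>G\<close> has a semigroup property in \<open>z\<close>, hence is itself of the form \<open>e\<^bsup>zK'\<^esup>(I,L')/\<bar>v i\<bar>\<close> for a solution \<open>(K',L')\<close>;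
  minimality of \<open>(K,L)\<close> forces \<open>K' = K\<close> and \<open>L' = L\<close>.\<close>

section \<open>Matrix exponential\<close>

text \<open>The densities live in \<open>ennreal\<close> because finiteness of \<open>G\<close> is
  not known in advance. It is inherited from \<open>(K,L)\<close> through the comparison, and only
  afterwards can real functions be formed and differentiated.

  Why \<open>G\<close> is an exponential: by the semigroup property, the density of entrances into a
  state at depth \<open>a\<close> is a linear combination, with coefficients not depending on
  \<open>a\<close>, of the values of \<open>G\<close> at the same depth \<open>a\<close>. The
  renewal equation involves \<open>G\<close> at all greater depths, because jumps may come from
  there; after this substitution it is a linear differential equation with constant coefficients,
  and its matrix is \<open>K'\<close>.

  Domination compares functions of \<open>z\<close>, whereas minimality compares matrices. The two
  are linked at depth \<open>0\<close>: the values there give \<open>L'\<close>, and the right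
  derivatives there give \<open>K'\<close>, because on \<open>S\<^sup>-\<close> both functions start
  from the identity.\<close>

abbreviation mpow :: "real ^ 's ^ 's \<Rightarrow> nat \<Rightarrow> real ^ 's ^ ('s::finite)" where
  "mpow X n \<equiv> ((**) X ^^ n) (mat 1)"

lemma matrix_mult_nth: "(A ** B) $ i $ j = (\<Sum>k\<in>UNIV. A $ i $ k * B $ k $ j)"
  by (simp add: matrix_matrix_mult_def)

lemma matrix_mult_scaleR_right: "A ** (c *\<^sub>R B) = c *\<^sub>R (A ** (B :: real ^ 'n ^ 'm))"
  by (simp add: vec_eq_iff matrix_mult_nth sum_distrib_left algebra_simps)

lemma matrix_mult_scaleR_left: "(c *\<^sub>R A) ** B = c *\<^sub>R (A ** (B :: real ^ 'n ^ 'm))"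
  by (simp add: vec_eq_iff matrix_mult_nth sum_distrib_left algebra_simps)

lemma mpow_Suc_right: "mpow X (Suc n) = mpow X n ** X"
proof (induction n)
  case (Suc n)
  have "mpow X (Suc (Suc n)) = X ** (mpow X n ** X)" using Suc by simp
  then show ?case by (simp add: matrix_mul_assoc)
qed simp

lemma mpow_scaleR: "mpow (t *\<^sub>R X) n = t ^ n *\<^sub>R mpow X n"
  by (induction n) (simp_all add: matrix_mult_scaleR_left matrix_mult_scaleR_right)

text \<open>The sum of all absolute entries serves as a crude matrix norm; it bounds each entry's
  series by a scalar exponential series.\<close>

lemma abs_mpow_nth_le:
  "\<bar>mpow X n $ i $ j\<bar> \<le> (\<Sum>i\<in>UNIV. \<Sum>j\<in>UNIV. \<bar>X $ i $ j\<bar>) ^ n"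
proof (induction n arbitrary: i j)
  case 0
  show ?case by (simp add: mat_def)
next
  case (Suc n)
  let ?B = "\<Sum>i\<in>UNIV. \<Sum>j\<in>UNIV. \<bar>X $ i $ j\<bar>"
  have B0: "0 \<le> ?B" by (intro sum_nonneg) simp
  have "\<bar>mpow X (Suc n) $ i $ j\<bar> \<le> (\<Sum>k\<in>UNIV. \<bar>X $ i $ k * mpow X n $ k $ j\<bar>)"
    by (simp add: matrix_mult_nth sum_abs)
  also have "\<dots> \<le> (\<Sum>k\<in>UNIV. \<bar>X $ i $ k\<bar> * ?B ^ n)"
    using Suc by (intro sum_mono) (simp add: abs_mult mult_left_mono)
  also have "\<dots> = (\<Sum>k\<in>UNIV. \<bar>X $ i $ k\<bar>) * ?B ^ n" by (simp add: sum_distrib_right)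
  also have "\<dots> \<le> ?B * ?B ^ n"
    by (intro mult_right_mono zero_le_power B0
        member_le_sum[where f="\<lambda>i. \<Sum>j\<in>UNIV. \<bar>X $ i $ j\<bar>"] sum_nonneg) auto
  finally show ?case by simp
qed

lemma summable_mpow_nth: "summable (\<lambda>n. mpow X n $ i $ j / fact n * t ^ n)"
proof -
  let ?B = "\<Sum>i\<in>UNIV. \<Sum>j\<in>UNIV. \<bar>X $ i $ j\<bar>"
  have "summable (\<lambda>n. inverse (fact n) * (?B * \<bar>t\<bar>) ^ n)" by (rule summable_exp)
  then show ?thesis
  proof (rule summable_comparison_test'[where N = 0], goal_cases)
    case (1 n)
    have "norm (mpow X n $ i $ j / fact n * t ^ n) = inverse (fact n) * (\<bar>mpow X n $ i $ j\<bar> * \<bar>t\<bar> ^ n)"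
      by (simp add: abs_mult power_abs field_simps)
    also have "\<dots> \<le> inverse (fact n) * (?B ^ n * \<bar>t\<bar> ^ n)"
      by (intro mult_left_mono mult_right_mono abs_mpow_nth_le) auto
    finally show ?case by (simp add: power_mult_distrib)
  qed
qed

text \<open>Reduces the matrix series to one real power series per entry, so that termwise
  differentiation of power series applies.\<close>

lemma mexp_scaleR_nth: "mexp (t *\<^sub>R X) $ i $ j = (\<Sum>n. mpow X n $ i $ j / fact n * t ^ n)"
proof -
  let ?S = "\<chi> i j. \<Sum>n. mpow X n $ i $ j / fact n * t ^ n"
  have "(\<lambda>n. (1 / fact n) *\<^sub>R mpow (t *\<^sub>R X) n) sums ?S"
    unfolding sums_def
  proof (intro vec_tendstoI, goal_cases)
    case (1 i j)
    have "(\<lambda>n. mpow X n $ i $ j / fact n * t ^ n) sums (?S $ i $ j)"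
      using summable_mpow_nth[of X i j t] by (simp add: summable_sums)
    then show ?case by (simp add: sums_def sum_component mpow_scaleR field_simps)
  qed
  then have "mexp (t *\<^sub>R X) = ?S" unfolding mexp_def by (rule sums_unique[symmetric])
  then show ?thesis by simp
qed

lemma mexp_0 [simp]: "mexp (0 :: real ^ 's ^ ('s::finite)) = mat 1"
proof -
  have "mexp (0 *\<^sub>R 0 :: real ^ 's ^ 's) $ i $ j = (mat 1 :: real ^ 's ^ 's) $ i $ j" for i j
    by (simp only: mexp_scaleR_nth powser_zero) simp
  then show ?thesis by (simp add: vec_eq_iff)
qed

text \<open>A power of \<open>X\<close> can be split off on either side. The right-hand form matches
  forward equations \<open>f' = f X\<close>; the left-hand form is used for the product rule and for
  rows in which \<open>X\<close> vanishes.\<close>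

lemma has_real_derivative_mexp_nth:
  "((\<lambda>t. mexp (t *\<^sub>R X) $ i $ j) has_real_derivative (X ** mexp (t *\<^sub>R X)) $ i $ j) (at t within S)"
  (is ?left)
  and has_real_derivative_mexp_nth':
  "((\<lambda>t. mexp (t *\<^sub>R X) $ i $ j) has_real_derivative (mexp (t *\<^sub>R X) ** X) $ i $ j) (at t within S)"
  (is ?right)
proof -
  define a where "a i j n = mpow X n $ i $ j / fact n" for i j n
  have sm: "summable (\<lambda>n. a i j n * t ^ n)" for i j t
    unfolding a_def by (rule summable_mpow_nth)
  have D: "((\<lambda>t. mexp (t *\<^sub>R X) $ i $ j) has_real_derivative (\<Sum>n. diffs (a i j) n * t ^ n)) (at t within S)"
    unfolding mexp_scaleR_nth a_def[symmetric]
    by (rule has_field_derivative_at_within[OF termdiffs_strong_converges_everywhere[OF sm]])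
  have d: "diffs (a i j) n = mpow X (Suc n) $ i $ j / fact n" for n
    unfolding diffs_def a_def by (simp add: field_simps del: funpow.simps of_nat_Suc)
  have 1: "diffs (a i j) n = (\<Sum>k\<in>UNIV. X $ i $ k * a k j n)" for n
    unfolding d by (simp add: matrix_mult_nth a_def sum_divide_distrib)
  have 2: "diffs (a i j) n = (\<Sum>k\<in>UNIV. X $ k $ j * a i k n)" for n
    unfolding d mpow_Suc_right by (simp add: matrix_mult_nth a_def sum_divide_distrib mult.commute)
  have "(\<Sum>n. diffs (a i j) n * t ^ n) = (\<Sum>k\<in>UNIV. \<Sum>n. X $ i $ k * (a k j n * t ^ n))"
    by (subst suminf_sum[symmetric])
      (auto simp: 1 sum_distrib_right mult.assoc intro: summable_mult sm)
  also have "\<dots> = (X ** mexp (t *\<^sub>R X)) $ i $ j"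
    by (simp add: matrix_mult_nth mexp_scaleR_nth suminf_mult[OF sm] a_def[symmetric])
  finally show ?left using D by simp
  have "(\<Sum>n. diffs (a i j) n * t ^ n) = (\<Sum>k\<in>UNIV. \<Sum>n. X $ k $ j * (a i k n * t ^ n))"
    by (subst suminf_sum[symmetric])
      (auto simp: 2 sum_distrib_right mult.assoc intro: summable_mult sm)
  also have "\<dots> = (mexp (t *\<^sub>R X) ** X) $ i $ j"
    by (simp add: matrix_mult_nth mexp_scaleR_nth suminf_mult[OF sm] a_def[symmetric] mult.commute[of _ "X $ _ $ _"])
  finally show ?right using D by simp
qed

text \<open>By the product rule the derivative of \<open>f t ** mexp (t *\<^sub>R - X)\<close> is
  \<open>f X e - f X e = 0\<close>. Derivatives are taken within \<open>{0..}\<close>, since the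
  occupation densities will be differentiable only in this one-sided sense at depth
  \<open>0\<close>.\<close>

lemma linear_ODE_mexp_const:
  fixes f :: "real \<Rightarrow> real ^ 's ^ ('s::finite)"
  assumes f: "\<And>t i j. 0 \<le> t \<Longrightarrow>
      ((\<lambda>t. f t $ i $ j) has_real_derivative (f t ** X) $ i $ j) (at t within {0..})"
    and t: "0 \<le> t"
  shows "f t ** mexp (t *\<^sub>R - X) = f 0"
proof -
  let ?m = "\<lambda>t. mexp (t *\<^sub>R - X)"
  have "(f t ** ?m t) $ i $ j = (f 0 ** ?m 0) $ i $ j" for i j
  proof -
    have "((\<lambda>t. (f t ** ?m t) $ i $ j) has_real_derivative 0) (at s within {0..})" if "s \<in> {0..}" for s
    proof -
      have "((\<lambda>t. (f t ** ?m t) $ i $ j) has_real_derivative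
          (\<Sum>k\<in>UNIV. (f s ** X) $ i $ k * ?m s $ k $ j + (- X ** ?m s) $ k $ j * f s $ i $ k)) (at s within {0..})"
        unfolding matrix_mult_nth[of "f _" "?m _"] using that
        by (intro DERIV_sum DERIV_mult has_real_derivative_mexp_nth f) auto
      moreover have "(\<Sum>k\<in>UNIV. (f s ** X) $ i $ k * ?m s $ k $ j + (- X ** ?m s) $ k $ j * f s $ i $ k)
         = ((f s ** X) ** ?m s) $ i $ j + (f s ** (- X ** ?m s)) $ i $ j"
        by (simp add: matrix_mult_nth[of "f s ** X"] matrix_mult_nth[of "f s" "- X ** _"] sum.distrib mult.commute)
      moreover have "(f s ** (- X ** ?m s)) = - ((f s ** X) ** ?m s)"
        by (simp add: matrix_mul_assoc vec_eq_iff matrix_mult_nth sum_negf)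
      ultimately show ?thesis by simp
    qed
    then obtain c where "\<And>s. s \<in> {0..} \<Longrightarrow> (f s ** ?m s) $ i $ j = c"
      using has_field_derivative_zero_constant[of "{0::real..}" "\<lambda>t. (f t ** ?m t) $ i $ j"] by auto
    from this[of t] this[of 0] t show ?thesis by simp
  qed
  then show ?thesis by (simp add: vec_eq_iff)
qed

lemma mexp_mult_mexp_minus: "0 \<le> t \<Longrightarrow> mexp (t *\<^sub>R X) ** mexp (t *\<^sub>R - X) = mat 1"
  using linear_ODE_mexp_const[of "\<lambda>t. mexp (t *\<^sub>R X)" X t] has_real_derivative_mexp_nth'[of X] by simp

text \<open>The common source of the addition formula, of positivity for ML matrices and of the
  exponential form of the occupation density.\<close>

lemma linear_ODE_mexp_unique:
  fixes f :: "real \<Rightarrow> real ^ 's ^ ('s::finite)"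
  assumes f: "\<And>t i j. 0 \<le> t \<Longrightarrow>
      ((\<lambda>t. f t $ i $ j) has_real_derivative (f t ** X) $ i $ j) (at t within {0..})"
    and t: "0 \<le> t"
  shows "f t = f 0 ** mexp (t *\<^sub>R X)"
proof -
  have "f t ** mexp (t *\<^sub>R - X) ** mexp (t *\<^sub>R X) = f 0 ** mexp (t *\<^sub>R X)"
    using linear_ODE_mexp_const[of f X t] f t by simp
  moreover have "mexp (t *\<^sub>R - X) ** mexp (t *\<^sub>R X) = mat 1"
    using mexp_mult_mexp_minus[OF t, of "- X"] by simp
  ultimately show ?thesis by (simp add: matrix_mul_assoc[symmetric])
qed

text \<open>Obtained from uniqueness in the variable \<open>t\<close>, with \<open>s\<close> as a
  parameter of either sign; negative \<open>s\<close> occurs later as a shift by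
  \<open>- w\<close>.\<close>

lemma mexp_add: "0 \<le> t \<Longrightarrow> mexp ((s + t) *\<^sub>R X) = mexp (s *\<^sub>R X) ** mexp (t *\<^sub>R X)"
proof -
  assume t: "0 \<le> t"
  have "((\<lambda>t. mexp ((s + t) *\<^sub>R X) $ i $ j) has_real_derivative (mexp ((s + t) *\<^sub>R X) ** X) $ i $ j)
     (at t within {0..})" for t i j
    using DERIV_shift[of "\<lambda>t. mexp (t *\<^sub>R X) $ i $ j" _ t s]
      has_real_derivative_mexp_nth'[of X i j "s + t" UNIV]
    by (auto simp: add.commute intro: has_field_derivative_at_within)
  from linear_ODE_mexp_unique[of "\<lambda>t. mexp ((s + t) *\<^sub>R X)" X t, OF this t] show ?thesis by simp
qed

lemma mexp_nonneg_of_nonneg: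
  assumes "\<And>i j. 0 \<le> X $ i $ j" and t: "0 \<le> t"
  shows "0 \<le> mexp (t *\<^sub>R X) $ i $ j"
proof -
  have "0 \<le> mpow X n $ i $ j" for n i j
    by (induction n arbitrary: i j) (auto simp: mat_def matrix_mult_nth assms intro!: sum_nonneg mult_nonneg_nonneg)
  then show ?thesis unfolding mexp_scaleR_nth using t summable_mpow_nth[of X i j t]
    by (intro suminf_nonneg) auto
qed

text \<open>Adding a multiple \<open>a\<close> of the identity makes an ML matrix nonnegative and multiplies the
  exponential by a positive scalar.\<close>

lemma mexp_ML_nonneg:
  fixes X :: "real ^ 's ^ ('s::finite)"
  assumes X: "is_ML_matrix X" and t: "0 \<le> t"
  shows "0 \<le> mexp (t *\<^sub>R X) $ i $ j"
proof -
  define a where "a = (\<Sum>i\<in>UNIV. \<bar>X $ i $ i\<bar>)"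
  define Z where "Z = X + a *\<^sub>R mat 1"
  have "\<bar>X $ i $ i\<bar> \<le> a" for i
    unfolding a_def by (rule member_le_sum[where f="\<lambda>i. \<bar>X $ i $ i\<bar>"]) auto
  then have "0 \<le> a + X $ i $ i" for i by (simp add: abs_le_iff add.commute neg_le_iff_le) (metis add.commute diff_ge_0_iff_ge diff_minus_eq_add)
  then have Z: "0 \<le> Z $ i $ j" for i j
    using X by (cases "i = j") (auto simp: Z_def mat_def is_ML_matrix_def add.commute)
  let ?f = "\<lambda>t. exp (- a * t) *\<^sub>R mexp (t *\<^sub>R Z)"
  have fX: "?f t ** X = ?f t ** Z - a *\<^sub>R ?f t" for t
    unfolding Z_def by (simp add: matrix_add_ldistrib matrix_mult_scaleR_right matrix_mult_scaleR_left)
  have "((\<lambda>t. ?f t $ i $ j) has_real_derivative (?f t ** X) $ i $ j) (at t within {0..})" for t i j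
    unfolding fX
    by (auto intro!: derivative_eq_intros has_real_derivative_mexp_nth'
        simp: matrix_mult_scaleR_left algebra_simps)
  from linear_ODE_mexp_unique[of ?f X t, OF this t] have "?f t = mexp (t *\<^sub>R X)" by simp
  then have "mexp (t *\<^sub>R X) $ i $ j = exp (- a * t) * mexp (t *\<^sub>R Z) $ i $ j"
    by (simp add: vec_eq_iff)
  then show ?thesis using mexp_nonneg_of_nonneg[OF Z t] by simp
qed

section \<open>Occupation densities\<close>

text \<open>Both measures have the same distribution function, which determines a finite Borel
  measure. This is how the Stieltjes measures of the data become explicit.\<close>

lemma interval_measure_cdf:
  assumes "finite_borel_measure N"
  shows "interval_measure (cdf N) = N"
proof -
  interpret finite_borel_measure N by fact
  show ?thesis
    by (intro cdf_unique' assms cdf_interval_measure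
        finite_borel_measure_interval_measure[where m = "measure N (space N)"]
        cdf_nondecreasing cdf_is_right_cont cdf_lim_at_bot cdf_lim_at_top measure_nonneg)
qed

context map_data
begin

abbreviation "Um k j \<equiv> U_measure C D F k j"
abbreviation "Dm k j \<equiv> D_measure D F k j"
abbreviation "c k \<equiv> total_rate C D k"
text \<open>The nonnegative part of \<open>C\<close>, as in \<open>U\<close>. The diagonal of
  \<open>C\<close> is kept apart as the outflow rate \<open>c\<close>.\<close>

abbreviation "Coff k j \<equiv> (if k = j then 0 else C $ k $ j)"

section \<open>Explicit form of the measures \<open>D_measure\<close> and
  \<open>U_measure\<close>\<close>

lemma Coff_nonneg: "0 \<le> Coff k j"
  using C_nonneg by auto

lemma D_measure_eq: "Dm k j = scale_measure (ennreal (D $ k $ j)) (F k j)"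
proof -
  interpret F: real_distribution "F k j" by (rule F_distribution)
  let ?N = "scale_measure (ennreal (D $ k $ j)) (F k j)"
  have "finite_borel_measure ?N"
    by (intro finite_borel_measure.intro finite_measureI finite_borel_measure_axioms.intro)
      (auto simp: ennreal_mult_eq_top_iff)
  moreover have "cdf ?N = (\<lambda>x. D $ k $ j * cdf (F k j) x)"
    by (auto simp: cdf_def fun_eq_iff measure_scale_measure D_nonneg)
  ultimately show ?thesis using interval_measure_cdf[of ?N] by (simp add: D_measure_def)
qed

lemma sets_Dm [simp, measurable_cong]: "sets (Dm k j) = sets borel"
  by (simp add: D_measure_def)

lemma space_Dm [simp]: "space (Dm k j) = UNIV"
  by (simp add: D_measure_def)

lemma sets_Um [simp, measurable_cong]: "sets (Um k j) = sets borel"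
  by (simp add: U_measure_def)

lemma space_Um [simp]: "space (Um k j) = UNIV"
  by (simp add: U_measure_def)

lemma emeasure_Dm: "emeasure (Dm k j) A = ennreal (D $ k $ j) * emeasure (F k j) A"
  by (simp add: D_measure_eq)

lemma finite_measure_Dm: "finite_measure (Dm k j)"
proof -
  interpret F: real_distribution "F k j" by (rule F_distribution)
  show ?thesis by (auto intro!: finite_measureI simp: emeasure_Dm ennreal_mult_eq_top_iff)
qed

text \<open>The sum of an atom at \<open>0\<close> and \<open>Dm k j\<close> is built as a measure
  \<open>N\<close>; its distribution function is the one defining \<open>U_measure\<close>, so
  uniqueness identifies the two.\<close>

lemma emeasure_Um:
  assumes "A \<in> sets borel"
  shows "emeasure (Um k j) A = ennreal (Coff k j) * indicator A 0 + emeasure (Dm k j) A"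
proof -
  interpret F: real_distribution "F k j" by (rule F_distribution)
  interpret Dm: finite_measure "Dm k j" by (rule finite_measure_Dm)
  define \<mu> where "\<mu> A = ennreal (Coff k j) * indicator A 0 + emeasure (Dm k j) A" for A :: "real set"
  define N where "N = measure_of UNIV (sets borel) \<mu>"
  have sN: "sets N = sets borel" by (simp add: N_def sets.sigma_sets_eq[of borel, simplified])
  have eN: "emeasure N A = \<mu> A" if "A \<in> sets borel" for A
    unfolding N_def
  proof (rule emeasure_measure_of_sigma)
    show "sigma_algebra UNIV (sets borel)"
      using sets.sigma_algebra_axioms by (metis space_borel)
    show "positive (sets borel) \<mu>" by (simp add: positive_def \<mu>_def)
    show "countably_additive (sets borel) \<mu>"
    proof (rule countably_additiveI)
      fix A :: "nat \<Rightarrow> real set"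
      assume A: "range A \<subseteq> sets borel" "disjoint_family A" "\<Union> (range A) \<in> sets borel"
      have "emeasure (return borel 0) (\<Union> (range A)) = (\<Sum>n. emeasure (return borel 0) (A n))"
        using A by (intro suminf_emeasure[symmetric]) auto
      moreover have "emeasure (Dm k j) (\<Union> (range A)) = (\<Sum>n. emeasure (Dm k j) (A n))"
        using A by (intro suminf_emeasure[symmetric]) auto
      moreover have "range A \<subseteq> sets borel \<Longrightarrow> A n \<in> sets borel" for n by auto
      ultimately show "(\<Sum>n. \<mu> (A n)) = \<mu> (\<Union> (range A))"
        using A unfolding \<mu>_def by (simp add: suminf_add[symmetric])
    qed
  qed (use that in auto)
  have "finite_borel_measure N"
    by (intro finite_borel_measure.intro finite_measureI finite_borel_measure_axioms.intro)
      (auto simp: sN eN \<mu>_def sets_eq_imp_space_eq[OF sN] Dm.emeasure_eq_measure ennreal_mult_eq_top_iff)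
  moreover have "cdf N = (\<lambda>x. (if k \<noteq> j \<and> 0 \<le> x then C $ k $ j else 0) + D $ k $ j * cdf (F k j) x)"
  proof
    fix x
    have "emeasure N {..x} = ennreal ((if k \<noteq> j \<and> 0 \<le> x then C $ k $ j else 0) + D $ k $ j * cdf (F k j) x)"
      using C_nonneg[of k j] D_nonneg[of k j]
      by (auto simp: eN \<mu>_def emeasure_Dm F.emeasure_eq_measure cdf_def ennreal_mult indicator_def)
    then show "cdf N x = (if k \<noteq> j \<and> 0 \<le> x then C $ k $ j else 0) + D $ k $ j * cdf (F k j) x"
      using C_nonneg[of k j] D_nonneg[of k j] F.cdf_nonneg[of x] unfolding cdf_def[of N] measure_def[of N]
      by (simp del: ennreal_plus)
  qed
  ultimately have "Um k j = N" using interval_measure_cdf[of N] by (simp add: U_measure_def)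
  then show ?thesis using assms eN by (simp add: \<mu>_def)
qed

lemma finite_measure_Um: "finite_measure (Um k j)"
proof -
  interpret Dm: finite_measure "Dm k j" by (rule finite_measure_Dm)
  show ?thesis
    by (rule finite_measureI) (auto simp: emeasure_Um Dm.emeasure_eq_measure ennreal_mult_eq_top_iff)
qed

lemma nn_integral_Um:
  assumes "f \<in> borel_measurable borel"
  shows "(\<integral>\<^sup>+u. f u \<partial>Um k j) = ennreal (Coff k j) * f 0 + (\<integral>\<^sup>+u. f u \<partial>Dm k j)"
  using assms
proof (induction rule: borel_measurable_induct)
  case (cong f g)
  then show ?case by (metis UNIV_I nn_integral_cong space_borel)
next
  case (set A)
  then show ?case by (simp add: emeasure_Um)
next
  case (mult u v)
  then show ?case by (simp add: nn_integral_cmult distrib_left mult.left_commute)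
next
  case (add u v)
  then show ?case by (simp add: nn_integral_add distrib_left add_ac del: mult_if_delta)
next
  case (seq V)
  have inc: "incseq (\<lambda>i. \<integral>\<^sup>+u. V i u \<partial>Dm k j)"
    using seq(3) by (auto simp: incseq_def le_fun_def intro!: nn_integral_mono)
  have "(\<integral>\<^sup>+u. (SUP i. V i) u \<partial>Um k j) = (SUP i. \<integral>\<^sup>+u. V i u \<partial>Um k j)"
    using seq by (subst SUP_apply, intro nn_integral_monotone_convergence_SUP) auto
  also have "\<dots> = (SUP i. ennreal (Coff k j) * V i 0 + (\<integral>\<^sup>+u. V i u \<partial>Dm k j))"
    using seq by simp
  also have "\<dots> = (SUP i. ennreal (Coff k j) * V i 0) + (SUP i. \<integral>\<^sup>+u. V i u \<partial>Dm k j)"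
    using seq(3) by (intro ennreal_SUP_add inc) (auto simp: incseq_def le_fun_def intro!: mult_left_mono)
  also have "(SUP i. \<integral>\<^sup>+u. V i u \<partial>Dm k j) = (\<integral>\<^sup>+u. (SUP i. V i) u \<partial>Dm k j)"
    using seq by (subst SUP_apply, intro nn_integral_monotone_convergence_SUP[symmetric]) auto
  finally show ?case by (simp add: SUP_mult_left_ennreal image_comp)
qed

lemma AE_Dm_pos: "AE u in Dm k j. 0 < u"
proof -
  interpret F: real_distribution "F k j" by (rule F_distribution)
  have "AE u in F k j. u \<in> {0<..}"
    using F_positive[of k j] by (intro F.prob_eq_1[THEN iffD1]) auto
  then have "emeasure (F k j) {..0} = 0"
    by (subst (asm) AE_iff_measurable[of "{..0}"]) auto
  then show ?thesis
    by (subst AE_iff_measurable[of "{..0}"]) (auto simp: emeasure_Dm)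
qed

text \<open>Jumps only decrease the depth. Hence \<open>entrance f j a\<close> sees \<open>f\<close>
  at depths at least \<open>a\<close> only, and comparisons restricted to nonnegative depths are
  stable under \<open>entrance\<close>.\<close>

lemma AE_Um_nonneg: "AE u in Um k j. 0 \<le> u"
proof -
  have "emeasure (Dm k j) {..<0} = 0"
    by (rule null_setsD1, subst AE_iff_null_sets, simp, rule eventually_mono[OF AE_Dm_pos]) auto
  then show ?thesis
    by (subst AE_iff_measurable[of "{..<0}"]) (auto simp: emeasure_Um)
qed

text \<open>The level is measured downwards, \<open>z = - Y\<close>. A sojourn in \<open>k\<close> lowers the level by
  \<open>- v k\<close> times an exponential variable; its density divided by the rate is the occupation
  density of one sojourn.\<close>

definition sojourn :: "'s \<Rightarrow> real \<Rightarrow> ennreal" where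
  "sojourn k t = (if t / v k \<le> 0 then ennreal (exp (c k * t / v k) / \<bar>v k\<bar>) else 0)"

lemma sojourn_measurable [measurable]: "sojourn k \<in> borel_measurable borel"
  unfolding sojourn_def by measurable

text \<open>Density of entrances into \<open>j\<close> at depth \<open>a\<close>: a jump of size
  \<open>u\<close> leads there from depth \<open>a + u\<close>. \<open>Um\<close> carries rates, not
  probabilities, which fits occupation densities that were divided by the rate.\<close>

definition entrance :: "('s \<Rightarrow> real \<Rightarrow> ennreal) \<Rightarrow> 's \<Rightarrow> real \<Rightarrow> ennreal" where
  "entrance f j a = (\<Sum>k\<in>UNIV. \<integral>\<^sup>+u. f k (a + u) \<partial>Um k j)"

text \<open>The factor \<open>indicator {0<..} a\<close> kills the chain once a transition ends at
  or above the initial level.\<close>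

definition next_occ :: "('s \<Rightarrow> real \<Rightarrow> ennreal) \<Rightarrow> 's \<Rightarrow> real \<Rightarrow> ennreal" where
  "next_occ f j z = (\<integral>\<^sup>+a. entrance f j a * sojourn j (z - a) * indicator {0<..} a \<partial>lborel)"

text \<open>\<open>occ i n k\<close> is the density of the time spent at depth \<open>z\<close> during the \<open>n\<close>-th sojourn, on the
  event that this sojourn is in \<open>k\<close> and that the process, started in \<open>i\<close>, was below its initial
  level at the first \<open>n\<close> transitions.\<close>

primrec occ :: "'s \<Rightarrow> nat \<Rightarrow> 's \<Rightarrow> real \<Rightarrow> ennreal" where
  "occ i 0 = (\<lambda>j z. if i = j then sojourn i z else 0)"
| "occ i (Suc n) = next_occ (occ i n)"

lemma entrance_measurable [measurable]:
  assumes [measurable]: "\<And>k. f k \<in> borel_measurable borel"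
  shows "entrance f j \<in> borel_measurable borel"
proof -
  interpret finite_measure "Um k j" for k by (rule finite_measure_Um)
  show ?thesis unfolding entrance_def by measurable
qed

lemma next_occ_measurable [measurable]:
  assumes [measurable]: "\<And>k. f k \<in> borel_measurable borel"
  shows "next_occ f j \<in> borel_measurable borel"
  unfolding next_occ_def by measurable

lemma occ_measurable [measurable]: "occ i n k \<in> borel_measurable borel"
  by (induction n arbitrary: k) auto

definition total_occ :: "'s \<Rightarrow> 's \<Rightarrow> real \<Rightarrow> ennreal" where
  "total_occ i k z = (\<Sum>n. occ i n k z)"

lemma total_occ_measurable [measurable]: "total_occ i k \<in> borel_measurable borel"
  unfolding total_occ_def by measurable

section \<open>Renewal equation and minimality of the total occupation density\<close>

lemma entrance_sum:
  assumes [measurable]: "\<And>n k. f n k \<in> borel_measurable borel"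
  shows "entrance (\<lambda>k z. \<Sum>n\<in>N. f n k z) j a = (\<Sum>n\<in>N. entrance (f n) j a)"
  unfolding entrance_def by (simp add: nn_integral_sum) (rule sum.swap)

lemma entrance_suminf:
  assumes [measurable]: "\<And>n k. f n k \<in> borel_measurable borel"
  shows "entrance (\<lambda>k z. \<Sum>n. f n k z) j a = (\<Sum>n. entrance (f n) j a)"
  unfolding entrance_def by (simp add: nn_integral_suminf suminf_sum)

lemma next_occ_sum:
  assumes [measurable]: "\<And>n k. f n k \<in> borel_measurable borel"
  shows "next_occ (\<lambda>k z. \<Sum>n\<in>N. f n k z) j z = (\<Sum>n\<in>N. next_occ (f n) j z)"
  unfolding next_occ_def by (simp add: entrance_sum sum_distrib_right nn_integral_sum)

lemma next_occ_suminf: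
  assumes [measurable]: "\<And>n k. f n k \<in> borel_measurable borel"
  shows "next_occ (\<lambda>k z. \<Sum>n. f n k z) j z = (\<Sum>n. next_occ (f n) j z)"
  unfolding next_occ_def by (simp add: entrance_suminf flip: nn_integral_suminf ennreal_suminf_multc)

lemma total_occ_eq: "total_occ i k z = occ i 0 k z + next_occ (total_occ i) k z"
proof -
  have "total_occ i k z = occ i 0 k z + (\<Sum>n. occ i (Suc n) k z)"
    using suminf_offset[of "\<lambda>n. occ i n k z" 1] by (simp add: total_occ_def summableI add.commute)
  also have "(\<Sum>n. occ i (Suc n) k z) = next_occ (total_occ i) k z"
    using next_occ_suminf[of "occ i" k z] by (simp add: total_occ_def[abs_def])
  finally show ?thesis .
qed

lemma entrance_mono:
  assumes "\<And>k z. 0 \<le> z \<Longrightarrow> f k z \<le> g k z" "0 \<le> a"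
  shows "entrance f j a \<le> entrance g j a"
  unfolding entrance_def
  using assms by (intro sum_mono nn_integral_mono_AE eventually_mono[OF AE_Um_nonneg]) auto

lemma next_occ_mono:
  assumes "\<And>k z. 0 \<le> z \<Longrightarrow> f k z \<le> g k z"
  shows "next_occ f j z \<le> next_occ g j z"
  unfolding next_occ_def
  by (intro nn_integral_mono) (auto split: split_indicator intro!: mult_right_mono entrance_mono assms)

text \<open>Monotone iteration: the partial sums arise from \<open>0\<close> by repeatedly applying
  \<open>occ i 0 + next_occ\<close>, and each step stays below a supersolution. Hence
  \<open>total_occ i\<close> is the least supersolution on nonnegative depths.\<close>

lemma partial_occ_le:
  assumes super: "\<And>k z. 0 \<le> z \<Longrightarrow> occ i 0 k z + next_occ g k z \<le> g k z"
    and z: "0 \<le> z"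
  shows "(\<Sum>m<n. occ i m k z) \<le> g k z"
  using z
proof (induction n arbitrary: k z)
  case (Suc n)
  have "(\<Sum>m<Suc n. occ i m k z) = occ i 0 k z + (\<Sum>m<n. next_occ (occ i m) k z)"
    by (subst sum.lessThan_Suc_shift) simp
  also have "\<dots> = occ i 0 k z + next_occ (\<lambda>k z. \<Sum>m<n. occ i m k z) k z"
    by (simp add: next_occ_sum)
  also have "\<dots> \<le> occ i 0 k z + next_occ g k z"
    by (intro add_left_mono next_occ_mono Suc)
  also have "\<dots> \<le> g k z" by (rule super) fact
  finally show ?case .
qed simp

lemma total_occ_le:
  assumes "\<And>k z. 0 \<le> z \<Longrightarrow> occ i 0 k z + next_occ g k z \<le> g k z"
    and "0 \<le> z"
  shows "total_occ i k z \<le> g k z"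
  unfolding total_occ_def using partial_occ_le[OF assms] by (intro suminf_le_const) (auto simp: summableI)

end

section \<open>Solutions of the KL equation dominate the occupation density\<close>

lemma diag_matrix_nth: "(X ** diag_matrix v) $ i $ j = X $ i $ j * v j"
  by (simp add: matrix_mult_nth diag_matrix_def if_distrib[of "(*) _"] cong: if_cong)

text \<open>\<open>matrix_inv\<close> is a choice operator, so the reciprocal diagonal is exhibited
  first as a witness of invertibility.\<close>

lemma diag_matrix_inverse:
  fixes v :: "'s::finite \<Rightarrow> real"
  assumes "\<And>i. v i \<noteq> 0"
  shows "diag_matrix v ** matrix_inv (diag_matrix v) = mat 1"
    and "matrix_inv (diag_matrix v) ** diag_matrix v = mat 1"
proof -
  have "diag_matrix v ** diag_matrix (\<lambda>i. 1 / v i) = mat 1"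
    "diag_matrix (\<lambda>i. 1 / v i) ** diag_matrix v = mat 1"
    using assms by (simp_all add: vec_eq_iff diag_matrix_nth) (simp_all add: diag_matrix_def mat_def)
  then have "invertible (diag_matrix v)" unfolding invertible_def by blast
  then show "diag_matrix v ** matrix_inv (diag_matrix v) = mat 1"
    "matrix_inv (diag_matrix v) ** diag_matrix v = mat 1"
    using someI_ex[of "\<lambda>A'. diag_matrix v ** A' = mat 1 \<and> A' ** diag_matrix v = mat 1"]
    unfolding matrix_inv_def invertible_def by auto
qed

lemma has_real_derivative_mexp_mult:
  "((\<lambda>z. (mexp (z *\<^sub>R K) ** X) $ i $ j) has_real_derivative (mexp (z *\<^sub>R K) ** K ** X) $ i $ j)
    (at z within S)"
  unfolding matrix_mult_nth[of _ X]
  by (auto intro!: derivative_eq_intros has_real_derivative_mexp_nth')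

lemma continuous_on_mexp_mult: "continuous_on S (\<lambda>z. (mexp (z *\<^sub>R K) ** X) $ i $ j)"
  by (rule DERIV_continuous_on, rule has_real_derivative_mexp_mult)

lemma borel_measurable_mexp_mult [measurable]:
  "(\<lambda>z. (mexp (z *\<^sub>R K) ** X) $ i $ j) \<in> borel_measurable borel"
  by (intro borel_measurable_continuous_onI continuous_on_mexp_mult)

context map_data
begin

lemma KL_equation_iff:
  "- X = Z ** matrix_inv (diag_matrix v) \<longleftrightarrow> (\<forall>i j. - (X $ i $ j * v j) = Z $ i $ j)"
proof -
  note inv = diag_matrix_inverse[OF v_nonzero]
  have "- X = Z ** matrix_inv (diag_matrix v) \<longleftrightarrow> - X ** diag_matrix v = Z"
  proof
    assume "- X = Z ** matrix_inv (diag_matrix v)"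
    then show "- X ** diag_matrix v = Z" by (simp add: matrix_mul_assoc[symmetric] inv)
  next
    assume "- X ** diag_matrix v = Z"
    then have "Z ** matrix_inv (diag_matrix v) = - X ** (diag_matrix v ** matrix_inv (diag_matrix v))"
      by (simp add: matrix_mul_assoc)
    then show "- X = Z ** matrix_inv (diag_matrix v)" by (simp add: inv)
  qed
  then show ?thesis by (simp add: vec_eq_iff diag_matrix_nth)
qed

lemma total_rate_sum: "(\<Sum>k\<in>UNIV. x k * C $ k $ j) = (\<Sum>k\<in>UNIV. x k * Coff k j) - c j * x j"
proof -
  have "(\<Sum>k\<in>UNIV. x k * C $ k $ j) = (\<Sum>k\<in>UNIV. x k * Coff k j + (if k = j then - c j * x j else 0))"
    by (intro sum.cong) (auto simp: C_diag)
  then show ?thesis by (simp add: sum.distrib)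
qed

context
  fixes K L :: "real ^ 's ^ 's"
  assumes KL: "KL_solution C D F v K L"
begin

abbreviation "IL \<equiv> I_L v L"
abbreviation "Eh z \<equiv> mexp (z *\<^sub>R K) ** IL"
abbreviation "Eh' z \<equiv> mexp (z *\<^sub>R K) ** K ** IL"

lemma IL_nonneg: "0 \<le> IL $ i $ j"
  using KL by (auto simp: I_L_def KL_solution_def)

lemma Eh_nonneg: "0 \<le> z \<Longrightarrow> 0 \<le> Eh z $ i $ j"
  unfolding matrix_mult_nth using KL
  by (intro sum_nonneg mult_nonneg_nonneg IL_nonneg mexp_ML_nonneg) (auto simp: KL_solution_def)

lemma Eh_has_derivative: "((\<lambda>z. Eh z $ i $ j) has_real_derivative Eh' z $ i $ j) (at z within S)"
  by (rule has_real_derivative_mexp_mult)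

lemma Eh_measurable [measurable]: "(\<lambda>z. Eh z $ i $ j) \<in> borel_measurable borel"
  by (rule borel_measurable_mexp_mult)

lemma Eh'_measurable [measurable]: "(\<lambda>z. Eh' z $ i $ j) \<in> borel_measurable borel"
  unfolding matrix_mul_assoc[symmetric, of _ K IL] by (rule borel_measurable_mexp_mult)

lemma Eh_integrable: "set_integrable (Dm k j) {0..} (\<lambda>u. Eh u $ i $ k)"
  using KL by (auto simp: KL_solution_def matrix_integrable_def)

lemma Eh_add: "0 \<le> u \<Longrightarrow> Eh (a + u) = mexp (a *\<^sub>R K) ** Eh u"
  by (simp add: mexp_add matrix_mul_assoc)

lemma Eh_shift_nth: "0 \<le> u \<Longrightarrow> Eh (a + u) $ i $ k = (\<Sum>l\<in>UNIV. mexp (a *\<^sub>R K) $ i $ l * Eh u $ l $ k)"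
  by (simp only: Eh_add matrix_mult_nth[of "mexp _" "Eh _"])

lemma Eh_shift_integrable: "set_integrable (Dm k j) {0..} (\<lambda>u. Eh (a + u) $ i $ k)"
proof -
  have "set_integrable (Dm k j) {0..} (\<lambda>u. \<Sum>l\<in>UNIV. mexp (a *\<^sub>R K) $ i $ l * Eh u $ l $ k)"
    unfolding set_integrable_def scaleR_sum_right
    by (intro Bochner_Integration.integrable_sum set_integrable_mult_right[unfolded set_integrable_def]
        Eh_integrable[unfolded set_integrable_def])
  then show ?thesis
    by (rule set_integrable_cong[THEN iffD1, rotated 3]) (auto simp: Eh_shift_nth)
qed

lemma Eh_shift_integral:
  "(\<Sum>k\<in>UNIV. LINT u:{0..}|Dm k j. Eh (a + u) $ i $ k)
    = (mexp (a *\<^sub>R K) ** matrix_integral {0..} Eh (D_measure D F)) $ i $ j"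
proof -
  have "(LINT u:{0..}|Dm k j. Eh (a + u) $ i $ k)
      = (\<Sum>l\<in>UNIV. mexp (a *\<^sub>R K) $ i $ l * (LINT u:{0..}|Dm k j. Eh u $ l $ k))" for k
  proof -
    have "(LINT u:{0..}|Dm k j. Eh (a + u) $ i $ k)
      = (LINT u:{0..}|Dm k j. (\<Sum>l\<in>UNIV. mexp (a *\<^sub>R K) $ i $ l * Eh u $ l $ k))"
      by (rule set_lebesgue_integral_cong) (auto simp: Eh_shift_nth)
    also have "\<dots> = (\<Sum>l\<in>UNIV. mexp (a *\<^sub>R K) $ i $ l * (LINT u:{0..}|Dm k j. Eh u $ l $ k))"
      unfolding set_lebesgue_integral_def scaleR_sum_right
      using Eh_integrable[of k j] unfolding set_integrable_def
      by (subst Bochner_Integration.integral_sum) (simp_all add: mult.left_commute[of "indicat_real _ _"])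
    finally show ?thesis .
  qed
  then show ?thesis
    by (simp add: matrix_mult_nth[of "mexp _"] matrix_integral_def sum_distrib_left) (rule sum.swap)
qed

text \<open>The KL equation multiplied from the left by \<open>mexp (a *\<^sub>R K)\<close>: the
  factor merges with the exponential under the integral and shifts its argument by
  \<open>a\<close>.\<close>

lemma Eh_equation:
  "(\<Sum>k\<in>UNIV. Eh a $ i $ k * Coff k j) + (\<Sum>k\<in>UNIV. LINT u:{0..}|Dm k j. Eh (a + u) $ i $ k)
    = c j * Eh a $ i $ j - v j * Eh' a $ i $ j"
proof -
  let ?Z = "IL ** C + matrix_integral {0..} Eh (D_measure D F)"
  have Z: "- ((K ** IL) $ i $ j * v j) = ?Z $ i $ j" for i j
    using KL unfolding KL_solution_def KL_equation_iff by blast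
  have "- (v j * Eh' a $ i $ j) = (mexp (a *\<^sub>R K) ** ?Z) $ i $ j"
    unfolding matrix_mul_assoc[symmetric, of _ K IL] matrix_mult_nth[of "mexp _" "K ** IL"]
      matrix_mult_nth[of "mexp _" ?Z] Z[symmetric]
    by (simp add: sum_distrib_left sum_negf mult_ac)
  also have "\<dots> = (Eh a ** C) $ i $ j + (\<Sum>k\<in>UNIV. LINT u:{0..}|Dm k j. Eh (a + u) $ i $ k)"
    unfolding Eh_shift_integral by (simp add: matrix_add_ldistrib matrix_mul_assoc)
  also have "(Eh a ** C) $ i $ j = (\<Sum>k\<in>UNIV. Eh a $ i $ k * Coff k j) - c j * Eh a $ i $ j"
    unfolding matrix_mult_nth[of "Eh a" C] by (rule total_rate_sum)
  finally show ?thesis by simp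
qed

lemma set_lebesgue_integral_nonneg_Eh: "0 \<le> a \<Longrightarrow> 0 \<le> (LINT u:{0..}|Dm k j. Eh (a + u) $ i $ k)"
  unfolding set_lebesgue_integral_def
  by (intro Bochner_Integration.integral_nonneg) (auto simp: indicator_def intro!: Eh_nonneg)

text \<open>\<open>Eh'\<close> alone has no known sign; the combination is nonnegative because
  \<open>Eh_equation\<close> equates it with a sum of nonnegative terms.\<close>

lemma Eh_rate_nonneg: "0 \<le> a \<Longrightarrow> 0 \<le> c j * Eh a $ i $ j - v j * Eh' a $ i $ j"
  unfolding Eh_equation[symmetric]
  by (intro add_nonneg_nonneg sum_nonneg mult_nonneg_nonneg Coff_nonneg set_lebesgue_integral_nonneg_Eh Eh_nonneg)

lemma nn_integral_Eh_Dm: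
  assumes a: "0 \<le> a"
  shows "(\<integral>\<^sup>+u. ennreal (Eh (a + u) $ i $ k) \<partial>Dm k j) = ennreal (LINT u:{0..}|Dm k j. Eh (a + u) $ i $ k)"
proof -
  have "ennreal (LINT u:{0..}|Dm k j. Eh (a + u) $ i $ k)
      = (\<integral>\<^sup>+u. ennreal (indicator {0..} u *\<^sub>R Eh (a + u) $ i $ k) \<partial>Dm k j)"
    unfolding set_lebesgue_integral_def
    by (intro nn_integral_eq_integral[symmetric] Eh_shift_integrable[unfolded set_integrable_def])
      (use a in \<open>auto simp: indicator_def intro!: Eh_nonneg\<close>)
  also have "\<dots> = (\<integral>\<^sup>+u. ennreal (Eh (a + u) $ i $ k) \<partial>Dm k j)"
    by (intro nn_integral_cong_AE eventually_mono[OF AE_Dm_pos]) auto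
  finally show ?thesis ..
qed

text \<open>Besides the value this records finiteness, from which finiteness of
  \<open>entrance (total_occ i)\<close> follows by comparison.\<close>

lemma entrance_Eh:
  assumes a: "0 \<le> a"
  shows "entrance (\<lambda>k z. ennreal (Eh z $ i $ k)) j a
    = ennreal (c j * Eh a $ i $ j - v j * Eh' a $ i $ j)"
proof -
  note nn = Eh_nonneg[OF a, of i] set_lebesgue_integral_nonneg_Eh[OF a, of _ j i]
  have "entrance (\<lambda>k z. ennreal (Eh z $ i $ k)) j a
    = (\<Sum>k\<in>UNIV. ennreal (Eh a $ i $ k * Coff k j) + ennreal (LINT u:{0..}|Dm k j. Eh (a + u) $ i $ k))"
    unfolding entrance_def using nn Coff_nonneg
    by (intro sum.cong) (auto simp: nn_integral_Um nn_integral_Eh_Dm[OF a] ennreal_mult mult.commute)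
  also have "\<dots> = ennreal (\<Sum>k\<in>UNIV. Eh a $ i $ k * Coff k j + (LINT u:{0..}|Dm k j. Eh (a + u) $ i $ k))"
    using nn Coff_nonneg by (simp flip: ennreal_plus add: sum_ennreal)
  finally show ?thesis by (simp only: sum.distrib Eh_equation)
qed

text \<open>The KL equation says \<open>c j * e - v j * e' = q\<close> for the column \<open>e\<close> of \<open>Eh\<close>. Variation of constants gives
  equality if \<open>v j < 0\<close>; if \<open>v j > 0\<close>, a nonnegative boundary term at infinity is dropped.\<close>

lemma next_occ_Eh_le:
  assumes i: "v i < 0" and z: "0 \<le> z"
  defines "g \<equiv> \<lambda>k z. ennreal (Eh z $ i $ k / \<bar>v i\<bar>)"
  shows "occ i 0 j z + next_occ g j z \<le> g j z"
proof -
  define e where "e z = Eh z $ i $ j / \<bar>v i\<bar>" for z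
  define e' where "e' z = Eh' z $ i $ j / \<bar>v i\<bar>" for z
  have De: "(e has_real_derivative e' x) (at x within S)" for x S
    unfolding e_def e'_def by (rule DERIV_cdivide[OF Eh_has_derivative])
  have [measurable]: "e \<in> borel_measurable borel" "e' \<in> borel_measurable borel"
    unfolding e_def e'_def by measurable
  have e0: "0 \<le> e x" if "0 \<le> x" for x
    unfolding e_def using Eh_nonneg[OF that, of i j] by simp
  define q where "q a = c j * e a - v j * e' a" for a
  have q: "q a = (c j * Eh a $ i $ j - v j * Eh' a $ i $ j) / \<bar>v i\<bar>" for a
    using i by (simp add: q_def e_def e'_def field_simps)
  have q0: "0 \<le> q a" if "0 \<le> a" for a
    unfolding q using Eh_rate_nonneg[OF that, of j i] by simp
  have [measurable]: "q \<in> borel_measurable borel" unfolding q_def by measurable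
  have ent: "entrance g j a = ennreal (q a)" if a: "0 \<le> a" for a
  proof -
    have "entrance g j a = ennreal (1 / \<bar>v i\<bar>) * entrance (\<lambda>k z. ennreal (Eh z $ i $ k)) j a"
      unfolding entrance_def sum_distrib_left
    proof (intro sum.cong refl, subst nn_integral_cmult[symmetric])
      fix k show "(\<lambda>u. ennreal (Eh (a + u) $ i $ k)) \<in> borel_measurable (Um k j)" by measurable
      show "(\<integral>\<^sup>+ u. g k (a + u) \<partial>Um k j) = (\<integral>\<^sup>+ u. ennreal (1 / \<bar>v i\<bar>) * ennreal (Eh (a + u) $ i $ k) \<partial>Um k j)"
        using a by (intro nn_integral_cong_AE eventually_mono[OF AE_Um_nonneg])
          (auto simp: g_def Eh_nonneg simp flip: ennreal_mult)
    qed
    also have "\<dots> = ennreal (q a)"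
      unfolding entrance_Eh[OF a] q using Eh_rate_nonneg[OF a, of j i] by (simp flip: ennreal_mult)
    finally show ?thesis .
  qed
  let ?d = "\<lambda>a. q a * exp (c j * (z - a) / v j) / \<bar>v j\<bar>"
  \<comment> \<open>One antiderivative serves both signs: the derivative is \<open>?d\<close> for
    \<open>v j < 0\<close> and \<open>- ?d\<close> for \<open>v j > 0\<close>.\<close>
  have D0: "((\<lambda>a. e a * exp (c j * (z - a) / v j)) has_real_derivative - (q a * exp (c j * (z - a) / v j) / v j)) (at a)" for a
    unfolding q_def using v_nonzero[of j]
    by (auto intro!: derivative_eq_intros De simp: field_simps)
  have no: "next_occ g j z = (\<integral>\<^sup>+a. ennreal (q a) * sojourn j (z - a) * indicator {0<..} a \<partial>lborel)"
    unfolding next_occ_def by (intro nn_integral_cong) (auto split: split_indicator simp: ent)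
  show ?thesis
  proof (cases "v j < 0")
    case True
    have "next_occ g j z \<le> (\<integral>\<^sup>+a. ennreal (?d a) * indicator {0..z} a \<partial>lborel)"
      unfolding no using True q0
      by (intro nn_integral_mono)
        (auto split: split_indicator simp: sojourn_def field_simps zero_le_divide_iff divide_le_0_iff simp flip: ennreal_mult)
    also have "\<dots> = ennreal (e z * exp (c j * (z - z) / v j) - e 0 * exp (c j * (z - 0) / v j))"
    proof (rule nn_integral_FTC_Icc[where F = "\<lambda>a. e a * exp (c j * (z - a) / v j)"])
      fix x assume "x \<in> {0..z}"
      then show "0 \<le> ?d x" using q0[of x] by simp
      show "((\<lambda>a. e a * exp (c j * (z - a) / v j)) has_real_derivative ?d x) (at x)"
        using True by (intro DERIV_cong[OF D0]) simp
    qed (use z in auto)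
    finally have "next_occ g j z \<le> ennreal (e z - e 0 * exp (c j * z / v j))" by simp
    moreover have "occ i 0 j z = ennreal (e 0 * exp (c j * z / v j))"
      using True z by (auto simp: e_def I_L_def sojourn_def divide_le_0_iff)
    ultimately have "occ i 0 j z + next_occ g j z
        \<le> ennreal (e 0 * exp (c j * z / v j)) + ennreal (e z - e 0 * exp (c j * z / v j))"
      by (simp add: add_left_mono)
    also have "\<dots> = g j z"
    proof (subst ennreal_plus[symmetric])
      \<comment> \<open>\<open>ennreal\<close> maps negative numbers to \<open>0\<close>, so the two
        terms may be recombined only after the difference is known to be nonnegative.\<close>
      have "e 0 * exp (c j * (z - 0) / v j) \<le> e z * exp (c j * (z - z) / v j)"
      proof (rule DERIV_nonneg_imp_nondecreasing[OF z])
        fix x assume "0 \<le> x" "x \<le> z"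
        then show "\<exists>y. ((\<lambda>a. e a * exp (c j * (z - a) / v j)) has_real_derivative y) (at x) \<and> 0 \<le> y"
          using q0[of x] True by - (rule exI, rule conjI, rule D0, auto simp: divide_le_0_iff)
      qed
      then show "0 \<le> e z - e 0 * exp (c j * z / v j)" by simp
    qed (simp_all add: e0 g_def e_def[symmetric])
    finally show ?thesis .
  next
    case False
    then have vj: "0 < v j" using v_nonzero[of j] by auto
    have "next_occ g j z \<le> (\<integral>\<^sup>+a. (SUP n. ennreal (?d a) * indicator {z..z + real n} a) \<partial>lborel)"
      unfolding no
    proof (intro nn_integral_mono)
      fix a
      show "ennreal (q a) * sojourn j (z - a) * indicator {0<..} a
        \<le> (SUP n. ennreal (?d a) * indicator {z..z + real n} a)"
      proof (cases "0 < a \<and> z \<le> a")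
        case True
        obtain n where "a - z \<le> real n" using real_arch_simple by blast
        then have "ennreal (q a) * sojourn j (z - a) * indicator {0<..} a
            \<le> ennreal (?d a) * indicator {z..z + real n} a"
          using True q0[of a] vj by (auto simp: sojourn_def indicator_def divide_le_0_iff simp flip: ennreal_mult)
        then show ?thesis by (rule SUP_upper2[OF UNIV_I])
      qed (use vj in \<open>auto simp: sojourn_def indicator_def divide_le_0_iff\<close>)
    qed
    also have "\<dots> = (SUP n. \<integral>\<^sup>+a. ennreal (?d a) * indicator {z..z + real n} a \<partial>lborel)"
      by (intro nn_integral_monotone_convergence_SUP)
        (auto simp: incseq_def le_fun_def split: split_indicator)
    also have "\<dots> \<le> ennreal (e z)"
    proof (rule SUP_least)
      fix n :: nat
      have "(\<integral>\<^sup>+a. ennreal (?d a) * indicator {z..z + real n} a \<partial>lborel)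
        = ennreal (- (e (z + n) * exp (c j * (z - (z + n)) / v j)) - - (e z * exp (c j * (z - z) / v j)))"
      proof (rule nn_integral_FTC_Icc[where F = "\<lambda>a. - (e a * exp (c j * (z - a) / v j))"])
        fix x assume "x \<in> {z..z + real n}"
        then show "0 \<le> ?d x" using q0[of x] z by simp
        show "((\<lambda>a. - (e a * exp (c j * (z - a) / v j))) has_real_derivative ?d x) (at x)"
          using vj by (intro DERIV_cong[OF DERIV_minus[OF D0]]) simp
      qed auto
      also have "\<dots> \<le> ennreal (e z)" using e0[of "z + n"] z by (intro ennreal_leI) simp
      finally show "(\<integral>\<^sup>+a. ennreal (?d a) * indicator {z..z + real n} a \<partial>lborel) \<le> ennreal (e z)" .
    qed
    finally show ?thesis using i vj by (auto simp: g_def e_def)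
  qed
qed

lemma total_occ_le_Eh:
  assumes "v i < 0" and "0 \<le> z"
  shows "total_occ i k z \<le> ennreal (Eh z $ i $ k / \<bar>v i\<bar>)"
  using total_occ_le[of i "\<lambda>k z. ennreal (Eh z $ i $ k / \<bar>v i\<bar>)" z k] next_occ_Eh_le[OF assms(1)] assms(2)
  by auto

end

end

section \<open>The occupation density as a matrix exponential\<close>

lemma suminf_swap_ennreal: "(\<Sum>m. \<Sum>n. f m n) = (\<Sum>n. \<Sum>m. f m n :: ennreal)"
proof -
  have "(\<Sum>m. \<Sum>n. f m n) = (\<Sum>m. \<integral>\<^sup>+n. f m n \<partial>count_space UNIV)"
    by (simp add: nn_integral_count_space_nat)
  also have "\<dots> = (\<integral>\<^sup>+n. (\<Sum>m. f m n) \<partial>count_space UNIV)"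
    by (intro nn_integral_suminf[symmetric]) auto
  finally show ?thesis by (simp add: nn_integral_count_space_nat)
qed

text \<open>Sums in \<open>ennreal\<close> can be exchanged without any summability condition, so
  the semigroup property passes from \<open>occ\<close> to \<open>total_occ\<close> before
  finiteness is known.\<close>

lemma Cauchy_product_ennreal:
  fixes f g :: "nat \<Rightarrow> ennreal"
  shows "(\<Sum>n. \<Sum>m\<le>n. f m * g (n - m)) = (\<Sum>n. f n) * (\<Sum>n. g n)"
proof -
  let ?h = "\<lambda>m n. if m \<le> n then f m * g (n - m) else 0"
  have "(\<Sum>m\<le>n. f m * g (n - m)) = (\<Sum>m. ?h m n)" for n
    by (subst suminf_finite[of "{..n}"]) (auto intro!: sum.cong)
  then have "(\<Sum>n. \<Sum>m\<le>n. f m * g (n - m)) = (\<Sum>n. \<Sum>m. ?h m n)" by simp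
  also have "\<dots> = (\<Sum>m. \<Sum>n. ?h m n)" by (rule suminf_swap_ennreal)
  also have "(\<Sum>n. ?h m n) = f m * (\<Sum>n. g n)" for m
  proof -
    have "(\<Sum>n. ?h m n) = (\<Sum>n. ?h m (n + m)) + (\<Sum>n<m. ?h m n)"
      by (rule suminf_offset) (simp add: summableI)
    then show ?thesis by simp
  qed
  then have "(\<Sum>m. \<Sum>n. ?h m n) = (\<Sum>n. f n) * (\<Sum>n. g n)" by simp
  finally show ?thesis .
qed

lemma nn_integral_lborel_shift:
  fixes f :: "real \<Rightarrow> ennreal"
  assumes [measurable]: "f \<in> borel_measurable borel"
  shows "(\<integral>\<^sup>+a. f (a - z) \<partial>lborel) = (\<integral>\<^sup>+a. f a \<partial>lborel)"
  using nn_integral_real_affine[of "\<lambda>a. f (a - z)" 1 z] by simp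

lemma at_within_atLeast_eq:
  fixes x :: real
  assumes "x < b"
  shows "at x within {0..} = at x within {0..b}"
  by (rule at_within_nhd[of _ "{..<b}"]) (use assms in auto)

context map_data
begin

text \<open>Memorylessness of the exponential law. Each density carries a factor
  \<open>1 / \<bar>v j\<bar>\<close>; the middle factor removes the surplus one.\<close>

lemma sojourn_add:
  assumes "v j < 0" "0 \<le> s" "0 \<le> t"
  shows "sojourn j (s + t) = sojourn j s * ennreal \<bar>v j\<bar> * sojourn j t"
proof -
  have "exp (c j * (s + t) / v j) / \<bar>v j\<bar> = exp (c j * s / v j) / \<bar>v j\<bar> * \<bar>v j\<bar> * (exp (c j * t / v j) / \<bar>v j\<bar>)"
    using assms by (simp add: distrib_left add_divide_distrib exp_add)
  then show ?thesis using assms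
    by (simp add: sojourn_def divide_le_0_iff flip: ennreal_mult)
qed

text \<open>Path decomposition at the last passage through depth \<open>z\<close> before depth \<open>z + z'\<close>: as there
  are no downward jumps, this passage happens while moving down, in a state \<open>l\<close> with \<open>v l < 0\<close>.\<close>

lemma occ_add:
  assumes i: "v i < 0" and z: "0 \<le> z" and z': "0 \<le> z'"
  shows "occ i n j (z + z') = (\<Sum>m\<le>n. \<Sum>l | v l < 0. occ i m l z * ennreal \<bar>v l\<bar> * occ l (n - m) j z')"
  using z'
proof (induction n arbitrary: j z')
  case 0
  have "(\<Sum>l | v l < 0. occ i 0 l z * ennreal \<bar>v l\<bar> * occ l 0 j z')
      = (\<Sum>l | v l < 0. if l = i then sojourn i z * ennreal \<bar>v i\<bar> * (if i = j then sojourn i z' else 0) else 0)"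
    by (intro sum.cong) auto
  also have "\<dots> = occ i 0 j (z + z')"
    using sojourn_add[OF i z 0] i by auto
  finally show ?case by simp
next
  case (Suc n)
  let ?e = "entrance (occ i n) j"
  let ?q = "\<lambda>m l. occ i m l z * ennreal \<bar>v l\<bar>"
  \<comment> \<open>Entrances at depth \<open>z + s\<close> come from depths
    \<open>z + (s + u)\<close> with \<open>u \<ge> 0\<close>, so the induction hypothesis applies
    under the integral.\<close>
  have e: "?e (z + s) = (\<Sum>m\<le>n. \<Sum>l | v l < 0. ?q m l * entrance (occ l (n - m)) j s)" if s: "0 \<le> s" for s
  proof -
    have "?e (z + s) = (\<Sum>k\<in>UNIV. \<integral>\<^sup>+u. (\<Sum>m\<le>n. \<Sum>l | v l < 0. ?q m l * occ l (n - m) k (s + u)) \<partial>Um k j)"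
      unfolding entrance_def using Suc.IH[of "s + _"] s
      by (intro sum.cong refl nn_integral_cong_AE eventually_mono[OF AE_Um_nonneg]) (auto simp: add.assoc)
    also have "\<dots> = (\<Sum>k\<in>UNIV. \<Sum>m\<le>n. \<Sum>l | v l < 0. ?q m l * (\<integral>\<^sup>+u. occ l (n - m) k (s + u) \<partial>Um k j))"
      by (simp add: nn_integral_sum nn_integral_cmult)
    also have "\<dots> = (\<Sum>m\<le>n. \<Sum>k\<in>UNIV. \<Sum>l | v l < 0. ?q m l * (\<integral>\<^sup>+u. occ l (n - m) k (s + u) \<partial>Um k j))"
      by (rule sum.swap)
    also have "\<dots> = (\<Sum>m\<le>n. \<Sum>l | v l < 0. ?q m l * entrance (occ l (n - m)) j s)"
      unfolding entrance_def sum_distrib_left by (intro sum.cong refl sum.swap)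
    finally show ?thesis .
  qed
  \<comment> \<open>If the last sojourn starts above depth \<open>z\<close>, it crosses
    \<open>z\<close> itself, which requires \<open>v j < 0\<close>; this is the summand
    \<open>m = Suc n\<close>, \<open>l = j\<close>. If it starts below \<open>z\<close>, the passage
    lies in an earlier sojourn and \<open>e\<close> supplies the summands
    \<open>m \<le> n\<close>.\<close>
  let ?first = "if v j < 0 then ennreal \<bar>v j\<bar> * sojourn j z' else 0"
  have "occ i (Suc n) j (z + z') = (\<integral>\<^sup>+a. ?first * (?e a * sojourn j (z - a) * indicator {0<..} a)
      + ?e (z + (a - z)) * sojourn j (z' - (a - z)) * indicator {0<..} (a - z) \<partial>lborel)"
    unfolding occ.simps next_occ_def
  proof (intro nn_integral_cong_AE eventually_mono[OF AE_lborel_singleton[of z]])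
    fix a assume "a \<noteq> z"
    then consider "a < z" | "z < a" by linarith
    then show "?e a * sojourn j (z + z' - a) * indicator {0<..} a
      = ?first * (?e a * sojourn j (z - a) * indicator {0<..} a)
      + ?e (z + (a - z)) * sojourn j (z' - (a - z)) * indicator {0<..} (a - z)"
    proof cases
      case 1
      then show ?thesis using sojourn_add[of j "z - a" z'] Suc.prems v_nonzero[of j]
        by (cases "v j < 0") (auto simp: algebra_simps sojourn_def divide_le_0_iff)
    next
      case 2
      then show ?thesis using z
        by (auto simp: algebra_simps) (auto simp: sojourn_def divide_le_0_iff)
    qed
  qed
  also have "\<dots> = ?first * occ i (Suc n) j z
      + (\<integral>\<^sup>+a. ?e (z + (a - z)) * sojourn j (z' - (a - z)) * indicator {0<..} (a - z) \<partial>lborel)"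
    by (simp add: nn_integral_add nn_integral_cmult next_occ_def)
  also have "(\<integral>\<^sup>+a. ?e (z + (a - z)) * sojourn j (z' - (a - z)) * indicator {0<..} (a - z) \<partial>lborel)
      = (\<integral>\<^sup>+s. ?e (z + s) * sojourn j (z' - s) * indicator {0<..} s \<partial>lborel)"
    by (rule nn_integral_lborel_shift[of "\<lambda>s. ?e (z + s) * sojourn j (z' - s) * indicator {0<..} s"]) simp
  also have "\<dots> = (\<integral>\<^sup>+s. (\<Sum>m\<le>n. \<Sum>l | v l < 0. ?q m l * (entrance (occ l (n - m)) j s * sojourn j (z' - s) * indicator {0<..} s)) \<partial>lborel)"
    by (intro nn_integral_cong) (auto simp: e sum_distrib_right mult.assoc split: split_indicator)
  also have "\<dots> = (\<Sum>m\<le>n. \<Sum>l | v l < 0. ?q m l * occ l (Suc n - m) j z')"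
    by (simp add: nn_integral_sum nn_integral_cmult Suc_diff_le next_occ_def)
  also have "?first * occ i (Suc n) j z = (\<Sum>l | v l < 0. ?q (Suc n) l * occ l (Suc n - Suc n) j z')"
  proof -
    have "(\<Sum>l | v l < 0. ?q (Suc n) l * occ l 0 j z')
        = (\<Sum>l | v l < 0. if l = j then ennreal \<bar>v j\<bar> * sojourn j z' * occ i (Suc n) j z else 0)"
      by (intro sum.cong) (auto simp: mult_ac simp del: occ.simps(2))
    then show ?thesis by (simp del: occ.simps(2))
  qed
  finally show ?case by (simp del: occ.simps add: add.commute)
qed

lemma total_occ_add:
  assumes "v i < 0" "0 \<le> z" "0 \<le> z'"
  shows "total_occ i j (z + z') = (\<Sum>l | v l < 0. total_occ i l z * ennreal \<bar>v l\<bar> * total_occ l j z')"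
proof -
  have "total_occ i j (z + z') = (\<Sum>n. \<Sum>l | v l < 0. \<Sum>m\<le>n. (occ i m l z * ennreal \<bar>v l\<bar>) * occ l (n - m) j z')"
    unfolding total_occ_def occ_add[OF assms] by (subst sum.swap) simp
  also have "\<dots> = (\<Sum>l | v l < 0. \<Sum>n. \<Sum>m\<le>n. (occ i m l z * ennreal \<bar>v l\<bar>) * occ l (n - m) j z')"
    by (intro suminf_sum) (simp add: summableI)
  also have "\<dots> = (\<Sum>l | v l < 0. total_occ i l z * ennreal \<bar>v l\<bar> * total_occ l j z')"
    unfolding total_occ_def
    by (intro sum.cong refl, subst Cauchy_product_ennreal[where g = "\<lambda>n. occ _ n j z'"]) simp
  finally show ?thesis .
qed

text \<open>An occupation density times a speed is a flux through a level. With the weight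
  \<open>\<bar>v i\<bar>\<close> the semigroup property becomes a plain matrix product and the value
  at depth \<open>0\<close> is the identity on \<open>S\<^sup>-\<close>.\<close>

definition scaled_occ :: "'s \<Rightarrow> 's \<Rightarrow> real \<Rightarrow> real" where
  "scaled_occ i j z = \<bar>v i\<bar> * enn2real (total_occ i j z)"

text \<open>Scaled entrance density at the starting depth. By the semigroup property it determines
  the entrance density at every nonnegative depth.\<close>

definition \<rho> :: "'s \<Rightarrow> 's \<Rightarrow> real" where
  "\<rho> l j = \<bar>v l\<bar> * enn2real (entrance (total_occ l) j 0)"

text \<open>The generator on \<open>S\<^sup>-\<close>: these entries are the right derivatives of
  \<open>scaled_occ\<close> at depth \<open>0\<close>.\<close>

definition KG :: "real ^ 's ^ 's" where
  "KG = (\<chi> l j. if v l < 0 \<and> v j < 0 then ((if l = j then c j else 0) - \<rho> l j) / v j else 0)"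

definition LG :: "real ^ 's ^ 's" where
  "LG = (\<chi> i j. if v i < 0 \<and> v j > 0 then scaled_occ i j 0 else 0)"

lemma scaled_occ_nonneg: "0 \<le> scaled_occ i j z" and \<rho>_nonneg: "0 \<le> \<rho> l j"
  by (simp_all add: scaled_occ_def \<rho>_def)

lemma scaled_occ_measurable [measurable]: "scaled_occ i j \<in> borel_measurable borel"
  unfolding scaled_occ_def by measurable

section \<open>Finiteness, differential equation and exponential form of
  \<open>scaled_occ\<close>\<close>

context
  fixes K L :: "real ^ 's ^ 's"
  assumes KL: "KL_solution C D F v K L"
begin

text \<open>Domination by \<open>Eh\<close> excludes the value infinity, which
  \<open>enn2real\<close> would silently turn into \<open>0\<close>.\<close>

lemma total_occ_eq_scaled_occ:
  assumes "v i < 0" "0 \<le> z"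
  shows "total_occ i j z = ennreal (scaled_occ i j z / \<bar>v i\<bar>)"
  using total_occ_le_Eh[OF KL assms, of j] assms unfolding scaled_occ_def
  by (auto simp: ennreal_enn2real_if top_unique)

lemma scaled_occ_le_Eh:
  assumes "v i < 0" "0 \<le> z"
  shows "scaled_occ i j z \<le> (mexp (z *\<^sub>R K) ** I_L v L) $ i $ j"
proof -
  have "scaled_occ i j z / \<bar>v i\<bar> \<le> (mexp (z *\<^sub>R K) ** I_L v L) $ i $ j / \<bar>v i\<bar>"
    using total_occ_le_Eh[OF KL assms, of j] Eh_nonneg[OF KL assms(2), of i j]
    unfolding total_occ_eq_scaled_occ[OF assms] by (subst (asm) ennreal_le_iff) auto
  then show ?thesis using assms by (simp add: divide_le_cancel)
qed

lemma scaled_occ_add: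
  assumes i: "v i < 0" and z: "0 \<le> z" "0 \<le> z'"
  shows "scaled_occ i j (z + z') = (\<Sum>l | v l < 0. scaled_occ i l z * scaled_occ l j z')"
proof -
  have "ennreal (scaled_occ i j (z + z') / \<bar>v i\<bar>) = total_occ i j (z + z')"
    using i z by (simp add: total_occ_eq_scaled_occ)
  also have "\<dots> = (\<Sum>l | v l < 0. ennreal (scaled_occ i l z * scaled_occ l j z' / \<bar>v i\<bar>))"
    unfolding total_occ_add[OF i z]
  proof (intro sum.cong refl)
    fix l assume l: "l \<in> {l. v l < 0}"
    have nn: "0 \<le> \<bar>v l\<bar>" "0 \<le> scaled_occ l j z' / \<bar>v l\<bar>" by (simp_all add: scaled_occ_nonneg)
    have eq: "scaled_occ i l z / \<bar>v i\<bar> * \<bar>v l\<bar> * (scaled_occ l j z' / \<bar>v l\<bar>) = scaled_occ i l z * scaled_occ l j z' / \<bar>v i\<bar>"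
      using l by simp
    show "total_occ i l z * ennreal \<bar>v l\<bar> * total_occ l j z' = ennreal (scaled_occ i l z * scaled_occ l j z' / \<bar>v i\<bar>)"
      using i z l by (simp only: total_occ_eq_scaled_occ mem_Collect_eq nn[THEN ennreal_mult'', symmetric] eq)
  qed
  also have "\<dots> = ennreal ((\<Sum>l | v l < 0. scaled_occ i l z * scaled_occ l j z') / \<bar>v i\<bar>)"
    by (subst sum_ennreal) (auto simp: scaled_occ_nonneg sum_divide_distrib)
  finally have "scaled_occ i j (z + z') / \<bar>v i\<bar> = (\<Sum>l | v l < 0. scaled_occ i l z * scaled_occ l j z') / \<bar>v i\<bar>"
    by (subst (asm) ennreal_inj) (auto simp: scaled_occ_nonneg intro!: divide_nonneg_nonneg sum_nonneg)
  then show ?thesis using i by simp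
qed

lemma entrance_total_finite:
  assumes i: "v i < 0" and a: "0 \<le> a"
  shows "entrance (total_occ i) j a < \<infinity>"
proof -
  have "entrance (total_occ i) j a \<le> entrance (\<lambda>k z. ennreal (1 / \<bar>v i\<bar>) * ennreal ((mexp (z *\<^sub>R K) ** I_L v L) $ i $ k)) j a"
    using total_occ_le_Eh[OF KL i] Eh_nonneg[OF KL]
    by (intro entrance_mono a) (auto simp flip: ennreal_mult)
  also have "\<dots> = ennreal (1 / \<bar>v i\<bar>) * entrance (\<lambda>k z. ennreal ((mexp (z *\<^sub>R K) ** I_L v L) $ i $ k)) j a"
    unfolding entrance_def by (simp add: nn_integral_cmult sum_distrib_left)
  also have "\<dots> < \<infinity>"
    unfolding entrance_Eh[OF KL a] by (simp add: ennreal_mult_less_top)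
  finally show ?thesis .
qed

text \<open>Splitting at depth \<open>a\<close> pulls all dependence on \<open>a\<close> out of the
  jump integral. This is the step that replaces an integral equation by one with constant
  coefficients \<open>\<rho>\<close>.\<close>

lemma entrance_total_eq:
  assumes i: "v i < 0" and a: "0 \<le> a"
  shows "entrance (total_occ i) j a = ennreal ((\<Sum>l | v l < 0. scaled_occ i l a * \<rho> l j) / \<bar>v i\<bar>)"
proof -
  have "entrance (total_occ i) j a
      = (\<Sum>k\<in>UNIV. \<integral>\<^sup>+u. (\<Sum>l | v l < 0. total_occ i l a * ennreal \<bar>v l\<bar> * total_occ l k u) \<partial>Um k j)"
    unfolding entrance_def
    by (intro sum.cong refl nn_integral_cong_AE eventually_mono[OF AE_Um_nonneg] total_occ_add i a)
  also have "\<dots> = (\<Sum>l | v l < 0. total_occ i l a * ennreal \<bar>v l\<bar> * entrance (total_occ l) j 0)"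
    by (simp add: nn_integral_sum nn_integral_cmult entrance_def sum_distrib_left) (rule sum.swap)
  also have "\<dots> = (\<Sum>l | v l < 0. ennreal (scaled_occ i l a * \<rho> l j / \<bar>v i\<bar>))"
  proof (intro sum.cong refl)
    fix l assume "l \<in> {l. v l < 0}"
    then have "ennreal \<bar>v l\<bar> * entrance (total_occ l) j 0 = ennreal (\<rho> l j)"
      using entrance_total_finite[of l 0 j] unfolding \<rho>_def
      by (subst ennreal_mult) (simp_all add: ennreal_enn2real_if)
    then show "total_occ i l a * ennreal \<bar>v l\<bar> * entrance (total_occ l) j 0 = ennreal (scaled_occ i l a * \<rho> l j / \<bar>v i\<bar>)"
      using i a by (simp only: mult.assoc total_occ_eq_scaled_occ ennreal_mult''[OF \<rho>_nonneg, symmetric]) simp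
  qed
  also have "\<dots> = ennreal ((\<Sum>l | v l < 0. scaled_occ i l a * \<rho> l j) / \<bar>v i\<bar>)"
    by (subst sum_ennreal) (auto simp: scaled_occ_nonneg \<rho>_nonneg sum_divide_distrib)
  finally show ?thesis .
qed

text \<open>In a downward state, later sojourns start strictly below the initial level and only
  descend, so depth \<open>0\<close> is seen by the initial sojourn alone.\<close>

lemma scaled_occ_0: "v i < 0 \<Longrightarrow> v j < 0 \<Longrightarrow> scaled_occ i j 0 = (if i = j then 1 else 0)"
proof -
  assume i: "v i < 0" and j: "v j < 0"
  have "next_occ (total_occ i) j 0 = 0"
    unfolding next_occ_def using j
    by (subst nn_integral_0_iff_AE) (auto simp: sojourn_def zero_le_divide_iff split: split_indicator)
  then have "total_occ i j 0 = (if i = j then ennreal (1 / \<bar>v i\<bar>) else 0)"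
    using i by (subst total_occ_eq) (auto simp: sojourn_def)
  then show ?thesis using i by (auto simp: scaled_occ_def)
qed

definition R :: "'s \<Rightarrow> 's \<Rightarrow> real \<Rightarrow> real" where
  "R i j a = (\<Sum>l | v l < 0. scaled_occ i l a * \<rho> l j)"

text \<open>Integrand of the variation of constants formula, with the factor depending on
  \<open>z\<close> taken out so that \<open>z\<close> remains only in the integration
  bounds.\<close>

definition Rexp :: "'s \<Rightarrow> 's \<Rightarrow> real \<Rightarrow> real" where
  "Rexp i j a = R i j a * exp (- (c j * a / v j)) / \<bar>v j\<bar>"

lemma R_nonneg: "0 \<le> R i j a"
  unfolding R_def by (intro sum_nonneg mult_nonneg_nonneg scaled_occ_nonneg \<rho>_nonneg)

lemma Rexp_nonneg: "0 \<le> Rexp i j a"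
  unfolding Rexp_def by (simp add: R_nonneg)

lemma Rexp_measurable [measurable]: "Rexp i j \<in> borel_measurable borel"
  unfolding Rexp_def R_def by measurable

lemma entrance_sojourn:
  assumes "v i < 0" "0 \<le> a"
  shows "entrance (total_occ i) j a * sojourn j (z - a)
    = (if (z - a) / v j \<le> 0 then ennreal (exp (c j * z / v j) / \<bar>v i\<bar>) * ennreal (Rexp i j a) else 0)"
proof -
  have "R i j a / \<bar>v i\<bar> * (exp (c j * (z - a) / v j) / \<bar>v j\<bar>) = exp (c j * z / v j) / \<bar>v i\<bar> * Rexp i j a"
    by (simp add: Rexp_def right_diff_distrib diff_divide_distrib exp_diff exp_minus field_simps)
  then show ?thesis
    using R_nonneg[of i j a] Rexp_nonneg[of i j a]
    by (simp add: entrance_total_eq[OF assms] R_def[symmetric] sojourn_def flip: ennreal_mult)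
qed

text \<open>For \<open>v j < 0\<close> the renewal equation integrates over \<open>[0, z]\<close>.
  For \<open>v j > 0\<close> it integrates over \<open>[z, \<infinity>)\<close>, and comparing
  depths \<open>0\<close> and \<open>z\<close> leaves the integral over \<open>[0, z]\<close> with
  the opposite sign; \<open>sgn\<close> unites the cases. Finiteness of the integral is part of the
  result, forced by finiteness of \<open>scaled_occ\<close>.\<close>

lemma scaled_occ_integral_aux:
  assumes i: "v i < 0" and z: "0 \<le> z"
  shows "\<exists>r\<ge>0. (\<integral>\<^sup>+a. ennreal (Rexp i j a) * indicator {0..z} a \<partial>lborel) = ennreal r
    \<and> scaled_occ i j z * exp (- (c j * z / v j)) = scaled_occ i j 0 - sgn (v j) * r"
proof -
  let ?\<kappa> = "\<lambda>z. exp (c j * z / v j) / \<bar>v i\<bar>"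
  let ?I = "\<integral>\<^sup>+a. ennreal (Rexp i j a) * indicator {0..z} a \<partial>lborel"
  have \<kappa>: "0 < ?\<kappa> z" for z using i by (simp add: divide_less_0_iff)
  have \<kappa>_top: "ennreal (?\<kappa> z) * \<top> = \<top>" for z
    using \<kappa>[of z] i by (subst ennreal_mult_eq_top_iff) simp
  have scaled_occ\<kappa>: "scaled_occ i j z / \<bar>v i\<bar> = ?\<kappa> z * (scaled_occ i j z * exp (- (c j * z / v j)))" for z
    by (simp add: exp_minus)
  show ?thesis
  proof (cases "v j < 0")
    case True
    have "next_occ (total_occ i) j z = ennreal (?\<kappa> z) * ?I"
      unfolding next_occ_def
      by (subst nn_integral_cmult[symmetric], measurable)
        (intro nn_integral_cong_AE eventually_mono[OF AE_lborel_singleton[of 0]],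
          use True i in \<open>auto simp: entrance_sojourn divide_le_0_iff indicator_def\<close>)
    moreover have "occ i 0 j z = ennreal (?\<kappa> z) * ennreal (scaled_occ i j 0)"
      using i True z scaled_occ_0[of i j] by (auto simp: sojourn_def divide_le_0_iff)
    ultimately have eq: "ennreal (scaled_occ i j z / \<bar>v i\<bar>) = ennreal (?\<kappa> z) * ennreal (scaled_occ i j 0) + ennreal (?\<kappa> z) * ?I"
      using total_occ_eq[of i j z] total_occ_eq_scaled_occ[OF i z, of j] by simp
    have "?I \<noteq> \<top>"
    proof
      assume "?I = \<top>"
      then show False using eq by (simp add: \<kappa>_top)
    qed
    then obtain r where r: "0 \<le> r" "?I = ennreal r" by (cases ?I) auto
    have "ennreal (?\<kappa> z * (scaled_occ i j z * exp (- (c j * z / v j)))) = ennreal (?\<kappa> z * (scaled_occ i j 0 + r))"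
      using eq \<kappa>[of z] r scaled_occ_nonneg[of i j 0] unfolding scaled_occ\<kappa>
      by (simp add: ennreal_mult[symmetric] ennreal_plus[symmetric] distrib_left del: ennreal_plus)
    then have "scaled_occ i j z * exp (- (c j * z / v j)) = scaled_occ i j 0 + r"
      using \<kappa>[of z] r scaled_occ_nonneg[of i j] by (subst (asm) ennreal_inj) auto
    then show ?thesis using r True by auto
  next
    case False
    then have vj: "0 < v j" using v_nonzero[of j] by auto
    let ?J = "\<lambda>z. \<integral>\<^sup>+a. ennreal (Rexp i j a) * indicator {z..} a \<partial>lborel"
    have J: "?J z = ennreal (scaled_occ i j z * exp (- (c j * z / v j)))" if z: "0 \<le> z" for z
    proof -
      have "next_occ (total_occ i) j z = ennreal (?\<kappa> z) * ?J z"
        unfolding next_occ_def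
        by (subst nn_integral_cmult[symmetric], measurable)
          (intro nn_integral_cong_AE eventually_mono[OF AE_lborel_singleton[of 0]],
            use vj i z in \<open>auto simp: entrance_sojourn divide_le_0_iff indicator_def\<close>)
      moreover have "occ i 0 j z = 0" using i vj by auto
      ultimately have eq: "ennreal (scaled_occ i j z / \<bar>v i\<bar>) = ennreal (?\<kappa> z) * ?J z"
        using total_occ_eq[of i j z] total_occ_eq_scaled_occ[OF i z, of j] by simp
      have "?J z \<noteq> \<top>"
      proof
        assume "?J z = \<top>"
        then show False using eq by (simp add: \<kappa>_top)
      qed
      then obtain r where r: "0 \<le> r" "?J z = ennreal r" by (cases "?J z") auto
      have "ennreal (?\<kappa> z * (scaled_occ i j z * exp (- (c j * z / v j)))) = ennreal (?\<kappa> z * r)"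
        using eq \<kappa>[of z] r unfolding scaled_occ\<kappa> by (simp add: ennreal_mult[symmetric])
      then show ?thesis
        using \<kappa>[of z] r scaled_occ_nonneg[of i j] by (subst (asm) ennreal_inj) auto
    qed
    have "?J 0 = (\<integral>\<^sup>+a. ennreal (Rexp i j a) * indicator {0..z} a + ennreal (Rexp i j a) * indicator {z..} a \<partial>lborel)"
      using z by (intro nn_integral_cong_AE eventually_mono[OF AE_lborel_singleton[of z]])
        (auto split: split_indicator)
    also have "\<dots> = ?I + ?J z" by (intro nn_integral_add) auto
    finally have eq: "ennreal (scaled_occ i j 0) = ?I + ennreal (scaled_occ i j z * exp (- (c j * z / v j)))"
      using J z by simp
    then have "?I \<noteq> \<top>" by auto
    then obtain r where r: "0 \<le> r" "?I = ennreal r" by (cases ?I) auto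
    have "scaled_occ i j 0 = r + scaled_occ i j z * exp (- (c j * z / v j))"
      using eq r scaled_occ_nonneg[of i j]
      by (simp add: ennreal_plus[symmetric] del: ennreal_plus)
    then show ?thesis using r vj by auto
  qed
qed

lemma scaled_occ_integral:
  assumes i: "v i < 0" and z: "0 \<le> z"
  shows "Rexp i j integrable_on {0..z}"
    and "scaled_occ i j z = exp (c j * z / v j) * (scaled_occ i j 0 - sgn (v j) * integral {0..z} (Rexp i j))"
proof -
  obtain r where r: "r \<ge> 0" "(\<integral>\<^sup>+a. ennreal (Rexp i j a) * indicator {0..z} a \<partial>lborel) = ennreal r"
      "scaled_occ i j z * exp (- (c j * z / v j)) = scaled_occ i j 0 - sgn (v j) * r"
    using scaled_occ_integral_aux[OF assms] by blast
  have "has_bochner_integral lborel (\<lambda>a. indicator {0..z} a *\<^sub>R Rexp i j a) r"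
    by (rule has_bochner_integral_nn_integral)
      (use r Rexp_nonneg in \<open>auto simp: ennreal_mult'[symmetric] ennreal_indicator[symmetric] mult.commute\<close>)
  then have "set_integrable lborel {0..z} (Rexp i j)" "(LINT a:{0..z}|lborel. Rexp i j a) = r"
    by (auto simp: set_integrable_def set_lebesgue_integral_def has_bochner_integral_iff)
  then have I: "Rexp i j integrable_on {0..z}" "integral {0..z} (Rexp i j) = r"
    using set_borel_integral_eq_integral[of "{0..z}" "Rexp i j"] by auto
  show "Rexp i j integrable_on {0..z}" by (rule I)
  show "scaled_occ i j z = exp (c j * z / v j) * (scaled_occ i j 0 - sgn (v j) * integral {0..z} (Rexp i j))"
    unfolding I(2) r(3)[symmetric] by (simp add: exp_minus)
qed

lemma scaled_occ_continuous:
  assumes i: "v i < 0"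
  shows "continuous_on {0..} (scaled_occ i j)"
proof -
  have "continuous_on {0..N} (scaled_occ i j)" for N
  proof (cases "0 \<le> N")
    case True
    have "continuous_on {0..N} (\<lambda>z. exp (c j * z / v j) * (scaled_occ i j 0 - sgn (v j) * integral {0..z} (Rexp i j)))"
      using v_nonzero by (intro continuous_intros indefinite_integral_continuous_1 scaled_occ_integral i True) auto
    then show ?thesis
      by (rule continuous_on_cong[OF refl, THEN iffD1, rotated]) (simp add: scaled_occ_integral(2)[OF i, symmetric])
  qed simp
  then show ?thesis
    unfolding continuous_on_eq_continuous_within
    using at_within_atLeast_eq[of x "x + 1" for x]
    by (metis atLeastAtMost_iff atLeast_iff less_add_one less_imp_le)
qed

text \<open>Bootstrapping: the integral formula makes \<open>scaled_occ\<close> continuous, hence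
  the integrand \<open>Rexp\<close> is continuous, hence the integral is differentiable.\<close>

lemma scaled_occ_has_derivative:
  assumes i: "v i < 0" and z: "0 \<le> z"
  shows "(scaled_occ i j has_real_derivative (c j * scaled_occ i j z - R i j z) / v j) (at z within {0..})"
proof -
  let ?\<phi> = "\<lambda>z. exp (c j * z / v j) * (scaled_occ i j 0 - sgn (v j) * integral {0..z} (Rexp i j))"
  have "continuous_on {0..z + 1} (scaled_occ i l)" for l
    by (rule continuous_on_subset[OF scaled_occ_continuous[OF i]]) auto
  then have "continuous_on {0..z + 1} (Rexp i j)"
    unfolding Rexp_def R_def using v_nonzero[of j] by (intro continuous_intros) auto
  then have "((\<lambda>z. integral {0..z} (Rexp i j)) has_real_derivative Rexp i j z) (at z within {0..z + 1})"
    using z by (intro integral_has_real_derivative) auto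
  then have D: "(?\<phi> has_real_derivative (exp (c j * z / v j) * (c j / v j)) * (scaled_occ i j 0 - sgn (v j) * integral {0..z} (Rexp i j))
      + - (sgn (v j) * Rexp i j z) * exp (c j * z / v j)) (at z within {0..z + 1})"
    using v_nonzero[of j] by (auto intro!: derivative_eq_intros)
  have e1: "(exp (c j * z / v j) * (c j / v j)) * (scaled_occ i j 0 - sgn (v j) * integral {0..z} (Rexp i j))
      = c j * scaled_occ i j z / v j"
    using scaled_occ_integral(2)[OF i z, of j] by simp
  have e2: "sgn (v j) * Rexp i j z * exp (c j * z / v j) = R i j z / v j"
    using v_nonzero[of j] by (simp add: Rexp_def exp_minus sgn_if)
  have "(?\<phi> has_real_derivative (c j * scaled_occ i j z - R i j z) / v j) (at z within {0..z + 1})"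
    using D unfolding e1 mult_minus_left e2 by (simp add: diff_divide_distrib)
  then have "(scaled_occ i j has_real_derivative (c j * scaled_occ i j z - R i j z) / v j) (at z within {0..z + 1})"
    by (rule has_field_derivative_transform_within[where d = 1]) (use z i in \<open>auto simp: scaled_occ_integral(2)[symmetric]\<close>)
  then show ?thesis using at_within_atLeast_eq[of z "z + 1"] by simp
qed

lemma scaled_occ_eq_mexp:
  assumes i: "v i < 0" and z: "0 \<le> z"
  shows "v j < 0 \<Longrightarrow> mexp (z *\<^sub>R KG) $ i $ j = scaled_occ i j z"
    and "(mexp (z *\<^sub>R KG) ** I_L v LG) $ i $ j = scaled_occ i j z"
proof -
  \<comment> \<open>The block of \<open>scaled_occ\<close> is completed by the identity because
    \<open>KG\<close> vanishes outside \<open>S\<^sup>- \<times> S\<^sup>-\<close>; so completed, it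
    satisfies \<open>B' = B KG\<close> as a full matrix.\<close>
  let ?B = "\<lambda>z. (\<chi> i j. if v i < 0 \<and> v j < 0 then scaled_occ i j z else if i = j then 1 else 0) :: real ^ 's ^ 's"
  have "?B z = ?B 0 ** mexp (z *\<^sub>R KG)"
  proof (rule linear_ODE_mexp_unique[OF _ z])
    fix t :: real and i j :: 's
    assume t: "0 \<le> t"
    show "((\<lambda>t. ?B t $ i $ j) has_real_derivative (?B t ** KG) $ i $ j) (at t within {0..})"
    proof (cases "v i < 0 \<and> v j < 0")
      case True
      have "(?B t ** KG) $ i $ j = (\<Sum>l | v l < 0. scaled_occ i l t * KG $ l $ j)"
        unfolding matrix_mult_nth using True by (intro sum.mono_neutral_cong_right) (auto simp: KG_def)
      also have "\<dots> = (\<Sum>l | v l < 0. (if l = j then c j * scaled_occ i j t / v j else 0) - scaled_occ i l t * \<rho> l j / v j)"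
        using True by (intro sum.cong) (auto simp: KG_def field_simps)
      also have "\<dots> = (c j * scaled_occ i j t - R i j t) / v j"
        using True by (simp add: sum_subtractf R_def sum_divide_distrib diff_divide_distrib)
      finally show ?thesis using True scaled_occ_has_derivative[of i t j] t by simp
    next
      case False
      then have "(?B t ** KG) $ i $ j = 0"
        unfolding matrix_mult_nth by (intro sum.neutral) (auto simp: KG_def)
      moreover have "(\<lambda>t. ?B t $ i $ j) = (\<lambda>t. if i = j then 1 else 0)" using False by auto
      ultimately show ?thesis by (simp only: DERIV_const)
    qed
  qed
  moreover have "?B 0 = mat 1"
    by (auto simp: vec_eq_iff mat_def scaled_occ_0)
  ultimately have B: "mexp (z *\<^sub>R KG) = ?B z" by simp
  then show "v j < 0 \<Longrightarrow> mexp (z *\<^sub>R KG) $ i $ j = scaled_occ i j z" using i by simp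
  \<comment> \<open>Columns in \<open>S\<^sup>+\<close> have no differential equation within the
    block; they follow from the semigroup property with second depth \<open>0\<close>, where
    \<open>LG\<close> holds the values.\<close>
  have "(?B z ** I_L v LG) $ i $ j = (\<Sum>l | v l < 0. scaled_occ i l z * scaled_occ l j 0)"
    unfolding matrix_mult_nth using i v_nonzero[of j]
    by (intro sum.mono_neutral_cong_right) (auto simp: I_L_def LG_def scaled_occ_0 not_less order_less_le)
  then show "(mexp (z *\<^sub>R KG) ** I_L v LG) $ i $ j = scaled_occ i j z"
    using scaled_occ_add[OF i z, of 0 j] B by simp
qed

text \<open>A zero row of \<open>KG\<close> keeps that row of the exponential equal to the identity
  row, which selects a zero row of \<open>I_L\<close>.\<close>

lemma mexp_KG_row_0:
  assumes i: "\<not> v i < 0" and z: "0 \<le> z"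
  shows "(mexp (z *\<^sub>R KG) ** I_L v LG) $ i $ j = 0"
proof -
  have "((\<lambda>z. (mexp (z *\<^sub>R KG)) $ i $ l) has_real_derivative 0) (at z within {0..})" for l z
  proof -
    have "(KG ** mexp (z *\<^sub>R KG)) $ i $ l = 0"
      using i by (simp add: matrix_mult_nth KG_def)
    then show ?thesis using has_real_derivative_mexp_nth[of KG i l z] by simp
  qed
  then have "\<exists>d. \<forall>z\<in>{0..}. mexp (z *\<^sub>R KG) $ i $ l = d" for l
    using has_field_derivative_zero_constant[of "{0::real..}"] by auto
  then have "mexp (z *\<^sub>R KG) $ i $ l = mexp (0 *\<^sub>R KG) $ i $ l" for l
    using z by (metis atLeast_iff order_refl)
  then show ?thesis using i by (auto simp: matrix_mult_nth mat_def I_L_def intro!: sum.neutral)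
qed

text \<open>The KL equation is the differential equation of \<open>scaled_occ\<close> at depth
  \<open>0\<close>, with \<open>\<rho>\<close> written out as a jump integral. The required
  integrability is inherited from the given solution by domination.\<close>

lemma KL_solution_G: "KL_solution C D F v KG LG"
proof -
  let ?E = "\<lambda>u. mexp (u *\<^sub>R KG) ** I_L v LG"
  have "set_integrable (Dm k j) {0..} (\<lambda>u. ?E u $ i $ k)" for i j k
  proof (cases "v i < 0")
    case True
    show ?thesis
      unfolding set_integrable_def
    proof (rule Bochner_Integration.integrable_bound[OF Eh_integrable[OF KL, unfolded set_integrable_def, of k j i]])
      show "AE x in Dm k j. norm (indicat_real {0..} x *\<^sub>R ?E x $ i $ k)
          \<le> norm (indicat_real {0..} x *\<^sub>R (mexp (x *\<^sub>R K) ** I_L v L) $ i $ k)"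
        using True order_trans[OF scaled_occ_le_Eh[OF True] abs_ge_self] scaled_occ_nonneg[of i k]
        by (intro AE_I2) (auto simp: scaled_occ_eq_mexp indicator_def)
    qed measurable
  next
    case False
    then have "(\<lambda>u. indicat_real {0..} u *\<^sub>R ?E u $ i $ k) = (\<lambda>u. 0)"
      by (auto simp: indicator_def mexp_KG_row_0)
    then show ?thesis unfolding set_integrable_def by simp
  qed
  then have int: "matrix_integrable {0..} ?E (D_measure D F)"
    unfolding matrix_integrable_def by blast
  have eq: "- ((KG ** I_L v LG) $ i $ j * v j) = (I_L v LG ** C + matrix_integral {0..} ?E (D_measure D F)) $ i $ j" for i j
  proof (cases "v i < 0")
    case i: True
    have "((\<lambda>z. ?E z $ i $ j) has_real_derivative (KG ** I_L v LG) $ i $ j) (at 0 within {0..})"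
      using has_real_derivative_mexp_mult[of KG "I_L v LG" i j 0] by simp
    then have "(scaled_occ i j has_real_derivative (KG ** I_L v LG) $ i $ j) (at 0 within {0..})"
      by (rule has_field_derivative_transform_within[where d = 1]) (auto simp: scaled_occ_eq_mexp i)
    moreover have "(scaled_occ i j has_real_derivative (c j * scaled_occ i j 0 - R i j 0) / v j) (at 0 within {0..})"
      using scaled_occ_has_derivative[OF i, of 0] by simp
    moreover have "at (0::real) within {0..} \<noteq> bot"
      using at_within_atLeast_eq[of 0 1] by (simp add: at_within_Icc_at_right)
    ultimately have "(KG ** I_L v LG) $ i $ j = (c j * scaled_occ i j 0 - R i j 0) / v j"
      using has_field_derivative_unique by blast
    moreover have "R i j 0 = \<rho> i j"
    proof -
      have "R i j 0 = (\<Sum>l | v l < 0. if l = i then \<rho> i j else 0)"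
        unfolding R_def by (intro sum.cong) (auto simp: scaled_occ_0 i)
      then show ?thesis using i by simp
    qed
    ultimately have 1: "- ((KG ** I_L v LG) $ i $ j * v j) = \<rho> i j - c j * scaled_occ i j 0"
      using v_nonzero[of j] by simp
    have E0: "I_L v LG $ i $ k = scaled_occ i k 0" for k
      using scaled_occ_eq_mexp(2)[OF i, of 0 k] by simp
    have nonneg: "0 \<le> (LINT u:{0..}|Dm k j. ?E u $ i $ k)" for k
      unfolding set_lebesgue_integral_def
      by (intro Bochner_Integration.integral_nonneg) (auto simp: indicator_def scaled_occ_eq_mexp i scaled_occ_nonneg)
    have nonneg': "0 \<le> scaled_occ i k 0 * Coff k j + (LINT u:{0..}|Dm k j. ?E u $ i $ k)" for k
      using Coff_nonneg[of k j] scaled_occ_nonneg[of i k 0] nonneg[of k] by simp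
    have "ennreal \<bar>v i\<bar> * entrance (total_occ i) j 0
        = (\<Sum>k\<in>UNIV. ennreal (scaled_occ i k 0 * Coff k j + (LINT u:{0..}|Dm k j. ?E u $ i $ k)))"
      unfolding entrance_def sum_distrib_left
    proof (intro sum.cong refl)
      fix k
      have "ennreal \<bar>v i\<bar> * total_occ i k u = ennreal (scaled_occ i k u)" if "0 \<le> u" for u
        using i that by (simp add: total_occ_eq_scaled_occ ennreal_mult'[symmetric])
      then have "ennreal \<bar>v i\<bar> * (\<integral>\<^sup>+u. total_occ i k (0 + u) \<partial>Um k j) = (\<integral>\<^sup>+u. ennreal (scaled_occ i k u) \<partial>Um k j)"
        by (subst nn_integral_cmult[symmetric])
          (auto intro!: nn_integral_cong_AE eventually_mono[OF AE_Um_nonneg])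
      moreover have "ennreal (LINT u:{0..}|Dm k j. ?E u $ i $ k)
          = (\<integral>\<^sup>+u. ennreal (indicator {0..} u *\<^sub>R ?E u $ i $ k) \<partial>Dm k j)"
        unfolding set_lebesgue_integral_def
        by (intro nn_integral_eq_integral[symmetric] int[unfolded matrix_integrable_def set_integrable_def, rule_format])
          (auto simp: indicator_def scaled_occ_eq_mexp i scaled_occ_nonneg)
      moreover have "\<dots> = (\<integral>\<^sup>+u. ennreal (scaled_occ i k u) \<partial>Dm k j)"
        by (intro nn_integral_cong_AE eventually_mono[OF AE_Dm_pos]) (auto simp: scaled_occ_eq_mexp i)
      ultimately show "ennreal \<bar>v i\<bar> * (\<integral>\<^sup>+u. total_occ i k (0 + u) \<partial>Um k j)
          = ennreal (scaled_occ i k 0 * Coff k j + (LINT u:{0..}|Dm k j. ?E u $ i $ k))"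
        using Coff_nonneg[of k j] scaled_occ_nonneg[of i k 0] nonneg[of k]
        by (simp add: nn_integral_Um ennreal_mult mult.commute)
    qed
    also have "\<dots> = ennreal (\<Sum>k\<in>UNIV. scaled_occ i k 0 * Coff k j + (LINT u:{0..}|Dm k j. ?E u $ i $ k))"
      by (rule sum_ennreal) (rule nonneg')
    finally have "\<rho> i j = enn2real (ennreal (\<Sum>k\<in>UNIV. scaled_occ i k 0 * Coff k j + (LINT u:{0..}|Dm k j. ?E u $ i $ k)))"
      unfolding \<rho>_def by (metis abs_ge_zero enn2real_ennreal enn2real_mult)
    also have "\<dots> = (\<Sum>k\<in>UNIV. scaled_occ i k 0 * Coff k j + (LINT u:{0..}|Dm k j. ?E u $ i $ k))"
      by (intro enn2real_ennreal sum_nonneg nonneg')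
    finally have "\<rho> i j = \<dots>" .
    then have "\<rho> i j - c j * scaled_occ i j 0 = (\<Sum>k\<in>UNIV. scaled_occ i k 0 * C $ k $ j) + (\<Sum>k\<in>UNIV. (LINT u:{0..}|Dm k j. ?E u $ i $ k))"
      using total_rate_sum[of "\<lambda>k. scaled_occ i k 0" j] by (simp add: sum.distrib)
    then show ?thesis unfolding 1 by (simp add: matrix_mult_nth[of _ C] E0 matrix_integral_def)
  next
    case False
    have "(LINT u:{0..}|Dm k j. ?E u $ i $ k) = 0" for k
      using False by (subst set_lebesgue_integral_cong[where g = "\<lambda>u. 0"]) (auto simp: mexp_KG_row_0)
    moreover have "I_L v LG $ i $ k = 0" "KG $ i $ k = 0" for k
      using False by (simp_all add: I_L_def KG_def)
    ultimately show ?thesis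
      by (simp add: matrix_mult_nth[of _ C] matrix_mult_nth[of KG] matrix_integral_def)
  qed
  show ?thesis
    unfolding KL_solution_def KL_equation_iff
  proof (intro conjI int allI eq)
    show "supported_on {i. v i < 0} {i. v i < 0} KG" by (simp add: supported_on_def KG_def)
    show "supported_on {i. v i < 0} {i. v i > 0} LG" by (simp add: supported_on_def LG_def)
    \<comment> \<open>Off the diagonal the entry is \<open>- \<rho> l j / v j\<close> with
      \<open>v j < 0\<close>.\<close>
    show "is_ML_matrix KG" using \<rho>_nonneg by (auto simp: is_ML_matrix_def KG_def divide_le_0_iff less_imp_le)
    show "0 \<le> LG $ i $ j" for i j by (simp add: LG_def scaled_occ_nonneg)
  qed
qed

end

text \<open>Minimality gives \<open>K \<le> KG\<close> and \<open>L \<le> LG\<close> entrywise. The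
  reverse inequalities come from domination: at depth \<open>0\<close> for \<open>L\<close>, and to
  first order at depth \<open>0\<close> for \<open>K\<close>.\<close>

theorem total_occ_eq_Eh:
  assumes min: "minimal_KL_solution C D F v K L" and i: "v i < 0" and z: "0 \<le> z"
  shows "total_occ i j z = ennreal ((mexp (z *\<^sub>R K) ** I_L v L) $ i $ j / \<bar>v i\<bar>)"
proof -
  have KL: "KL_solution C D F v K L"
    and le: "K $ i $ j \<le> KG $ i $ j" "L $ i $ j \<le> LG $ i $ j" for i j
    using min KL_solution_G unfolding minimal_KL_solution_def by blast+
  have "L $ i $ j = LG $ i $ j" for i j
  proof (cases "v i < 0 \<and> v j > 0")
    case True
    then have "LG $ i $ j \<le> L $ i $ j" using scaled_occ_le_Eh[OF KL, of i 0 j] by (simp add: LG_def I_L_def)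
    then show ?thesis using le(2)[of i j] by simp
  next
    case False
    then show ?thesis using KL by (auto simp: KL_solution_def supported_on_def LG_def)
  qed
  then have L: "L = LG" by (simp add: vec_eq_iff)
  have "K $ i $ j = KG $ i $ j" for i j
  proof (cases "v i < 0 \<and> v j < 0")
    case True
    then have i: "v i < 0" and j: "v j < 0" by auto
    let ?d = "\<lambda>z. (mexp (z *\<^sub>R K) ** I_L v L) $ i $ j - (mexp (z *\<^sub>R KG) ** I_L v LG) $ i $ j"
    have e: "(X ** I_L v L') $ i $ j = X $ i $ j" if "supported_on {i. v i < 0} {i. v i < 0} X" for X L'
      unfolding matrix_mult_nth using that j
      by (subst sum.remove[of _ j]) (auto simp: I_L_def supported_on_def intro!: sum.neutral split: if_splits)
    have sK: "supported_on {i. v i < 0} {i. v i < 0} K" "supported_on {i. v i < 0} {i. v i < 0} KG"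
      using KL KL_solution_G[OF KL] by (auto simp: KL_solution_def)
    have d: "(?d has_real_derivative K $ i $ j - KG $ i $ j) (at 0 within {0..})"
      using DERIV_diff[OF has_real_derivative_mexp_mult[of K "I_L v L" i j 0 "{0..}"]
          has_real_derivative_mexp_mult[of KG "I_L v LG" i j 0 "{0..}"]]
      by (simp add: e sK)
    have "0 \<le> ?d z" if "0 \<le> z" for z
      using scaled_occ_le_Eh[OF KL i that, of j] scaled_occ_eq_mexp(2)[OF KL i that] by simp
    moreover have "?d 0 = 0" using i j by (simp add: I_L_def)
    \<comment> \<open>\<open>?d\<close> is nonnegative and vanishes at \<open>0\<close>, so its
      right derivative \<open>K - KG\<close> there cannot be negative.\<close>
    ultimately have "\<not> K $ i $ j - KG $ i $ j < 0"
      using has_real_derivative_neg_dec_right[OF d] by (auto simp: not_less[symmetric]) (metis field_lbound_gt_zero less_le_not_le zero_less_one)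
    then show ?thesis using le(1)[of i j] by simp
  next
    case False
    then show ?thesis using KL by (auto simp: KL_solution_def supported_on_def KG_def)
  qed
  then have "K = KG" by (simp add: vec_eq_iff)
  then show ?thesis
    using total_occ_eq_scaled_occ[OF KL i z] scaled_occ_eq_mexp(2)[OF KL i z] L by simp
qed

end

section \<open>The Markov property of the jump chain\<close>

context markov_additive_process
begin

section \<open>The chain embedded at the transition instants and its measurability\<close>

definition X :: "nat \<Rightarrow> 'a \<Rightarrow> real" where
  "X n \<omega> = Y (T n \<omega>) \<omega>"

definition St :: "nat \<Rightarrow> 'a \<Rightarrow> 's" where
  "St n \<omega> = M (T n \<omega>) \<omega>"

definition hold :: "nat \<Rightarrow> 'a \<Rightarrow> real" where
  "hold n \<omega> = T (Suc n) \<omega> - T n \<omega>"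

text \<open>\<open>hold n\<close> and \<open>jump n\<close> share the index of the sojourn that
  starts at \<open>T n\<close>; the jump occurs at its end, at transition
  \<open>Suc n\<close>.\<close>

definition jump :: "nat \<Rightarrow> 'a \<Rightarrow> real" where
  "jump n \<omega> = X (Suc n) \<omega> - (X n \<omega> + v (St n \<omega>) * hold n \<omega>)"

lemma X_0: "\<omega> \<in> space P \<Longrightarrow> X 0 \<omega> = 0"
  by (simp add: X_def T_0 Y_0)

lemma St_0: "\<omega> \<in> space P \<Longrightarrow> St 0 \<omega> = M 0 \<omega>"
  by (simp add: St_def T_0)

lemma X_Suc: "X (Suc n) \<omega> = X n \<omega> + v (St n \<omega>) * hold n \<omega> + jump n \<omega>"
  by (simp add: jump_def)

lemma T_less: "\<omega> \<in> space P \<Longrightarrow> m < n \<Longrightarrow> T m \<omega> < T n \<omega>"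
  using T_strict_mono by (auto simp: strict_mono_def)

lemma T_nonneg: "\<omega> \<in> space P \<Longrightarrow> 0 \<le> T n \<omega>"
  using T_less[of \<omega> 0 n] T_0 by (cases "n = 0") auto

text \<open>\<open>M\<close> and \<open>Y\<close> are given as measurable at fixed times only. Every
  sojourn contains a rational time, from which the state and, after removing the drift, the level at
  \<open>T n\<close> can be recovered by a countable union.\<close>

lemma rat_in_sojourn:
  assumes "\<omega> \<in> space P"
  shows "\<exists>q\<in>\<rat> \<inter> {0..}. T n \<omega> \<le> q \<and> q < T (Suc n) \<omega>"
proof -
  obtain q where "q \<in> \<rat>" "T n \<omega> < q" "q < T (Suc n) \<omega>"
    using Rats_dense_in_real[OF T_less[OF assms lessI]] by blast
  then show ?thesis using T_nonneg[OF assms, of n] by (intro bexI[of _ q]) auto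
qed

lemma T_measurable' [measurable]: "T n \<in> borel_measurable P"
  by (rule T_measurable)

lemma E_measurable' [measurable]: "E n \<in> measurable P (count_space UNIV)"
  by (rule E_measurable)

lemma countable_nonneg_rat: "countable (\<rat> \<inter> {0::real..})"
  by (intro countable_Int1 countable_rat)

lemma M_sojourn: "\<omega> \<in> space P \<Longrightarrow> T n \<omega> \<le> q \<Longrightarrow> q < T (Suc n) \<omega> \<Longrightarrow> M q \<omega> = St n \<omega>"
  by (simp add: St_def M_path)

lemma Y_sojourn:
  "\<omega> \<in> space P \<Longrightarrow> T n \<omega> \<le> q \<Longrightarrow> q < T (Suc n) \<omega> \<Longrightarrow> Y q \<omega> = X n \<omega> + v (St n \<omega>) * (q - T n \<omega>)"
  using Y_path[of \<omega> n q] by (simp add: St_def X_def)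

lemma St_measurable [measurable]: "St n \<in> measurable P (count_space UNIV)"
proof (rule measurable_count_space_eq2[THEN iffD2, OF finite], intro conjI ballI)
  fix s :: 's
  have "St n -` {s} \<inter> space P = (\<Union>q\<in>\<rat> \<inter> {0..}. {\<omega>\<in>space P. T n \<omega> \<le> q \<and> q < T (Suc n) \<omega> \<and> M q \<omega> = s})"
  proof (intro set_eqI iffI)
    fix \<omega> assume \<omega>: "\<omega> \<in> St n -` {s} \<inter> space P"
    then obtain q where "q \<in> \<rat> \<inter> {0..}" "T n \<omega> \<le> q" "q < T (Suc n) \<omega>" using rat_in_sojourn[of \<omega> n] by blast
    with \<omega> show "\<omega> \<in> (\<Union>q\<in>\<rat> \<inter> {0..}. {\<omega>\<in>space P. T n \<omega> \<le> q \<and> q < T (Suc n) \<omega> \<and> M q \<omega> = s})"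
      by (intro UN_I[of q]) (simp_all add: M_sojourn)
  qed (auto simp: M_sojourn)
  also have "\<dots> \<in> sets P"
  proof (intro sets.countable_UN'' countable_nonneg_rat)
    fix q :: real assume "q \<in> \<rat> \<inter> {0..}"
    then have [measurable]: "M q \<in> measurable P (count_space UNIV)" by (intro M_measurable) auto
    show "{\<omega>\<in>space P. T n \<omega> \<le> q \<and> q < T (Suc n) \<omega> \<and> M q \<omega> = s} \<in> sets P" by measurable
  qed
  finally show "St n -` {s} \<inter> space P \<in> sets P" .
qed simp

lemma X_measurable [measurable]: "X n \<in> borel_measurable P"
proof (rule measurableI)
  fix A :: "real set" assume [measurable]: "A \<in> sets borel"
  have "X n -` A \<inter> space P = (\<Union>q\<in>\<rat> \<inter> {0..}. {\<omega>\<in>space P. T n \<omega> \<le> q \<and> q < T (Suc n) \<omega> \<and> Y q \<omega> - v (St n \<omega>) * (q - T n \<omega>) \<in> A})"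
  proof (intro set_eqI iffI)
    fix \<omega> assume \<omega>: "\<omega> \<in> X n -` A \<inter> space P"
    then obtain q where "q \<in> \<rat> \<inter> {0..}" "T n \<omega> \<le> q" "q < T (Suc n) \<omega>" using rat_in_sojourn[of \<omega> n] by blast
    with \<omega> show "\<omega> \<in> (\<Union>q\<in>\<rat> \<inter> {0..}. {\<omega>\<in>space P. T n \<omega> \<le> q \<and> q < T (Suc n) \<omega> \<and> Y q \<omega> - v (St n \<omega>) * (q - T n \<omega>) \<in> A})"
      by (intro UN_I[of q]) (simp_all add: Y_sojourn)
  qed (auto simp: Y_sojourn)
  also have "\<dots> \<in> sets P"
  proof (intro sets.countable_UN'' countable_nonneg_rat)
    fix q :: real assume "q \<in> \<rat> \<inter> {0..}"
    then have [measurable]: "Y q \<in> borel_measurable P" by (intro Y_measurable) auto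
    have [measurable]: "(\<lambda>\<omega>. v (St n \<omega>)) \<in> borel_measurable P"
      by (rule measurable_compose[OF St_measurable]) simp
    show "{\<omega>\<in>space P. T n \<omega> \<le> q \<and> q < T (Suc n) \<omega> \<and> Y q \<omega> - v (St n \<omega>) * (q - T n \<omega>) \<in> A} \<in> sets P"
      by measurable
  qed
  finally show "X n -` A \<inter> space P \<in> sets P" .
qed simp

lemma v_St_measurable [measurable]: "(\<lambda>\<omega>. v (St n \<omega>)) \<in> borel_measurable P"
  by (rule measurable_compose[OF St_measurable]) simp

lemma hold_measurable [measurable]: "hold n \<in> borel_measurable P"
  unfolding hold_def by measurable

lemma jump_measurable [measurable]: "jump n \<in> borel_measurable P"
  unfolding jump_def by measurable

section \<open>Cylinder events and the history of the first transitions\<close>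

definition cyl :: "nat \<Rightarrow> (nat \<Rightarrow> 's) \<Rightarrow> (nat \<Rightarrow> transition_type) \<Rightarrow> (nat \<Rightarrow> real set) \<Rightarrow> (nat \<Rightarrow> real set) \<Rightarrow> 'a set" where
  "cyl n s e A B = {\<omega>\<in>space P. St 0 \<omega> = s 0 \<and> (\<forall>m<n. hold m \<omega> \<in> A m \<and> E (Suc m) \<omega> = e m
      \<and> St (Suc m) \<omega> = s (Suc m) \<and> jump m \<omega> \<in> B m)}"

text \<open>Cylinders with different states or types are disjoint, so the empty set is added for
  intersection stability; for \<open>n = 0\<close>, where \<open>A\<close> and \<open>B\<close> do
  not enter, it need not be a cylinder.\<close>

definition cyls :: "nat \<Rightarrow> 'a set set" where
  "cyls n = insert {} {cyl n s e A B | s e A B. (\<forall>m. A m \<in> sets borel) \<and> (\<forall>m. B m \<in> sets borel)}"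

definition past :: "nat \<Rightarrow> 'a measure" where
  "past n = sigma (space P) (cyls n)"

abbreviation exp_law :: "'s \<Rightarrow> real measure" where
  "exp_law k \<equiv> density lborel (\<lambda>t. ennreal (exponential_density (c k) t))"

lemma prob_cyl:
  assumes "\<And>m. A m \<in> sets borel" "\<And>m. B m \<in> sets borel"
  shows "prob (cyl n s e A B) = prob {\<omega>\<in>space P. M 0 \<omega> = s 0} *
    (\<Prod>m<n. measure (exp_law (s m)) (A m) * transition_prob C D F (s m) (e m) (s (Suc m)) (B m))"
proof -
  have "cyl n s e A B = {\<omega> \<in> space P. M 0 \<omega> = s 0 \<and> (\<forall>m<n.
            T (Suc m) \<omega> - T m \<omega> \<in> A m \<and>
            E (Suc m) \<omega> = e m \<and>
            M (T (Suc m) \<omega>) \<omega> = s (Suc m) \<and>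
            Y (T (Suc m) \<omega>) \<omega> - (Y (T m \<omega>) \<omega> + v (M (T m \<omega>) \<omega>) * (T (Suc m) \<omega> - T m \<omega>)) \<in> B m)}"
    unfolding cyl_def by (auto simp: St_0) (auto simp: hold_def St_def jump_def X_def)
  then show ?thesis using transition_law[of A B s n e] assms by simp
qed

lemma cyl_sets:
  assumes [measurable]: "\<And>m. A m \<in> sets borel" "\<And>m. B m \<in> sets borel"
  shows "cyl n s e A B \<in> sets P"
  unfolding cyl_def by measurable

lemma cyls_subset: "cyls n \<subseteq> sets P"
  unfolding cyls_def using cyl_sets by auto

lemma cyls_Pow: "cyls n \<subseteq> Pow (space P)"
  using cyls_subset sets.space_closed by blast

lemma cyl_in_cyls:
  "(\<And>m. A m \<in> sets borel) \<Longrightarrow> (\<And>m. B m \<in> sets borel) \<Longrightarrow> cyl n s e A B \<in> cyls n"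
  unfolding cyls_def by blast

lemma space_past [simp]: "space (past n) = space P"
  unfolding past_def by (intro space_measure_of cyls_Pow)

lemma sets_past: "sets (past n) = sigma_sets (space P) (cyls n)"
  unfolding past_def by (intro sets_measure_of cyls_Pow)

lemma past_subset: "S \<in> sets (past n) \<Longrightarrow> S \<in> sets P"
  using sets.sigma_sets_subset[OF cyls_subset] by (auto simp: sets_past)

lemma Int_stable_cyls: "Int_stable (cyls n)"
proof (rule Int_stableI)
  fix a b assume "a \<in> cyls n" "b \<in> cyls n"
  then consider "a \<inter> b = {}" | s e A B s' e' A' B' where "a = cyl n s e A B" "b = cyl n s' e' A' B'"
      "\<forall>m. A m \<in> sets borel" "\<forall>m. B m \<in> sets borel" "\<forall>m. A' m \<in> sets borel" "\<forall>m. B' m \<in> sets borel"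
      "a \<inter> b \<noteq> {}"
    unfolding cyls_def by blast
  then show "a \<inter> b \<in> cyls n"
  proof cases
    case 2
    then obtain \<omega> where "\<omega> \<in> cyl n s e A B" "\<omega> \<in> cyl n s' e' A' B'" by blast
    then have "s 0 = s' 0" "\<And>m. m < n \<Longrightarrow> s (Suc m) = s' (Suc m)" "\<And>m. m < n \<Longrightarrow> e m = e' m"
      unfolding cyl_def by auto
    then have "cyl n s e A B \<inter> cyl n s' e' A' B' = cyl n s e (\<lambda>m. A m \<inter> A' m) (\<lambda>m. B m \<inter> B' m)"
      unfolding cyl_def by auto
    then have "a \<inter> b = cyl n s e (\<lambda>m. A m \<inter> A' m) (\<lambda>m. B m \<inter> B' m)" using 2 by simp
    moreover have "\<forall>m. A m \<inter> A' m \<in> sets borel" "\<forall>m. B m \<inter> B' m \<in> sets borel" using 2 by auto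
    ultimately show ?thesis unfolding cyls_def by blast
  qed (simp add: cyls_def)
qed

lemma finite_transition_type: "finite (UNIV :: transition_type set)"
proof -
  have "(UNIV :: transition_type set) = {Type_C, Type_D}" using transition_type.exhaust by blast
  then show ?thesis by (metis finite.emptyI finite.insertI)
qed

text \<open>Restriction to extensional functions leaves finitely many paths and types, so finitely
  many cylinders cover the space.\<close>

definition paths :: "nat \<Rightarrow> (nat \<Rightarrow> 's) set" where "paths n = PiE {..n} (\<lambda>_. UNIV)"
definition types :: "nat \<Rightarrow> (nat \<Rightarrow> transition_type) set" where "types n = PiE {..n} (\<lambda>_. UNIV)"

lemma finite_paths_types: "finite (paths n)" "finite (types n)"
  unfolding paths_def types_def using finite_transition_type by (auto intro!: finite_PiE)

lemma cyl_cover: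
  "{\<omega>\<in>space P. Q (restrict (\<lambda>m. St m \<omega>) {..n}) \<and> (\<forall>m<n. hold m \<omega> \<in> A m \<and> jump m \<omega> \<in> B m)}
    = (\<Union>s\<in>{s\<in>paths n. Q s}. \<Union>e\<in>types n. cyl n s e A B)"
proof (intro subset_antisym subsetI)
  fix \<omega> assume \<omega>: "\<omega> \<in> {\<omega>\<in>space P. Q (restrict (\<lambda>m. St m \<omega>) {..n}) \<and> (\<forall>m<n. hold m \<omega> \<in> A m \<and> jump m \<omega> \<in> B m)}"
  let ?s = "restrict (\<lambda>m. St m \<omega>) {..n}" and ?e = "restrict (\<lambda>m. E (Suc m) \<omega>) {..n}"
  have "?s \<in> {s\<in>paths n. Q s}" "?e \<in> types n" "\<omega> \<in> cyl n ?s ?e A B"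
    using \<omega> by (auto simp: paths_def types_def cyl_def)
  then show "\<omega> \<in> (\<Union>s\<in>{s\<in>paths n. Q s}. \<Union>e\<in>types n. cyl n s e A B)" by blast
next
  fix \<omega> assume "\<omega> \<in> (\<Union>s\<in>{s\<in>paths n. Q s}. \<Union>e\<in>types n. cyl n s e A B)"
  then obtain s e where s: "s \<in> paths n" "Q s" and \<omega>: "\<omega> \<in> cyl n s e A B" by blast
  have "St m \<omega> = s m" if "m \<le> n" for m
    using \<omega> that by (cases m) (auto simp: cyl_def)
  then have "restrict (\<lambda>m. St m \<omega>) {..n} = s"
    using s(1) unfolding paths_def by (intro extensionalityI[of _ "{..n}"]) (auto simp: PiE_def)
  then show "\<omega> \<in> {\<omega>\<in>space P. Q (restrict (\<lambda>m. St m \<omega>) {..n}) \<and> (\<forall>m<n. hold m \<omega> \<in> A m \<and> jump m \<omega> \<in> B m)}"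
    using s(2) \<omega> by (auto simp: cyl_def)
qed

lemma past_event:
  assumes "\<And>m. A m \<in> sets borel" "\<And>m. B m \<in> sets borel"
  shows "{\<omega>\<in>space P. Q (restrict (\<lambda>m. St m \<omega>) {..n}) \<and> (\<forall>m<n. hold m \<omega> \<in> A m \<and> jump m \<omega> \<in> B m)} \<in> sets (past n)"
proof -
  have "cyl n s e A B \<in> sets (past n)" for s e
    unfolding sets_past using assms by (intro sigma_sets.Basic cyl_in_cyls)
  then show ?thesis
    unfolding cyl_cover using finite_paths_types[of n]
    by (intro sets.finite_UN) auto
qed

lemma past_St: assumes "m \<le> n" shows "St m \<in> measurable (past n) (count_space UNIV)"
proof (rule measurable_count_space_eq2[THEN iffD2, OF finite], intro conjI ballI)
  fix s :: 's
  have "St m -` {s} \<inter> space P = {\<omega>\<in>space P. restrict (\<lambda>m. St m \<omega>) {..n} m = s \<and> (\<forall>m<n. hold m \<omega> \<in> UNIV \<and> jump m \<omega> \<in> UNIV)}"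
    using assms by auto
  also have "\<dots> \<in> sets (past n)" by (rule past_event) auto
  finally show "St m -` {s} \<inter> space (past n) \<in> sets (past n)" by simp
qed simp

lemma past_hold: assumes "m < n" shows "hold m \<in> borel_measurable (past n)"
proof (rule measurableI)
  fix A :: "real set" assume A: "A \<in> sets borel"
  have "hold m -` A \<inter> space P = {\<omega>\<in>space P. True \<and> (\<forall>l<n. hold l \<omega> \<in> (if l = m then A else UNIV) \<and> jump l \<omega> \<in> UNIV)}"
    using assms by auto
  also have "\<dots> \<in> sets (past n)" by (rule past_event) (use A in auto)
  finally show "hold m -` A \<inter> space (past n) \<in> sets (past n)" by simp
qed simp

lemma past_jump: assumes "m < n" shows "jump m \<in> borel_measurable (past n)"
proof (rule measurableI)
  fix A :: "real set" assume A: "A \<in> sets borel"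
  have "jump m -` A \<inter> space P = {\<omega>\<in>space P. True \<and> (\<forall>l<n. hold l \<omega> \<in> UNIV \<and> jump l \<omega> \<in> (if l = m then A else UNIV))}"
    using assms by auto
  also have "\<dots> \<in> sets (past n)" by (rule past_event) (use A in auto)
  finally show "jump m -` A \<inter> space (past n) \<in> sets (past n)" by simp
qed simp

lemma past_X: "m \<le> n \<Longrightarrow> X m \<in> borel_measurable (past n)"
proof (induction m)
  case 0
  have "X 0 \<in> borel_measurable (past n) \<longleftrightarrow> (\<lambda>\<omega>. 0 :: real) \<in> borel_measurable (past n)"
    by (intro measurable_cong) (simp add: X_0)
  then show ?case by simp
next
  case (Suc m)
  have [measurable]: "(\<lambda>\<omega>. v (St m \<omega>)) \<in> borel_measurable (past n)"
    using Suc by (intro measurable_compose[OF past_St]) auto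
  have [measurable]: "hold m \<in> borel_measurable (past n)" "jump m \<in> borel_measurable (past n)" "X m \<in> borel_measurable (past n)"
    using Suc past_hold past_jump by auto
  show ?case unfolding X_Suc[abs_def] by measurable
qed

lemma prob_space_exp_law: "prob_space (exp_law k)"
  by (rule prob_space_exponential_density) (rule total_rate_pos)

lemma transition_prob_nonneg: "0 \<le> transition_prob C D F k e j B"
  using C_nonneg[of k j] D_nonneg[of k j] total_rate_pos[of k]
  by (cases e) (auto intro!: mult_nonneg_nonneg divide_nonneg_pos)

text \<open>Both sides are finite measures in \<open>S\<close>. On cylinders the identity is
  \<open>prob_cyl\<close> with one more transition, and cylinders form an intersection-stable
  generator of \<open>past n\<close>.\<close>

lemma markov_type:
  assumes S: "S \<in> sets (past n)" and A [measurable]: "A \<in> sets borel" and B [measurable]: "B \<in> sets borel"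
  shows "emeasure P (S \<inter> {\<omega>\<in>space P. St n \<omega> = k \<and> hold n \<omega> \<in> A \<and> E (Suc n) \<omega> = e \<and> St (Suc n) \<omega> = j \<and> jump n \<omega> \<in> B})
    = ennreal (measure (exp_law k) A * transition_prob C D F k e j B) * emeasure P (S \<inter> {\<omega>\<in>space P. St n \<omega> = k})"
proof -
  let ?\<kappa> = "measure (exp_law k) A * transition_prob C D F k e j B"
  let ?N = "{\<omega>\<in>space P. St n \<omega> = k \<and> hold n \<omega> \<in> A \<and> E (Suc n) \<omega> = e \<and> St (Suc n) \<omega> = j \<and> jump n \<omega> \<in> B}"
  let ?K = "{\<omega>\<in>space P. St n \<omega> = k}"
  have \<kappa>: "0 \<le> ?\<kappa>" using transition_prob_nonneg by simp
  have [measurable]: "?N \<in> sets P" "?K \<in> sets P" by measurable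
  have id: "(\<lambda>x. x) \<in> measurable P (past n)"
    using past_subset by (intro measurableI) auto
  \<comment> \<open>The image under the identity map only coarsens the \<sigma>-algebra to
    \<open>past n\<close>, where the uniqueness theorem is applied.\<close>
  define N1 where "N1 = distr (density P (indicator ?N)) (past n) (\<lambda>x. x)"
  define N2 where "N2 = distr (density P (\<lambda>\<omega>. ennreal ?\<kappa> * indicator ?K \<omega>)) (past n) (\<lambda>x. x)"
  have N1: "emeasure N1 S = emeasure P (S \<inter> ?N)" if "S \<in> sets (past n)" for S
  proof -
    have "S \<in> sets P" using past_subset that by auto
    then show ?thesis using that id unfolding N1_def
      by (subst emeasure_distr) (auto simp: emeasure_density Int_absorb2[OF sets.sets_into_space] indicator_inter_arith[symmetric] Int_commute)
  qed
  have N2: "emeasure N2 S = ennreal ?\<kappa> * emeasure P (S \<inter> ?K)" if "S \<in> sets (past n)" for S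
  proof -
    have "S \<in> sets P" using past_subset that by auto
    then show ?thesis using that id unfolding N2_def
      by (subst emeasure_distr) (auto simp: emeasure_density Int_absorb2[OF sets.sets_into_space]
          mult.assoc nn_integral_cmult indicator_inter_arith[symmetric] Int_commute)
  qed
  have "N1 = N2"
  proof (rule measure_eqI_generator_eq_countable[OF Int_stable_cyls])
    show "cyls n \<subseteq> Pow (space P)" by (rule cyls_Pow)
    show "sets N1 = sigma_sets (space P) (cyls n)" "sets N2 = sigma_sets (space P) (cyls n)"
      by (simp_all add: N1_def N2_def sets_past)
    show "emeasure N1 S = emeasure N2 S" if S: "S \<in> cyls n" for S
    proof -
      have Sp: "S \<in> sets (past n)" using S by (auto simp: sets_past)
      show ?thesis
      proof (cases "S = {}")
        case False
        then obtain s e0 A0 B0 where S_eq: "S = cyl n s e0 A0 B0" and AB: "\<And>m. A0 m \<in> sets borel" "\<And>m. B0 m \<in> sets borel"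
          using S by (auto simp: cyls_def)
        have Sn: "\<omega> \<in> S \<Longrightarrow> St n \<omega> = s n" for \<omega>
          unfolding S_eq cyl_def by (cases n) auto
        show ?thesis
        proof (cases "s n = k")
          case True
          let ?s = "s(Suc n := j)" and ?e = "e0(n := e)" and ?A = "A0(n := A)" and ?B = "B0(n := B)"
          have 1: "S \<inter> ?N = cyl (Suc n) ?s ?e ?A ?B"
            using True Sn unfolding S_eq cyl_def by (auto simp: less_Suc_eq)
          have 2: "S \<inter> ?K = S" using True Sn unfolding S_eq cyl_def by auto
          have "prob (S \<inter> ?N) = prob {\<omega>\<in>space P. M 0 \<omega> = ?s 0} * (\<Prod>m<Suc n. measure (exp_law (?s m)) (?A m) * transition_prob C D F (?s m) (?e m) (?s (Suc m)) (?B m))"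
            unfolding 1 using AB A B by (intro prob_cyl) auto
          also have "\<dots> = prob S * ?\<kappa>"
            unfolding S_eq prob_cyl[OF AB] prod.lessThan_Suc
            by (simp add: True mult.assoc)
          finally show ?thesis
            using \<kappa> unfolding N1[OF Sp] N2[OF Sp] 2 by (simp add: emeasure_eq_measure ennreal_mult mult.commute)
        next
          case False
          then have "S \<inter> ?N = {}" "S \<inter> ?K = {}" using Sn by auto
          then show ?thesis unfolding N1[OF Sp] N2[OF Sp] by simp
        qed
      qed simp
    qed
    \<comment> \<open>Cylinders without restriction on holding times and jumps provide the countable
      cover by sets of finite measure.\<close>
    let ?c = "(\<lambda>(s, e). cyl n s e (\<lambda>_. UNIV) (\<lambda>_. UNIV)) ` (paths n \<times> types n)"
    show "?c \<subseteq> cyls n" by (auto intro!: cyl_in_cyls)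
    show "countable ?c" using finite_paths_types by (intro countable_finite) auto
    show "\<Union> ?c = space P"
      using cyl_cover[of "\<lambda>_. True" n "\<lambda>_. UNIV" "\<lambda>_. UNIV"] by auto
    show "emeasure N1 a \<noteq> \<infinity>" if "a \<in> ?c" for a
    proof -
      have "a \<in> sets (past n)" using that by (auto simp: sets_past intro!: sigma_sets.Basic cyl_in_cyls)
      then show ?thesis by (simp add: N1 emeasure_eq_measure)
    qed
  qed
  then show ?thesis using N1[OF S] N2[OF S] by simp
qed

text \<open>Summing over the two transition types merges the atom of type C and the law of type D
  into \<open>Um k j\<close>, divided by \<open>c k\<close>.\<close>

lemma markov:
  assumes S: "S \<in> sets (past n)" and A [measurable]: "A \<in> sets borel" and B [measurable]: "B \<in> sets borel"
  shows "emeasure P (S \<inter> {\<omega>\<in>space P. St n \<omega> = k \<and> St (Suc n) \<omega> = j \<and> hold n \<omega> \<in> A \<and> jump n \<omega> \<in> B})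
    = emeasure P (S \<inter> {\<omega>\<in>space P. St n \<omega> = k}) * emeasure (exp_law k) A * (ennreal (1 / c k) * emeasure (Um k j) B)"
proof -
  interpret e: prob_space "exp_law k" by (rule prob_space_exp_law)
  let ?N = "\<lambda>e. S \<inter> {\<omega>\<in>space P. St n \<omega> = k \<and> hold n \<omega> \<in> A \<and> E (Suc n) \<omega> = e \<and> St (Suc n) \<omega> = j \<and> jump n \<omega> \<in> B}"
  have [measurable]: "S \<in> sets P" using past_subset[OF S] .
  have eq: "S \<inter> {\<omega>\<in>space P. St n \<omega> = k \<and> St (Suc n) \<omega> = j \<and> hold n \<omega> \<in> A \<and> jump n \<omega> \<in> B} = ?N Type_C \<union> ?N Type_D"
    using transition_type.exhaust by auto
  have "emeasure P (?N Type_C \<union> ?N Type_D) = emeasure P (?N Type_C) + emeasure P (?N Type_D)"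
    by (intro plus_emeasure[symmetric]) auto
  also have "\<dots> = emeasure P (S \<inter> {\<omega>\<in>space P. St n \<omega> = k}) *
      ennreal (measure (exp_law k) A * (transition_prob C D F k Type_C j B + transition_prob C D F k Type_D j B))"
    unfolding markov_type[OF S A B]
    by (simp only: distrib_left[of "measure _ _"] mult.commute[of _ "emeasure P _"] distrib_left[of "emeasure P _", symmetric]
        ennreal_plus[symmetric] mult_nonneg_nonneg measure_nonneg transition_prob_nonneg)
  also have "ennreal (measure (exp_law k) A * (transition_prob C D F k Type_C j B + transition_prob C D F k Type_D j B))
      = emeasure (exp_law k) A * (ennreal (1 / c k) * emeasure (Um k j) B)"
  proof -
    interpret F: real_distribution "F k j" by (rule F_distribution)
    have "emeasure (Um k j) B = ennreal (Coff k j * indicator B 0 + D $ k $ j * measure (F k j) B)"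
      using Coff_nonneg[of k j] D_nonneg[of k j]
      by (simp add: emeasure_Um emeasure_Dm F.emeasure_eq_measure ennreal_mult indicator_def)
    moreover have "transition_prob C D F k Type_C j B + transition_prob C D F k Type_D j B
        = 1 / c k * (Coff k j * indicator B 0 + D $ k $ j * measure (F k j) B)"
      by (auto simp: field_simps add_divide_distrib)
    ultimately show ?thesis
      using Coff_nonneg[of k j] D_nonneg[of k j] total_rate_pos[of k]
      by (simp only: e.emeasure_eq_measure) (subst ennreal_mult[symmetric] | simp)+
  qed
  finally show ?thesis unfolding eq by (simp add: mult.assoc)
qed

end

section \<open>Law of the killed chain\<close>

context prob_space
begin

text \<open>Weighting by an indicator before taking the image gives the sub-probability law of
  \<open>g\<close> on the event \<open>G\<close>.\<close>

lemma distr_indicator: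
  assumes [measurable]: "G \<in> events" "g \<in> measurable M N"
  shows "Z \<in> sets N \<Longrightarrow> emeasure (distr (density M (indicator G)) N g) Z = emeasure M (G \<inter> g -` Z)"
    and "f \<in> borel_measurable N \<Longrightarrow>
      (\<integral>\<^sup>+x. f x \<partial>distr (density M (indicator G)) N g) = (\<integral>\<^sup>+\<omega>. indicator G \<omega> * f (g \<omega>) \<partial>M)"
proof -
  assume [measurable]: "Z \<in> sets N"
  have [measurable]: "g -` Z \<inter> space M \<in> events" by (rule measurable_sets[OF assms(2)]) fact
  have "emeasure (distr (density M (indicator G)) N g) Z = emeasure (density M (indicator G)) (g -` Z \<inter> space M)"
    by (simp add: emeasure_distr)
  also have "\<dots> = (\<integral>\<^sup>+\<omega>. indicator (G \<inter> (g -` Z \<inter> space M)) \<omega> \<partial>M)"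
    unfolding indicator_inter_arith[of G] by (rule emeasure_density) measurable
  also have "\<dots> = emeasure M (G \<inter> (g -` Z \<inter> space M))" by simp
  also have "G \<inter> (g -` Z \<inter> space M) = G \<inter> g -` Z"
    using sets.sets_into_space[of G M] by auto
  finally show "emeasure (distr (density M (indicator G)) N g) Z = emeasure M (G \<inter> g -` Z)" .
next
  assume [measurable]: "f \<in> borel_measurable N"
  show "(\<integral>\<^sup>+x. f x \<partial>distr (density M (indicator G)) N g) = (\<integral>\<^sup>+\<omega>. indicator G \<omega> * f (g \<omega>) \<partial>M)"
    by (simp add: nn_integral_distr nn_integral_density)
qed

lemma finite_measure_distr_indicator:
  assumes [measurable]: "G \<in> events" "g \<in> measurable M N"
  shows "finite_measure (distr (density M (indicator G)) N g)"
  by (rule finite_measureI) (auto simp: distr_indicator(1) emeasure_eq_measure)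

end

context map_data
begin

text \<open>Substitution \<open>z = - (x + v k * t)\<close> from time to depth; the exponential
  density turns into \<open>c k\<close> times the occupation density of one sojourn.\<close>

lemma nn_integral_exp_law:
  assumes [measurable]: "g \<in> borel_measurable borel"
  shows "(\<integral>\<^sup>+t. g (x + v k * t) \<partial>density lborel (\<lambda>t. ennreal (exponential_density (c k) t)))
    = ennreal (c k) * (\<integral>\<^sup>+z. sojourn k (z + x) * g (- z) \<partial>lborel)"
proof -
  have v: "v k \<noteq> 0" by (rule v_nonzero)
  have c: "0 < c k" by (rule total_rate_pos)
  have "(\<integral>\<^sup>+z. sojourn k (z + x) * g (- z) \<partial>lborel)
      = ennreal \<bar>v k\<bar> * (\<integral>\<^sup>+t. sojourn k (- v k * t) * g (x + v k * t) \<partial>lborel)"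
    using v by (subst nn_integral_real_affine[where c = "- v k" and t = "- x"]) (auto simp: add.commute)
  also have "\<dots> = (\<integral>\<^sup>+t. ennreal \<bar>v k\<bar> * (sojourn k (- v k * t) * g (x + v k * t)) \<partial>lborel)"
    by (subst nn_integral_cmult) auto
  finally have "ennreal (c k) * (\<integral>\<^sup>+z. sojourn k (z + x) * g (- z) \<partial>lborel)
      = (\<integral>\<^sup>+t. ennreal (c k) * (ennreal \<bar>v k\<bar> * (sojourn k (- v k * t) * g (x + v k * t))) \<partial>lborel)"
    by (subst nn_integral_cmult) auto
  also have "\<dots> = (\<integral>\<^sup>+t. ennreal (exponential_density (c k) t) * g (x + v k * t) \<partial>lborel)"
  proof (intro nn_integral_cong)
    fix t
    have "ennreal (c k) * (ennreal \<bar>v k\<bar> * sojourn k (- v k * t)) = ennreal (exponential_density (c k) t)"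
      using v c by (simp add: sojourn_def exponential_density_def mult.commute flip: ennreal_mult)
    then show "ennreal (c k) * (ennreal \<bar>v k\<bar> * (sojourn k (- v k * t) * g (x + v k * t)))
        = ennreal (exponential_density (c k) t) * g (x + v k * t)"
      by (simp only: mult.assoc[symmetric])
  qed
  finally show ?thesis by (simp add: nn_integral_density)
qed

text \<open>Tonelli and the substitution \<open>a = z - u\<close>, the depth after a jump of size
  \<open>u\<close> from depth \<open>z\<close>.\<close>

lemma entrance_shift:
  assumes [measurable]: "\<And>k. f k \<in> borel_measurable borel" "\<psi> \<in> borel_measurable borel"
  shows "(\<Sum>k\<in>UNIV. \<integral>\<^sup>+z. f k z * (\<integral>\<^sup>+u. \<psi> (u - z) \<partial>Um k j) \<partial>lborel)
    = (\<integral>\<^sup>+a. entrance f j a * \<psi> (- a) \<partial>lborel)"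
proof -
  interpret U: finite_measure "Um k j" for k by (rule finite_measure_Um)
  interpret pair_sigma_finite lborel "Um k j" for k ..
  have "(\<integral>\<^sup>+z. f k z * (\<integral>\<^sup>+u. \<psi> (u - z) \<partial>Um k j) \<partial>lborel)
      = (\<integral>\<^sup>+a. (\<integral>\<^sup>+u. f k (a + u) \<partial>Um k j) * \<psi> (- a) \<partial>lborel)" for k
  proof -
    have "(\<integral>\<^sup>+z. f k z * (\<integral>\<^sup>+u. \<psi> (u - z) \<partial>Um k j) \<partial>lborel)
        = (\<integral>\<^sup>+z. \<integral>\<^sup>+u. f k z * \<psi> (u - z) \<partial>Um k j \<partial>lborel)"
      by (intro nn_integral_cong nn_integral_cmult[symmetric]) simp
    also have "\<dots> = (\<integral>\<^sup>+u. \<integral>\<^sup>+z. f k z * \<psi> (u - z) \<partial>lborel \<partial>Um k j)"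
      by (rule Fubini'[symmetric]) measurable
    also have "\<dots> = (\<integral>\<^sup>+u. \<integral>\<^sup>+a. f k (a + u) * \<psi> (- a) \<partial>lborel \<partial>Um k j)"
    proof (rule nn_integral_cong)
      fix u show "(\<integral>\<^sup>+z. f k z * \<psi> (u - z) \<partial>lborel) = (\<integral>\<^sup>+a. f k (a + u) * \<psi> (- a) \<partial>lborel)"
        using nn_integral_lborel_shift[of "\<lambda>a. f k (a + u) * \<psi> (- a)" u] by simp
    qed
    also have "\<dots> = (\<integral>\<^sup>+a. \<integral>\<^sup>+u. f k (a + u) * \<psi> (- a) \<partial>Um k j \<partial>lborel)"
      by (rule Fubini') measurable
    also have "\<dots> = (\<integral>\<^sup>+a. (\<integral>\<^sup>+u. f k (a + u) \<partial>Um k j) * \<psi> (- a) \<partial>lborel)"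
      by (intro nn_integral_cong nn_integral_multc) simp
    finally show ?thesis .
  qed
  then show ?thesis
    by (simp add: entrance_def sum_distrib_right nn_integral_sum)
qed

end

context markov_additive_process
begin

text \<open>Given the past, \<open>St n = k\<close> and the next state \<open>j\<close>, position,
  holding time and jump have a product law. \<open>markov\<close> yields this on boxes; two
  applications of uniqueness of product measures extend it to general integrands.\<close>

lemma transition_integral:
  assumes S: "S \<in> sets (past n)"
    and f [measurable]: "f \<in> borel_measurable ((borel \<Otimes>\<^sub>M borel) \<Otimes>\<^sub>M borel)"
  shows "(\<integral>\<^sup>+\<omega>. indicator (S \<inter> {\<omega>\<in>space P. St n \<omega> = k \<and> St (Suc n) \<omega> = j}) \<omega> * f ((X n \<omega>, hold n \<omega>), jump n \<omega>) \<partial>P)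
    = (\<integral>\<^sup>+\<omega>. indicator (S \<inter> {\<omega>\<in>space P. St n \<omega> = k}) \<omega> *
        (\<integral>\<^sup>+t. ennreal (1 / c k) * (\<integral>\<^sup>+u. f ((X n \<omega>, t), u) \<partial>Um k j) \<partial>exp_law k) \<partial>P)"
proof -
  have [measurable]: "S \<in> sets P" by (rule past_subset[OF S])
  let ?K = "S \<inter> {\<omega>\<in>space P. St n \<omega> = k}"
  let ?KJ = "S \<inter> {\<omega>\<in>space P. St n \<omega> = k \<and> St (Suc n) \<omega> = j}"
  interpret e: prob_space "exp_law k" by (rule prob_space_exp_law)
  interpret U: finite_measure "Um k j" by (rule finite_measure_Um)
  define q where "q = distr (density P (indicator ?K)) borel (X n)"
  interpret q: finite_measure q unfolding q_def by (rule finite_measure_distr_indicator) auto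
  have [measurable_cong, simp]: "sets q = sets borel" by (simp add: q_def)
  define W where "W = scale_measure (ennreal (1 / c k)) (Um k j)"
  have [measurable_cong, simp]: "sets W = sets borel" by (simp add: W_def)
  have eW: "emeasure W B = ennreal (1 / c k) * emeasure (Um k j) B" for B by (simp add: W_def)
  interpret W: finite_measure W
    by (rule finite_measureI) (auto simp: eW ennreal_mult_eq_top_iff U.emeasure_eq_measure)
  define N where "N = distr (density P (indicator ?KJ)) ((borel \<Otimes>\<^sub>M borel) \<Otimes>\<^sub>M borel) (\<lambda>\<omega>. ((X n \<omega>, hold n \<omega>), jump n \<omega>))"
  interpret qe: pair_sigma_finite q "exp_law k" ..
  have s1: "sets (q \<Otimes>\<^sub>M exp_law k) = sets (borel \<Otimes>\<^sub>M borel)"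
    by (rule sets_pair_measure_cong) auto
  \<comment> \<open>Uniqueness for three factors needs arbitrary measurable \<open>Z\<close> in the
    first two. For fixed \<open>B\<close> the scalar weight of \<open>B\<close> is put into
    \<open>qB\<close>, and uniqueness for two factors applies.\<close>
  have 1: "emeasure (q \<Otimes>\<^sub>M exp_law k) Z * emeasure W B = emeasure N (Z \<times> B)"
    if Z: "Z \<in> sets (borel \<Otimes>\<^sub>M borel)" and B [measurable]: "B \<in> sets borel" for Z B
  proof -
    let ?G = "?KJ \<inter> {\<omega>\<in>space P. jump n \<omega> \<in> B}"
    define qB where "qB = scale_measure (emeasure W B) q"
    have [measurable_cong, simp]: "sets qB = sets borel" by (simp add: qB_def)
    interpret qB: finite_measure qB
      by (rule finite_measureI) (auto simp: qB_def ennreal_mult_eq_top_iff q.emeasure_eq_measure W.emeasure_eq_measure)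
    define NB where "NB = distr (density P (indicator ?G)) (borel \<Otimes>\<^sub>M borel) (\<lambda>\<omega>. (X n \<omega>, hold n \<omega>))"
    have "qB \<Otimes>\<^sub>M exp_law k = NB"
    proof (rule pair_measure_eqI)
      show "sigma_finite_measure qB" "sigma_finite_measure (exp_law k)" ..
      show "sets (qB \<Otimes>\<^sub>M exp_law k) = sets NB"
        unfolding NB_def sets_distr by (rule sets_pair_measure_cong) auto
      fix V A assume "V \<in> sets qB" "A \<in> sets (exp_law k)"
      then have [measurable]: "V \<in> sets borel" "A \<in> sets borel" by auto
      \<comment> \<open>The position \<open>X n\<close> belongs to the past, so the condition
        \<open>X n \<in> V\<close> is absorbed into the past event.\<close>
      have SV: "S \<inter> (X n -` V \<inter> space P) \<in> sets (past n)"
        using S measurable_sets[OF past_X[of n n], of V] by auto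
      have "emeasure NB (V \<times> A) = emeasure P (?G \<inter> (\<lambda>\<omega>. (X n \<omega>, hold n \<omega>)) -` (V \<times> A))"
        unfolding NB_def by (rule distr_indicator(1)) measurable
      also have "?G \<inter> (\<lambda>\<omega>. (X n \<omega>, hold n \<omega>)) -` (V \<times> A)
          = (S \<inter> (X n -` V \<inter> space P)) \<inter> {\<omega>\<in>space P. St n \<omega> = k \<and> St (Suc n) \<omega> = j \<and> hold n \<omega> \<in> A \<and> jump n \<omega> \<in> B}"
        by auto
      also have "emeasure P \<dots> = emeasure P (S \<inter> (X n -` V \<inter> space P) \<inter> {\<omega>\<in>space P. St n \<omega> = k}) * emeasure (exp_law k) A * emeasure W B"
        unfolding eW by (rule markov[OF SV]) measurable
      also have "S \<inter> (X n -` V \<inter> space P) \<inter> {\<omega>\<in>space P. St n \<omega> = k} = ?K \<inter> X n -` V" by auto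
      also have "emeasure P (?K \<inter> X n -` V) = emeasure q V"
        unfolding q_def by (rule distr_indicator(1)[symmetric]) measurable
      finally show "emeasure qB V * emeasure (exp_law k) A = emeasure NB (V \<times> A)"
        by (simp add: qB_def mult_ac)
    qed
    then have "emeasure NB Z = emeasure (qB \<Otimes>\<^sub>M exp_law k) Z" by simp
    also have "\<dots> = (\<integral>\<^sup>+x. emeasure (exp_law k) (Pair x -` Z) \<partial>qB)"
      using Z by (intro e.emeasure_pair_measure_alt) (simp add: sets_pair_measure_cong[of qB borel "exp_law k" borel])
    also have "\<dots> = emeasure W B * (\<integral>\<^sup>+x. emeasure (exp_law k) (Pair x -` Z) \<partial>q)"
      unfolding qB_def using Z s1
      by (intro nn_integral_scale_measure e.measurable_emeasure_Pair) auto
    also have "(\<integral>\<^sup>+x. emeasure (exp_law k) (Pair x -` Z) \<partial>q) = emeasure (q \<Otimes>\<^sub>M exp_law k) Z"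
      using Z s1 by (intro e.emeasure_pair_measure_alt[symmetric]) auto
    finally have "emeasure NB Z = emeasure W B * emeasure (q \<Otimes>\<^sub>M exp_law k) Z" .
    moreover have "emeasure NB Z = emeasure P (?G \<inter> (\<lambda>\<omega>. (X n \<omega>, hold n \<omega>)) -` Z)"
      unfolding NB_def using Z by (intro distr_indicator(1)) measurable
    moreover have "emeasure N (Z \<times> B) = emeasure P (?KJ \<inter> (\<lambda>\<omega>. ((X n \<omega>, hold n \<omega>), jump n \<omega>)) -` (Z \<times> B))"
      unfolding N_def using Z B by (intro distr_indicator(1)) measurable
    moreover have "?KJ \<inter> (\<lambda>\<omega>. ((X n \<omega>, hold n \<omega>), jump n \<omega>)) -` (Z \<times> B) = ?G \<inter> (\<lambda>\<omega>. (X n \<omega>, hold n \<omega>)) -` Z"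
      by auto
    ultimately show ?thesis by (simp add: mult.commute)
  qed
  have N: "(q \<Otimes>\<^sub>M exp_law k) \<Otimes>\<^sub>M W = N"
  proof (rule pair_measure_eqI)
    show "sigma_finite_measure (q \<Otimes>\<^sub>M exp_law k)" "sigma_finite_measure W" ..
    show "sets ((q \<Otimes>\<^sub>M exp_law k) \<Otimes>\<^sub>M W) = sets N"
      unfolding N_def sets_distr by (rule sets_pair_measure_cong) (auto simp: s1)
  qed (use 1 s1 in auto)
  have mf: "f \<in> borel_measurable ((q \<Otimes>\<^sub>M exp_law k) \<Otimes>\<^sub>M W)"
    by (simp add: N) (simp add: N_def)
  have "(\<integral>\<^sup>+\<omega>. indicator ?KJ \<omega> * f ((X n \<omega>, hold n \<omega>), jump n \<omega>) \<partial>P) = (\<integral>\<^sup>+y. f y \<partial>N)"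
    unfolding N_def by (rule distr_indicator(2)[symmetric]) measurable
  also have "\<dots> = (\<integral>\<^sup>+y. \<integral>\<^sup>+u. f (y, u) \<partial>W \<partial>(q \<Otimes>\<^sub>M exp_law k))"
    unfolding N[symmetric] by (rule W.nn_integral_fst[symmetric, OF mf])
  also have "\<dots> = (\<integral>\<^sup>+x. \<integral>\<^sup>+t. \<integral>\<^sup>+u. f ((x, t), u) \<partial>W \<partial>exp_law k \<partial>q)"
    by (rule e.nn_integral_fst[symmetric]) measurable
  also have "\<dots> = (\<integral>\<^sup>+x. \<integral>\<^sup>+t. ennreal (1 / c k) * (\<integral>\<^sup>+u. f ((x, t), u) \<partial>Um k j) \<partial>exp_law k \<partial>q)"
    unfolding W_def by (intro nn_integral_cong nn_integral_scale_measure) measurable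
  also have "\<dots> = (\<integral>\<^sup>+\<omega>. indicator ?K \<omega> *
        (\<integral>\<^sup>+t. ennreal (1 / c k) * (\<integral>\<^sup>+u. f ((X n \<omega>, t), u) \<partial>Um k j) \<partial>exp_law k) \<partial>P)"
    unfolding q_def by (rule distr_indicator(2)) measurable
  finally show ?thesis .
qed

text \<open>The range starts at \<open>1\<close> because \<open>X 0 = 0\<close> is not
  negative.\<close>

definition below :: "'s \<Rightarrow> nat \<Rightarrow> 'a set" where
  "below i n = {\<omega>\<in>space P. St 0 \<omega> = i \<and> (\<forall>m\<in>{1..n}. X m \<omega> < 0)}"

lemma below_past: "below i n \<in> sets (past n)"
proof -
  have [measurable]: "St 0 \<in> measurable (past n) (count_space UNIV)" by (rule past_St) simp
  have "{\<omega>\<in>space (past n). St 0 \<omega> = i} \<in> sets (past n)" by measurable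
  moreover have "{\<omega>\<in>space (past n). \<forall>m\<in>{1..n}. X m \<omega> < 0} \<in> sets (past n)"
  proof (intro sets.sets_Collect_finite_All)
    fix m assume "m \<in> {1..n}"
    then have [measurable]: "X m \<in> borel_measurable (past n)" by (intro past_X) auto
    show "{\<omega>\<in>space (past n). X m \<omega> < 0} \<in> sets (past n)" by measurable
  qed auto
  ultimately have "{\<omega>\<in>space (past n). St 0 \<omega> = i} \<inter> {\<omega>\<in>space (past n). \<forall>m\<in>{1..n}. X m \<omega> < 0} \<in> sets (past n)"
    by (rule sets.Int)
  also have "{\<omega>\<in>space (past n). St 0 \<omega> = i} \<inter> {\<omega>\<in>space (past n). \<forall>m\<in>{1..n}. X m \<omega> < 0} = below i n"
    by (auto simp: below_def)
  finally show ?thesis .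
qed

lemma below_sets [measurable]: "below i n \<in> sets P"
  by (rule past_subset[OF below_past])

text \<open>The rate \<open>c k\<close> of the exponential density cancels the normalisation
  \<open>1 / c k\<close> of the jump kernel.\<close>

lemma sojourn_law:
  assumes f [measurable]: "f \<in> borel_measurable (borel \<Otimes>\<^sub>M borel)"
  shows "(\<integral>\<^sup>+\<omega>. indicator (below i n \<inter> {\<omega>\<in>space P. St n \<omega> = k \<and> St (Suc n) \<omega> = j}) \<omega> *
        f (X n \<omega> + v k * hold n \<omega>, jump n \<omega>) \<partial>P)
    = (\<integral>\<^sup>+\<omega>. indicator (below i n \<inter> {\<omega>\<in>space P. St n \<omega> = k}) \<omega> *
        (\<integral>\<^sup>+z. sojourn k (z + X n \<omega>) * (\<integral>\<^sup>+u. f (- z, u) \<partial>Um k j) \<partial>lborel) \<partial>P)"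
proof -
  interpret U: finite_measure "Um k j" by (rule finite_measure_Um)
  define g where "g b = (\<integral>\<^sup>+u. f (b, u) \<partial>Um k j)" for b
  have [measurable]: "g \<in> borel_measurable borel" unfolding g_def by measurable
  have *: "(\<integral>\<^sup>+t. ennreal (1 / c k) * g (x + v k * t) \<partial>exp_law k) = (\<integral>\<^sup>+z. sojourn k (z + x) * g (- z) \<partial>lborel)" for x
  proof -
    have "(\<integral>\<^sup>+t. ennreal (1 / c k) * g (x + v k * t) \<partial>exp_law k)
        = ennreal (1 / c k) * (ennreal (c k) * (\<integral>\<^sup>+z. sojourn k (z + x) * g (- z) \<partial>lborel))"
      by (simp add: nn_integral_cmult nn_integral_exp_law)
    also have "\<dots> = (\<integral>\<^sup>+z. sojourn k (z + x) * g (- z) \<partial>lborel)"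
      using total_rate_pos[of k] by (simp flip: mult.assoc ennreal_mult)
    finally show ?thesis .
  qed
  show ?thesis
    using transition_integral[OF below_past, of "\<lambda>y. f (fst (fst y) + v k * snd (fst y), snd y)" i n k j]
    by (simp add: g_def[symmetric] *)
qed

text \<open>Gives the recursively defined \<open>occ\<close> its probabilistic meaning:
  \<open>- z\<close> is the level just before transition \<open>Suc n\<close>, and a jump follows
  according to the rates \<open>Um k j\<close>.\<close>

lemma occupation_law:
  assumes "f \<in> borel_measurable (borel \<Otimes>\<^sub>M borel)"
  shows "(\<integral>\<^sup>+\<omega>. indicator (below i n \<inter> {\<omega>\<in>space P. St n \<omega> = k \<and> St (Suc n) \<omega> = j}) \<omega> *
        f (X n \<omega> + v k * hold n \<omega>, jump n \<omega>) \<partial>P)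
    = emeasure P {\<omega>\<in>space P. M 0 \<omega> = i} * (\<integral>\<^sup>+z. occ i n k z * (\<integral>\<^sup>+u. f (- z, u) \<partial>Um k j) \<partial>lborel)"
  using assms
proof (induction n arbitrary: k j f)
  case 0
  note [measurable] = 0
  interpret U: finite_measure "Um k' j'" for k' j' by (rule finite_measure_Um)
  let ?\<Phi> = "\<lambda>z. \<integral>\<^sup>+u. f (- z, u) \<partial>Um k j"
  have eq: "below i 0 \<inter> {\<omega>\<in>space P. St 0 \<omega> = k} = (if i = k then {\<omega>\<in>space P. M 0 \<omega> = i} else {})"
    by (auto simp: below_def St_0)
  have [measurable]: "M 0 \<in> measurable P (count_space UNIV)" by (rule M_measurable) simp
  have "(\<integral>\<^sup>+\<omega>. indicator (below i 0 \<inter> {\<omega>\<in>space P. St 0 \<omega> = k}) \<omega> * (\<integral>\<^sup>+z. sojourn k (z + X 0 \<omega>) * ?\<Phi> z \<partial>lborel) \<partial>P)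
      = (\<integral>\<^sup>+\<omega>. indicator (if i = k then {\<omega>\<in>space P. M 0 \<omega> = i} else {}) \<omega> * (\<integral>\<^sup>+z. sojourn k z * ?\<Phi> z \<partial>lborel) \<partial>P)"
    unfolding eq by (intro nn_integral_cong) (simp add: X_0)
  also have "\<dots> = emeasure P {\<omega>\<in>space P. M 0 \<omega> = i} * (\<integral>\<^sup>+z. occ i 0 k z * ?\<Phi> z \<partial>lborel)"
    by (cases "i = k") (simp_all add: nn_integral_multc)
  finally show ?case unfolding sojourn_law[OF 0] .
next
  case (Suc n)
  let ?p = "emeasure P {\<omega>\<in>space P. M 0 \<omega> = i}"
  interpret U: finite_measure "Um k' j'" for k' j' by (rule finite_measure_Um)
  note [measurable] = Suc.prems
  let ?\<Phi> = "\<lambda>z. \<integral>\<^sup>+u. f (- z, u) \<partial>Um k j"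
  \<comment> \<open>\<open>\<psi> x\<close> integrates over a sojourn in \<open>k\<close> begun at
    level \<open>x\<close>. The induction hypothesis is applied to \<open>\<psi>\<close> at the
    level after the preceding transition, cut off by \<open>{..<0}\<close> in \<open>?F\<close>,
    which encodes that this transition ends below \<open>0\<close>.\<close>
  define \<psi> where "\<psi> x = (\<integral>\<^sup>+z. sojourn k (z + x) * ?\<Phi> z \<partial>lborel)" for x
  have [measurable]: "\<psi> \<in> borel_measurable borel" unfolding \<psi>_def by measurable
  let ?F = "\<lambda>y. \<psi> (fst y + snd y) * indicator {..<0} (fst y + snd y)"
  have "(\<integral>\<^sup>+\<omega>. indicator (below i (Suc n) \<inter> {\<omega>\<in>space P. St (Suc n) \<omega> = k}) \<omega> * \<psi> (X (Suc n) \<omega>) \<partial>P)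
      = (\<integral>\<^sup>+\<omega>. (\<Sum>l\<in>UNIV. indicator (below i n \<inter> {\<omega>\<in>space P. St n \<omega> = l \<and> St (Suc n) \<omega> = k}) \<omega> *
          ?F (X n \<omega> + v l * hold n \<omega>, jump n \<omega>)) \<partial>P)"
  proof (intro nn_integral_cong)
    fix \<omega> assume \<omega>: "\<omega> \<in> space P"
    have "(\<Sum>l\<in>UNIV. indicator (below i n \<inter> {\<omega>\<in>space P. St n \<omega> = l \<and> St (Suc n) \<omega> = k}) \<omega> *
          ?F (X n \<omega> + v l * hold n \<omega>, jump n \<omega>))
        = (\<Sum>l\<in>UNIV. if l = St n \<omega> then indicator (below i n \<inter> {\<omega>\<in>space P. St (Suc n) \<omega> = k}) \<omega> *
          (\<psi> (X (Suc n) \<omega>) * indicator {..<0} (X (Suc n) \<omega>)) else 0)"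
      by (intro sum.cong refl) (auto simp: indicator_def X_Suc)
    also have "\<dots> = indicator (below i n \<inter> {\<omega>\<in>space P. St (Suc n) \<omega> = k}) \<omega> *
          (\<psi> (X (Suc n) \<omega>) * indicator {..<0} (X (Suc n) \<omega>))" by simp
    also have "\<dots> = indicator (below i (Suc n) \<inter> {\<omega>\<in>space P. St (Suc n) \<omega> = k}) \<omega> * \<psi> (X (Suc n) \<omega>)"
      using \<omega> by (auto simp: indicator_def below_def atLeastAtMostSuc_conv)
    finally show "indicator (below i (Suc n) \<inter> {\<omega>\<in>space P. St (Suc n) \<omega> = k}) \<omega> * \<psi> (X (Suc n) \<omega>) =
      (\<Sum>l\<in>UNIV. indicator (below i n \<inter> {\<omega>\<in>space P. St n \<omega> = l \<and> St (Suc n) \<omega> = k}) \<omega> *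
          ?F (X n \<omega> + v l * hold n \<omega>, jump n \<omega>))" ..
  qed
  also have "\<dots> = (\<Sum>l\<in>UNIV. ?p * (\<integral>\<^sup>+z. occ i n l z * (\<integral>\<^sup>+u. ?F (- z, u) \<partial>Um l k) \<partial>lborel))"
    by (subst nn_integral_sum, measurable) (intro sum.cong refl Suc.IH, measurable)
  also have "\<dots> = ?p * (\<Sum>l\<in>UNIV. \<integral>\<^sup>+z. occ i n l z * (\<integral>\<^sup>+u. \<psi> (u - z) * indicator {..<0} (u - z) \<partial>Um l k) \<partial>lborel)"
    by (simp add: sum_distrib_left)
  also have "\<dots> = ?p * (\<integral>\<^sup>+a. entrance (occ i n) k a * (\<psi> (- a) * indicator {..<0} (- a)) \<partial>lborel)"
    by (subst entrance_shift[of "occ i n" "\<lambda>x. \<psi> x * indicator {..<0} x"]) auto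
  also have "(\<integral>\<^sup>+a. entrance (occ i n) k a * (\<psi> (- a) * indicator {..<0} (- a)) \<partial>lborel)
      = (\<integral>\<^sup>+a. \<integral>\<^sup>+z. entrance (occ i n) k a * indicator {0<..} a * sojourn k (z - a) * ?\<Phi> z \<partial>lborel \<partial>lborel)"
    unfolding \<psi>_def
    by (intro nn_integral_cong, subst nn_integral_multc[symmetric], measurable, subst nn_integral_cmult[symmetric], measurable)
      (auto intro!: nn_integral_cong simp: mult_ac split: split_indicator)
  also have "\<dots> = (\<integral>\<^sup>+z. \<integral>\<^sup>+a. entrance (occ i n) k a * indicator {0<..} a * sojourn k (z - a) * ?\<Phi> z \<partial>lborel \<partial>lborel)"
    by (rule lborel_pair.Fubini') measurable
  also have "\<dots> = (\<integral>\<^sup>+z. occ i (Suc n) k z * ?\<Phi> z \<partial>lborel)"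
    by (rule nn_integral_cong, subst nn_integral_multc, measurable) (simp add: next_occ_def mult_ac)
  finally show ?case unfolding sojourn_law[OF Suc.prems] \<psi>_def .
qed

lemma AE_jump_nonneg: "AE \<omega> in P. \<forall>n. 0 \<le> jump n \<omega>"
proof -
  have "AE \<omega> in P. 0 \<le> jump n \<omega>" for n
  proof -
    have null: "emeasure (Um k j) {..<0} = 0" for k j
      by (rule null_setsD1, subst AE_iff_null_sets, simp, rule eventually_mono[OF AE_Um_nonneg]) auto
    have "emeasure P {\<omega>\<in>space P. St n \<omega> = k \<and> St (Suc n) \<omega> = j \<and> jump n \<omega> \<in> {..<0}} = 0" for k j
    proof -
      have "{\<omega>\<in>space P. St n \<omega> = k \<and> St (Suc n) \<omega> = j \<and> jump n \<omega> \<in> {..<0}}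
          = space P \<inter> {\<omega>\<in>space P. St n \<omega> = k \<and> St (Suc n) \<omega> = j \<and> hold n \<omega> \<in> UNIV \<and> jump n \<omega> \<in> {..<0}}"
        by auto
      then show ?thesis
        using markov[of "space P" n UNIV "{..<0}" k j] sets.top[of "past n"] null[of k j] by simp
    qed
    then have "AE \<omega> in P. \<not> (St n \<omega> = k \<and> St (Suc n) \<omega> = j \<and> jump n \<omega> < 0)" for k j
      by (subst AE_iff_measurable[where N = "{\<omega>\<in>space P. St n \<omega> = k \<and> St (Suc n) \<omega> = j \<and> jump n \<omega> \<in> {..<0}}"]) auto
    then have "AE \<omega> in P. \<forall>k. \<forall>j. \<not> (St n \<omega> = k \<and> St (Suc n) \<omega> = j \<and> jump n \<omega> < 0)"
      by (intro eventually_all_finite)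
    then show ?thesis by eventually_elim auto
  qed
  then show ?thesis by (simp add: AE_all_countable)
qed

end

section \<open>First passage\<close>

context markov_additive_process
begin

text \<open>Level \<open>0\<close> is reached by time \<open>T n\<close>: either at a transition instant or inside a sojourn with
  positive slope. Since jumps are nonnegative almost surely, the second alternative implies the
  first, but not on every path.\<close>

definition crossed :: "nat \<Rightarrow> 'a \<Rightarrow> bool" where
  "crossed n \<omega> \<longleftrightarrow> (\<exists>m\<in>{1..n}. 0 \<le> X m \<omega>) \<or> (\<exists>m<n. 0 < v (St m \<omega>) \<and> 0 < X m \<omega> + v (St m \<omega>) * hold m \<omega>)"

lemma crossed_mono: "crossed m \<omega> \<Longrightarrow> m \<le> n \<Longrightarrow> crossed n \<omega>"
  unfolding crossed_def by (meson atLeastAtMost_iff le_trans less_le_trans)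

lemma sojourn_exists:
  assumes "\<omega> \<in> space P" "0 \<le> t" "t < T n \<omega>"
  shows "\<exists>m<n. T m \<omega> \<le> t \<and> t < T (Suc m) \<omega>"
proof -
  define k where "k = (LEAST k. t < T k \<omega>)"
  have k: "t < T k \<omega>" unfolding k_def by (rule LeastI) (rule assms(3))
  have kn: "k \<le> n" unfolding k_def by (rule Least_le) (rule assms(3))
  have "k \<noteq> 0" using k assms(2) T_0[OF assms(1)] by (intro notI) simp
  then obtain m where m: "k = Suc m" using not0_implies_Suc by blast
  have "\<not> t < T m \<omega>" using not_less_Least[of m "\<lambda>k. t < T k \<omega>"] m by (simp add: k_def)
  then show ?thesis using k kn m by (intro exI[of _ m]) auto
qed

text \<open>The hitting time is an infimum, so negativity up to \<open>T n\<close> would not exclude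
  that it equals \<open>T n\<close>; the margin up to \<open>b\<close> does.\<close>

lemma Y_neg_not_crossed:
  assumes \<omega>: "\<omega> \<in> space P" and n: "1 \<le> n" and nc: "\<not> crossed n \<omega>"
  shows "\<exists>b>T n \<omega>. \<forall>t. 0 < t \<and> t < b \<longrightarrow> Y t \<omega> < 0"
proof -
  have Xm: "X m \<omega> < 0" if "1 \<le> m" "m \<le> n" for m
    using nc that by (force simp: crossed_def not_le)
  \<comment> \<open>The left limit at the end of a rising sojourn may be \<open>0\<close>, but
    inside the sojourn the path is strictly lower.\<close>
  have up: "X m \<omega> + v (St m \<omega>) * hold m \<omega> \<le> 0" if "m < n" "0 < v (St m \<omega>)" for m
    using nc that by (force simp: crossed_def not_le)
  \<comment> \<open>Before this time the drift, of speed at most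
    \<open>\<bar>v (St n \<omega>)\<bar>\<close>, cannot make up the distance
    \<open>\<bar>X n \<omega>\<bar>\<close> to level \<open>0\<close>.\<close>
  define b where "b = min (T (Suc n) \<omega>) (T n \<omega> + \<bar>X n \<omega>\<bar> / \<bar>v (St n \<omega>)\<bar>)"
  have v: "v k \<noteq> 0" for k by (rule v_nonzero)
  have "T n \<omega> < b" unfolding b_def using Xm[of n] n v T_less[OF \<omega> lessI, of n]
    by (simp add: divide_less_0_iff)
  moreover have "Y t \<omega> < 0" if t: "0 < t" "t < b" for t
  proof (cases "t < T n \<omega>")
    case True
    obtain m where m: "m < n" "T m \<omega> \<le> t" "t < T (Suc m) \<omega>"
      using sojourn_exists[OF \<omega> _ True] t by auto
    have Y: "Y t \<omega> = X m \<omega> + v (St m \<omega>) * (t - T m \<omega>)" using m \<omega> by (simp add: Y_sojourn)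
    show ?thesis
    proof (cases "0 < v (St m \<omega>)")
      case True
      then have "v (St m \<omega>) * (t - T m \<omega>) < v (St m \<omega>) * hold m \<omega>"
        using m by (intro mult_strict_left_mono) (auto simp: hold_def)
      then show ?thesis using Y up[OF m(1) True] by simp
    next
      case False
      then have vneg: "v (St m \<omega>) < 0" using v[of "St m \<omega>"] by simp
      \<comment> \<open>The initial sojourn starts at level \<open>0\<close> itself; negativity
        there comes from the slope and \<open>0 < t\<close>.\<close>
      show ?thesis
      proof (cases "m = 0")
        case True
        then show ?thesis using Y t vneg T_0[OF \<omega>] X_0[OF \<omega>] by (simp add: mult_neg_pos)
      next
        case False
        then show ?thesis using Y Xm[of m] m vneg mult_nonpos_nonneg[of "v (St m \<omega>)" "t - T m \<omega>"] by simp
      qed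
    qed
  next
    case False
    then have tn: "T n \<omega> \<le> t" "t < T (Suc n) \<omega>" "t - T n \<omega> < \<bar>X n \<omega>\<bar> / \<bar>v (St n \<omega>)\<bar>"
      using t by (auto simp: b_def)
    have "v (St n \<omega>) * (t - T n \<omega>) \<le> \<bar>v (St n \<omega>)\<bar> * (t - T n \<omega>)"
      using tn(1) by (intro mult_right_mono) auto
    also have "\<dots> < \<bar>X n \<omega>\<bar>"
      using tn(3) v[of "St n \<omega>"] by (simp add: field_simps)
    finally show ?thesis using Xm[of n] n Y_sojourn[OF \<omega> tn(1,2)] by simp
  qed
  ultimately show ?thesis by blast
qed

lemma hitting_time_le_iff:
  assumes \<omega>: "\<omega> \<in> space P" and n: "1 \<le> n"
  shows "hitting_time Y \<omega> \<le> ereal (T n \<omega>) \<longleftrightarrow> crossed n \<omega>"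
proof
  assume "crossed n \<omega>"
  then consider (jump) m where "m \<in> {1..n}" "0 \<le> X m \<omega>"
    | (line) m where "m < n" "0 < v (St m \<omega>)" "0 < X m \<omega> + v (St m \<omega>) * hold m \<omega>"
    unfolding crossed_def by blast
  then have "\<exists>t. 0 < t \<and> t \<le> T n \<omega> \<and> 0 \<le> Y t \<omega>"
  proof cases
    case jump
    then show ?thesis
      using T_less[OF \<omega>, of 0 m] T_less[OF \<omega>, of m n] T_0[OF \<omega>]
      by (intro exI[of _ "T m \<omega>"]) (auto simp: X_def le_less)
  next
    case line
    \<comment> \<open>The first entry is the time at which the line meets \<open>0\<close>. If
      \<open>X m \<omega> \<ge> 0\<close>, that time does not exceed \<open>T m\<close>, and the
      midpoint supplies a time strictly inside the sojourn.\<close>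
    let ?t = "max (T m \<omega> - X m \<omega> / v (St m \<omega>)) ((T m \<omega> + T (Suc m) \<omega>) / 2)"
    have T: "T m \<omega> < T (Suc m) \<omega>" by (rule T_less[OF \<omega> lessI])
    have "- X m \<omega> / v (St m \<omega>) < hold m \<omega>"
      using line by (simp add: field_simps)
    then have t: "T m \<omega> < ?t" "?t < T (Suc m) \<omega>"
      using T by (auto simp: hold_def less_max_iff_disj)
    have "v (St m \<omega>) * (- X m \<omega> / v (St m \<omega>)) \<le> v (St m \<omega>) * (?t - T m \<omega>)"
      using line by (intro mult_left_mono) auto
    then have "0 \<le> Y ?t \<omega>" using line Y_sojourn[OF \<omega>, of m ?t] t by simp
    moreover have "T (Suc m) \<omega> \<le> T n \<omega>"
      using T_less[OF \<omega>, of "Suc m" n] line(1) by (cases "Suc m = n") auto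
    ultimately show ?thesis using t T_nonneg[OF \<omega>, of m] by (intro exI[of _ ?t]) linarith
  qed
  then obtain t where t: "0 < t" "t \<le> T n \<omega>" "0 \<le> Y t \<omega>" by blast
  then have "hitting_time Y \<omega> \<le> ereal t" unfolding hitting_time_def by (intro INF_lower) simp
  also have "\<dots> \<le> ereal (T n \<omega>)" using t by simp
  finally show "hitting_time Y \<omega> \<le> ereal (T n \<omega>)" .
next
  assume le: "hitting_time Y \<omega> \<le> ereal (T n \<omega>)"
  show "crossed n \<omega>"
  proof (rule ccontr)
    assume "\<not> crossed n \<omega>"
    from Y_neg_not_crossed[OF \<omega> n this] obtain b where b: "T n \<omega> < b" "\<And>t. 0 < t \<Longrightarrow> t < b \<Longrightarrow> Y t \<omega> < 0"
      by blast
    have "ereal b \<le> hitting_time Y \<omega>"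
      unfolding hitting_time_def by (rule INF_greatest) (use b(2) in force)
    then have "ereal b \<le> ereal (T n \<omega>)" using le by (rule order_trans)
    then show False using b(1) by simp
  qed
qed

lemma next_transition_eq:
  assumes \<omega>: "\<omega> \<in> space P" and n: "crossed (Suc n) \<omega>" "\<not> crossed n \<omega>"
  shows "next_transition Y T \<omega> = ereal (T (Suc n) \<omega>)"
  unfolding next_transition_def
proof (rule antisym)
  show "(INF m\<in>{m. 1 \<le> m \<and> hitting_time Y \<omega> \<le> ereal (T m \<omega>)}. ereal (T m \<omega>)) \<le> ereal (T (Suc n) \<omega>)"
    using hitting_time_le_iff[OF \<omega>, of "Suc n"] n by (intro INF_lower) auto
  show "ereal (T (Suc n) \<omega>) \<le> (INF m\<in>{m. 1 \<le> m \<and> hitting_time Y \<omega> \<le> ereal (T m \<omega>)}. ereal (T m \<omega>))"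
  proof (rule INF_greatest)
    fix m assume "m \<in> {m. 1 \<le> m \<and> hitting_time Y \<omega> \<le> ereal (T m \<omega>)}"
    then have "crossed m \<omega>" using hitting_time_le_iff[OF \<omega>, of m] by simp
    then have "Suc n \<le> m" using crossed_mono[of m \<omega> n] n by (meson not_less_eq_eq)
    then show "ereal (T (Suc n) \<omega>) \<le> ereal (T m \<omega>)"
      using T_less[OF \<omega>, of "Suc n" m] by (cases "Suc n = m") auto
  qed
qed

lemma first_crossing:
  assumes "crossed n \<omega>"
  shows "\<exists>m. crossed (Suc m) \<omega> \<and> \<not> crossed m \<omega>"
proof -
  have 0: "\<not> crossed 0 \<omega>" by (simp add: crossed_def)
  show ?thesis using assms
  proof (induction n)
    case (Suc n)
    then show ?case by blast
  qed (use 0 in blast)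
qed

text \<open>Holds on every path, because \<open>crossed\<close> matches the hitting time pathwise;
  almost sure arguments start only with \<open>crossed_iff\<close>.\<close>

lemma next_transition_event_iff:
  assumes \<omega>: "\<omega> \<in> space P"
  shows "next_transition Y T \<omega> < \<infinity> \<and> M (real_of_ereal (next_transition Y T \<omega>)) \<omega> = j
      \<and> Y (real_of_ereal (next_transition Y T \<omega>)) \<omega> \<le> x
    \<longleftrightarrow> (\<exists>n. crossed (Suc n) \<omega> \<and> \<not> crossed n \<omega> \<and> St (Suc n) \<omega> = j \<and> X (Suc n) \<omega> \<le> x)"
    (is "?l \<longleftrightarrow> ?r")
proof
  assume ?r
  then obtain n where n: "crossed (Suc n) \<omega>" "\<not> crossed n \<omega>" "St (Suc n) \<omega> = j" "X (Suc n) \<omega> \<le> x" by blast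
  then show ?l using next_transition_eq[OF \<omega> n(1,2)] by (simp add: St_def X_def)
next
  assume l: ?l
  have "\<exists>m. 1 \<le> m \<and> hitting_time Y \<omega> \<le> ereal (T m \<omega>)"
  proof (rule ccontr)
    assume "\<not> ?thesis"
    then have "{m. 1 \<le> m \<and> hitting_time Y \<omega> \<le> ereal (T m \<omega>)} = {}" by auto
    then have "next_transition Y T \<omega> = \<infinity>"
      by (simp only: next_transition_def image_empty Inf_empty top_ereal_def)
    then show False using l by simp
  qed
  then obtain m where "crossed m \<omega>" using hitting_time_le_iff[OF \<omega>] by blast
  then obtain n where n: "crossed (Suc n) \<omega>" "\<not> crossed n \<omega>" using first_crossing by blast
  then show ?r using l next_transition_eq[OF \<omega> n] by (intro exI[of _ n]) (simp add: St_def X_def)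
qed

lemma crossed_iff:
  assumes "\<forall>n. 0 \<le> jump n \<omega>"
  shows "crossed n \<omega> \<longleftrightarrow> (\<exists>m\<in>{1..n}. 0 \<le> X m \<omega>)"
proof -
  have "0 \<le> X (Suc m) \<omega>" if "0 < X m \<omega> + v (St m \<omega>) * hold m \<omega>" for m
    using that assms by (simp add: X_Suc add_nonneg_nonneg less_imp_le)
  then have "\<exists>m'\<in>{1..n}. 0 \<le> X m' \<omega>" if "m < n" "0 < X m \<omega> + v (St m \<omega>) * hold m \<omega>" for m
    using that by (intro bexI[of _ "Suc m"]) auto
  then show ?thesis unfolding crossed_def by blast
qed

text \<open>The integral runs over all real \<open>z\<close>: a negative \<open>z\<close> means that
  level \<open>0\<close> was already passed inside the current sojourn.\<close>

definition exit_prob :: "'s \<Rightarrow> 's \<Rightarrow> real \<Rightarrow> ennreal" where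
  "exit_prob i j x = (\<Sum>k\<in>UNIV. \<integral>\<^sup>+z. total_occ i k z * (\<integral>\<^sup>+u. indicator {0..x} (u - z) \<partial>Um k j) \<partial>lborel)"

text \<open>Decomposition by the index of the exit transition. The events are disjoint, since the
  position after an earlier transition cannot be both negative and nonnegative.\<close>

lemma emeasure_exit:
  "emeasure P {\<omega>\<in>space P. (\<exists>n. crossed (Suc n) \<omega> \<and> \<not> crossed n \<omega> \<and> St (Suc n) \<omega> = j \<and> X (Suc n) \<omega> \<le> x) \<and> M 0 \<omega> = i}
    = emeasure P {\<omega>\<in>space P. M 0 \<omega> = i} * exit_prob i j x"
proof -
  interpret U: finite_measure "Um k' j'" for k' j' by (rule finite_measure_Um)
  have [measurable]: "M 0 \<in> measurable P (count_space UNIV)" by (rule M_measurable) simp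
  let ?p = "emeasure P {\<omega>\<in>space P. M 0 \<omega> = i}"
  let ?B = "\<lambda>n. below i n \<inter> {\<omega>\<in>space P. St (Suc n) \<omega> = j \<and> 0 \<le> X (Suc n) \<omega> \<and> X (Suc n) \<omega> \<le> x}"
  have [measurable]: "Measurable.pred P (crossed n)" for n unfolding crossed_def[abs_def] by measurable
  have B: "emeasure P (?B n) = ?p * (\<Sum>k\<in>UNIV. \<integral>\<^sup>+z. occ i n k z * (\<integral>\<^sup>+u. indicator {0..x} (u - z) \<partial>Um k j) \<partial>lborel)" for n
  proof -
    let ?F = "\<lambda>y :: real \<times> real. indicator {0..x} (fst y + snd y) :: ennreal"
    have "emeasure P (?B n) = (\<integral>\<^sup>+\<omega>. indicator (?B n) \<omega> \<partial>P)" by simp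
    also have "\<dots> = (\<integral>\<^sup>+\<omega>. (\<Sum>k\<in>UNIV. indicator (below i n \<inter> {\<omega>\<in>space P. St n \<omega> = k \<and> St (Suc n) \<omega> = j}) \<omega> *
          ?F (X n \<omega> + v k * hold n \<omega>, jump n \<omega>)) \<partial>P)"
    proof (rule nn_integral_cong)
      fix \<omega> assume \<omega>: "\<omega> \<in> space P"
      have "(\<Sum>k\<in>UNIV. indicator (below i n \<inter> {\<omega>\<in>space P. St n \<omega> = k \<and> St (Suc n) \<omega> = j}) \<omega> *
          ?F (X n \<omega> + v k * hold n \<omega>, jump n \<omega>)) = (\<Sum>k\<in>UNIV. if k = St n \<omega> then indicator (?B n) \<omega> else 0)"
        using \<omega> by (intro sum.cong refl) (auto simp: indicator_def X_Suc)
      then show "indicator (?B n) \<omega> = (\<Sum>k\<in>UNIV. indicator (below i n \<inter> {\<omega>\<in>space P. St n \<omega> = k \<and> St (Suc n) \<omega> = j}) \<omega> *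
          ?F (X n \<omega> + v k * hold n \<omega>, jump n \<omega>))" by simp
    qed
    also have "\<dots> = (\<Sum>k\<in>UNIV. ?p * (\<integral>\<^sup>+z. occ i n k z * (\<integral>\<^sup>+u. ?F (- z, u) \<partial>Um k j) \<partial>lborel))"
      by (subst nn_integral_sum, measurable) (intro sum.cong refl occupation_law, measurable)
    finally show ?thesis by (simp add: sum_distrib_left)
  qed
  have "emeasure P {\<omega>\<in>space P. (\<exists>n. crossed (Suc n) \<omega> \<and> \<not> crossed n \<omega> \<and> St (Suc n) \<omega> = j \<and> X (Suc n) \<omega> \<le> x) \<and> M 0 \<omega> = i}
      = emeasure P (\<Union>n. ?B n)"
  proof (intro emeasure_eq_AE, use AE_jump_nonneg AE_space in eventually_elim)
    fix \<omega> assume jn: "\<forall>n. 0 \<le> jump n \<omega>" and \<omega>: "\<omega> \<in> space P"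
    have "crossed (Suc n) \<omega> \<and> \<not> crossed n \<omega> \<longleftrightarrow> (\<forall>m\<in>{1..n}. X m \<omega> < 0) \<and> 0 \<le> X (Suc n) \<omega>" for n
    proof -
      have "{1..Suc n} = insert (Suc n) {1..n}" by auto
      then show ?thesis unfolding crossed_iff[OF jn] by (auto simp: not_le)
    qed
    then show "\<omega> \<in> {\<omega>\<in>space P. (\<exists>n. crossed (Suc n) \<omega> \<and> \<not> crossed n \<omega> \<and> St (Suc n) \<omega> = j \<and> X (Suc n) \<omega> \<le> x) \<and> M 0 \<omega> = i}
       \<longleftrightarrow> \<omega> \<in> (\<Union>n. ?B n)"
      using \<omega> by (auto simp: below_def St_0)
  qed measurable
  also have "\<dots> = (\<Sum>n. emeasure P (?B n))"
  proof (intro suminf_emeasure[symmetric])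
    show "disjoint_family ?B"
      unfolding disjoint_family_on_def
    proof (intro ballI impI)
      fix m n :: nat assume "m \<noteq> n"
      have *: "?B m \<inter> ?B n = {}" if "m < n" for m n
      proof -
        have "X (Suc m) \<omega> < 0" if "\<omega> \<in> below i n" for \<omega>
          using that \<open>m < n\<close> by (auto simp: below_def)
        then show ?thesis by force
      qed
      show "?B m \<inter> ?B n = {}"
        using \<open>m \<noteq> n\<close> *[of m n] *[of n m] by (cases "m < n") auto
    qed
  qed auto
  also have "(\<Sum>n. emeasure P (?B n)) = (\<Sum>n. ?p * (\<Sum>k\<in>UNIV. \<integral>\<^sup>+z. occ i n k z * (\<integral>\<^sup>+u. indicator {0..x} (u - z) \<partial>Um k j) \<partial>lborel))"
    by (simp only: B)
  also have "\<dots> = ?p * (\<Sum>k\<in>UNIV. \<Sum>n. \<integral>\<^sup>+z. occ i n k z * (\<integral>\<^sup>+u. indicator {0..x} (u - z) \<partial>Um k j) \<partial>lborel)"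
    by (simp add: suminf_sum summableI)
  also have "(\<Sum>k\<in>UNIV. \<Sum>n. \<integral>\<^sup>+z. occ i n k z * (\<integral>\<^sup>+u. indicator {0..x} (u - z) \<partial>Um k j) \<partial>lborel) = exit_prob i j x"
    unfolding exit_prob_def total_occ_def
    by (intro sum.cong refl, subst nn_integral_suminf[symmetric]) simp_all
  finally show ?thesis .
qed

text \<open>Finiteness holds because \<open>exit_prob\<close> times the positive number
  \<open>prob {\<omega>\<in>space P. M 0 \<omega> = i}\<close> is a probability.\<close>

lemma H_eq_exit_prob:
  assumes p: "prob {\<omega>\<in>space P. M 0 \<omega> = i} > 0"
  shows "H P M Y T i j x = enn2real (exit_prob i j x)" and "exit_prob i j x < \<infinity>"
proof -
  let ?p = "prob {\<omega>\<in>space P. M 0 \<omega> = i}"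
  let ?e = "{\<omega>\<in>space P. (\<exists>n. crossed (Suc n) \<omega> \<and> \<not> crossed n \<omega> \<and> St (Suc n) \<omega> = j \<and> X (Suc n) \<omega> \<le> x) \<and> M 0 \<omega> = i}"
  have eq: "{\<omega>\<in>space P. (next_transition Y T \<omega> < \<infinity> \<and>
              M (real_of_ereal (next_transition Y T \<omega>)) \<omega> = j \<and>
              Y (real_of_ereal (next_transition Y T \<omega>)) \<omega> \<le> x) \<and> M 0 \<omega> = i} = ?e"
    using next_transition_event_iff by blast
  have ee: "ennreal (prob ?e) = ennreal ?p * exit_prob i j x"
    using emeasure_exit[of j x i] by (simp add: emeasure_eq_measure)
  show fin: "exit_prob i j x < \<infinity>"
  proof (rule ccontr)
    assume "\<not> exit_prob i j x < \<infinity>"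
    then have "exit_prob i j x = \<top>" by (simp add: not_less top_unique)
    then show False using ee p by (simp add: ennreal_mult_eq_top_iff ennreal_mult_top)
  qed
  have "prob ?e = ?p * enn2real (exit_prob i j x)"
  proof -
    have "prob ?e = enn2real (ennreal ?p * exit_prob i j x)" unfolding ee[symmetric] by simp
    then show ?thesis by (simp add: enn2real_mult)
  qed
  then show "H P M Y T i j x = enn2real (exit_prob i j x)"
    unfolding H_def cond_prob_def eq using p by simp
qed

end

section \<open>Evaluation of the exit law\<close>

context map_data
begin

text \<open>After Tonelli, \<open>z\<close> ranges over \<open>[u - x, 0]\<close>, since the final
  level \<open>u - z\<close> must not exceed \<open>x\<close>; the exponential integrates
  explicitly.\<close>

lemma exit_integral:
  assumes vk: "0 < v k"
  shows "(\<integral>\<^sup>+z. ennreal (exp (c k * z / v k)) * indicator {..0} z * (\<integral>\<^sup>+u. indicator {0..x} (u - z) \<partial>Um k j) \<partial>lborel)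
    = (\<integral>\<^sup>+u. ennreal ((1 - exp (- c k * (x - u) / v k)) * (v k / c k)) * indicator {0..x} u \<partial>Um k j)"
proof -
  interpret U: finite_measure "Um k j" by (rule finite_measure_Um)
  interpret pair_sigma_finite lborel "Um k j" ..
  have ck: "0 < c k" by (rule total_rate_pos)
  have "(\<integral>\<^sup>+z. ennreal (exp (c k * z / v k)) * indicator {..0} z * (\<integral>\<^sup>+u. indicator {0..x} (u - z) \<partial>Um k j) \<partial>lborel)
      = (\<integral>\<^sup>+z. \<integral>\<^sup>+u. ennreal (exp (c k * z / v k)) * indicator {..0} z * indicator {0..x} (u - z) \<partial>Um k j \<partial>lborel)"
    by (rule nn_integral_cong, rule nn_integral_cmult[symmetric]) measurable
  also have "\<dots> = (\<integral>\<^sup>+u. \<integral>\<^sup>+z. ennreal (exp (c k * z / v k)) * indicator {..0} z * indicator {0..x} (u - z) \<partial>lborel \<partial>Um k j)"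
    by (rule Fubini'[symmetric]) measurable
  also have "\<dots> = (\<integral>\<^sup>+u. ennreal ((1 - exp (- c k * (x - u) / v k)) * (v k / c k)) * indicator {0..x} u \<partial>Um k j)"
  proof (intro nn_integral_cong_AE eventually_mono[OF AE_Um_nonneg])
    fix u :: real assume u: "0 \<le> u"
    show "(\<integral>\<^sup>+z. ennreal (exp (c k * z / v k)) * indicator {..0} z * indicator {0..x} (u - z) \<partial>lborel)
        = ennreal ((1 - exp (- c k * (x - u) / v k)) * (v k / c k)) * indicator {0..x} u"
    proof (cases "u \<le> x")
      case True
      have "(\<integral>\<^sup>+z. ennreal (exp (c k * z / v k)) * indicator {..0} z * indicator {0..x} (u - z) \<partial>lborel)
          = (\<integral>\<^sup>+z. ennreal (exp (c k * z / v k)) * indicator {u - x..0} z \<partial>lborel)"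
        using u by (intro nn_integral_cong) (auto split: split_indicator)
      also have "\<dots> = ennreal (v k / c k * exp (c k * 0 / v k) - v k / c k * exp (c k * (u - x) / v k))"
      proof (rule nn_integral_FTC_Icc[where F = "\<lambda>z. v k / c k * exp (c k * z / v k)"])
        fix z
        show "((\<lambda>z. v k / c k * exp (c k * z / v k)) has_real_derivative exp (c k * z / v k)) (at z)"
          using vk ck by (auto intro!: derivative_eq_intros)
      qed (use True in auto)
      also have "v k / c k * exp (c k * 0 / v k) - v k / c k * exp (c k * (u - x) / v k)
          = (1 - exp (- c k * (x - u) / v k)) * (v k / c k)"
        by (simp add: algebra_simps diff_divide_distrib)
      finally show ?thesis using True u by simp
    next
      case False
      then have "(\<integral>\<^sup>+z. ennreal (exp (c k * z / v k)) * indicator {..0} z * indicator {0..x} (u - z) \<partial>lborel)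
          = (\<integral>\<^sup>+(z::real). 0 \<partial>lborel)"
        by (intro nn_integral_cong) (auto split: split_indicator)
      then show ?thesis using False by simp
    qed
  qed
  finally show ?thesis .
qed

text \<open>A rising initial sojourn followed by a nonnegative jump ends at or above the initial
  level, so the killed chain has no second sojourn.\<close>

lemma occ_Suc_start_pos:
  assumes "0 < v i"
  shows "occ i (Suc n) k = (\<lambda>z. 0)"
proof (induction n arbitrary: k)
  case 0
  have "entrance (occ i 0) k a = 0" if a: "0 < a" for a
  proof -
    have "(\<integral>\<^sup>+u. occ i 0 l (a + u) \<partial>Um l k) = (\<integral>\<^sup>+u. 0 \<partial>Um l k)" for l
      by (intro nn_integral_cong_AE eventually_mono[OF AE_Um_nonneg])
        (use assms a in \<open>auto simp: sojourn_def divide_le_0_iff\<close>)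
    then show ?thesis unfolding entrance_def by simp
  qed
  then have "(\<lambda>a. entrance (occ i 0) k a * sojourn k (z - a) * indicator {0<..} a) = (\<lambda>a. 0)" for z
    by (auto split: split_indicator)
  then show ?case unfolding occ.simps(2) next_occ_def by simp
next
  case (Suc n)
  then have "entrance (occ i (Suc n)) k a = 0" for a
    unfolding entrance_def by (simp del: occ.simps)
  then show ?case unfolding occ.simps(2)[of i "Suc n"] next_occ_def by (simp del: occ.simps)
qed

lemma total_occ_start_pos:
  assumes "0 < v i"
  shows "total_occ i k z = occ i 0 k z"
proof -
  have "total_occ i k z = (\<Sum>n\<in>{0}. occ i n k z)"
    unfolding total_occ_def
  proof (rule suminf_finite)
    fix n :: nat assume "n \<notin> {0}"
    then obtain m where "n = Suc m" by (cases n) auto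
    then show "occ i n k z = 0" using occ_Suc_start_pos[OF assms, of m k] by simp
  qed simp
  then show ?thesis by simp
qed

text \<open>Levels above the start are reached only in the sojourn that crosses level
  \<open>0\<close>, and by memorylessness its density decays exponentially from the value at the
  crossing.\<close>

lemma total_occ_above:
  assumes i: "v i < 0" and z: "z < 0"
  shows "total_occ i k z = (if 0 < v k then ennreal (exp (c k * z / v k)) * total_occ i k 0 else 0)"
proof (cases "0 < v k")
  case True
  have o: "occ i 0 k y = 0" for y using i True by auto
  have "next_occ (total_occ i) k z = (\<integral>\<^sup>+a. ennreal (exp (c k * z / v k)) *
      (entrance (total_occ i) k a * sojourn k (0 - a) * indicator {0<..} a) \<partial>lborel)"
    unfolding next_occ_def
  proof (rule nn_integral_cong)
    fix a :: real
    have "sojourn k (z - a) = ennreal (exp (c k * z / v k)) * sojourn k (0 - a)" if "0 < a"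
    proof -
      have "exp (c k * (z - a) / v k) / \<bar>v k\<bar> = exp (c k * z / v k) * (exp (c k * (0 - a) / v k) / \<bar>v k\<bar>)"
        by (simp add: right_diff_distrib diff_divide_distrib exp_diff exp_minus field_simps)
      then show ?thesis using that z True
        by (simp add: sojourn_def divide_le_0_iff flip: ennreal_mult)
    qed
    then show "entrance (total_occ i) k a * sojourn k (z - a) * indicator {0<..} a
        = ennreal (exp (c k * z / v k)) * (entrance (total_occ i) k a * sojourn k (0 - a) * indicator {0<..} a)"
      by (auto simp: mult_ac split: split_indicator)
  qed
  also have "\<dots> = ennreal (exp (c k * z / v k)) * next_occ (total_occ i) k 0"
    unfolding next_occ_def by (rule nn_integral_cmult) measurable
  finally show ?thesis using True total_occ_eq[of i k z] total_occ_eq[of i k 0] o by simp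
next
  case False
  then have vk: "v k < 0" using v_nonzero[of k] by simp
  have "(\<lambda>a. entrance (total_occ i) k a * sojourn k (z - a) * indicator {0<..} a) = (\<lambda>a. 0)"
    using z vk by (auto simp: sojourn_def divide_le_0_iff split: split_indicator)
  then have "next_occ (total_occ i) k z = 0" unfolding next_occ_def by simp
  moreover have "occ i 0 k z = 0" using vk z by (auto simp: sojourn_def divide_le_0_iff)
  ultimately show ?thesis using False total_occ_eq[of i k z] by simp
qed

text \<open>Substitution \<open>w = u - z\<close>, the level after the exit. From a depth
  \<open>z > 0\<close> the atom of \<open>Um\<close> at \<open>0\<close> cannot lead to a
  nonnegative level, so only \<open>Dm\<close> remains.\<close>

lemma below_integral:
  assumes [measurable]: "g \<in> borel_measurable borel"
  shows "(\<integral>\<^sup>+z. g z * indicator {0..} z * (\<integral>\<^sup>+u. indicator {0..x} (u - z) \<partial>Um k j) \<partial>lborel)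
    = (\<integral>\<^sup>+w. indicator {0..x} w * (\<integral>\<^sup>+u. indicator {w..} u * g (u - w) \<partial>Dm k j) \<partial>lborel)"
proof -
  interpret Dm: finite_measure "Dm k j" by (rule finite_measure_Dm)
  interpret U: finite_measure "Um k j" by (rule finite_measure_Um)
  interpret pair_sigma_finite lborel "Dm k j" ..
  have "(\<integral>\<^sup>+z. g z * indicator {0..} z * (\<integral>\<^sup>+u. indicator {0..x} (u - z) \<partial>Um k j) \<partial>lborel)
      = (\<integral>\<^sup>+z. g z * indicator {0..} z * (\<integral>\<^sup>+u. indicator {0..x} (u - z) \<partial>Dm k j) \<partial>lborel)"
    by (intro nn_integral_cong_AE eventually_mono[OF AE_lborel_singleton[of 0]])
      (auto simp: nn_integral_Um split: split_indicator)
  also have "\<dots> = (\<integral>\<^sup>+z. \<integral>\<^sup>+u. g z * indicator {0..} z * indicator {0..x} (u - z) \<partial>Dm k j \<partial>lborel)"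
    by (rule nn_integral_cong, rule nn_integral_cmult[symmetric]) measurable
  also have "\<dots> = (\<integral>\<^sup>+u. \<integral>\<^sup>+z. g z * indicator {0..} z * indicator {0..x} (u - z) \<partial>lborel \<partial>Dm k j)"
    by (rule Fubini'[symmetric]) measurable
  also have "\<dots> = (\<integral>\<^sup>+u. \<integral>\<^sup>+w. indicator {0..x} w * (indicator {0..} (u - w) * g (u - w)) \<partial>lborel \<partial>Dm k j)"
  proof (rule nn_integral_cong)
    fix u
    show "(\<integral>\<^sup>+z. g z * indicator {0..} z * indicator {0..x} (u - z) \<partial>lborel)
        = (\<integral>\<^sup>+w. indicator {0..x} w * (indicator {0..} (u - w) * g (u - w)) \<partial>lborel)"
      by (subst nn_integral_real_affine[where c = "-1" and t = u]) (auto simp: mult_ac)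
  qed
  also have "\<dots> = (\<integral>\<^sup>+w. \<integral>\<^sup>+u. indicator {0..x} w * (indicator {0..} (u - w) * g (u - w)) \<partial>Dm k j \<partial>lborel)"
    by (rule Fubini') measurable
  also have "\<dots> = (\<integral>\<^sup>+w. indicator {0..x} w * (\<integral>\<^sup>+u. indicator {0..} (u - w) * g (u - w) \<partial>Dm k j) \<partial>lborel)"
    by (rule nn_integral_cong, rule nn_integral_cmult) measurable
  also have "\<dots> = (\<integral>\<^sup>+w. indicator {0..x} w * (\<integral>\<^sup>+u. indicator {w..} u * g (u - w) \<partial>Dm k j) \<partial>lborel)"
    by (intro nn_integral_cong arg_cong2[where f = "(*)"] refl) (auto split: split_indicator)
  finally show ?thesis .
qed

lemma exit_term_LINT:
  assumes vk: "0 < v k" and l: "0 \<le> l"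
  shows "(LINT y:{0..x}|Um k j. l * (1 - exp (- c k * (x - y) / v k)) * (v k / c k))
    = l * enn2real (\<integral>\<^sup>+u. ennreal ((1 - exp (- c k * (x - u) / v k)) * (v k / c k)) * indicator {0..x} u \<partial>Um k j)"
proof -
  let ?f = "\<lambda>y. (1 - exp (- c k * (x - y) / v k)) * (v k / c k)"
  have ck: "0 < c k" by (rule total_rate_pos)
  have f0: "0 \<le> ?f y" if "y \<le> x" for y
    using that vk ck by (intro mult_nonneg_nonneg) (auto simp: divide_le_0_iff mult_nonneg_nonneg)
  have "(LINT y:{0..x}|Um k j. l * (1 - exp (- c k * (x - y) / v k)) * (v k / c k))
      = l * (LINT y|Um k j. indicator {0..x} y * ?f y)"
    unfolding set_lebesgue_integral_def
    by (subst integral_mult_right_zero[symmetric]) (simp add: mult_ac)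
  also have "(LINT y|Um k j. indicator {0..x} y * ?f y) = enn2real (\<integral>\<^sup>+y. ennreal (indicator {0..x} y * ?f y) \<partial>Um k j)"
    by (rule integral_eq_nn_integral) (use f0 in \<open>auto simp: indicator_def\<close>)
  also have "(\<integral>\<^sup>+y. ennreal (indicator {0..x} y * ?f y) \<partial>Um k j) = (\<integral>\<^sup>+y. ennreal (?f y) * indicator {0..x} y \<partial>Um k j)"
    by (intro nn_integral_cong) (auto split: split_indicator)
  finally show ?thesis .
qed

end

context markov_additive_process
begin

text \<open>The factor \<open>1 / v i\<close> of the sojourn density cancels the \<open>v i\<close>
  from \<open>exit_integral\<close>.\<close>

lemma exit_prob_start_pos:
  assumes vi: "0 < v i"
  shows "enn2real (exit_prob i j x) = (LINT y:{0..x}|Um i j. (1 - exp (- c i * (x - y) / v i)) * (1 / c i))"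
proof -
  let ?Q = "\<integral>\<^sup>+u. ennreal ((1 - exp (- c i * (x - u) / v i)) * (v i / c i)) * indicator {0..x} u \<partial>Um i j"
  have "exit_prob i j x = (\<Sum>k\<in>UNIV. if k = i then
      (\<integral>\<^sup>+z. sojourn i z * (\<integral>\<^sup>+u. indicator {0..x} (u - z) \<partial>Um i j) \<partial>lborel) else 0)"
    unfolding exit_prob_def total_occ_start_pos[OF vi] by (intro sum.cong) auto
  also have "\<dots> = (\<integral>\<^sup>+z. sojourn i z * (\<integral>\<^sup>+u. indicator {0..x} (u - z) \<partial>Um i j) \<partial>lborel)" by simp
  also have "\<dots> = (\<integral>\<^sup>+z. ennreal (1 / v i) * (ennreal (exp (c i * z / v i)) * indicator {..0} z * (\<integral>\<^sup>+u. indicator {0..x} (u - z) \<partial>Um i j)) \<partial>lborel)"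
  proof (rule nn_integral_cong)
    fix z
    have "sojourn i z = ennreal (1 / v i) * (ennreal (exp (c i * z / v i)) * indicator {..0} z)"
      using vi by (auto simp: sojourn_def divide_le_0_iff simp flip: ennreal_mult split: split_indicator)
    then show "sojourn i z * (\<integral>\<^sup>+u. indicator {0..x} (u - z) \<partial>Um i j)
       = ennreal (1 / v i) * (ennreal (exp (c i * z / v i)) * indicator {..0} z * (\<integral>\<^sup>+u. indicator {0..x} (u - z) \<partial>Um i j))"
      by (simp only: mult.assoc)
  qed
  also have "\<dots> = ennreal (1 / v i) * ?Q"
  proof -
    interpret U: finite_measure "Um i j" by (rule finite_measure_Um)
    show ?thesis unfolding exit_integral[OF vi, symmetric] by (rule nn_integral_cmult) measurable
  qed
  finally have "enn2real (exit_prob i j x) = 1 / v i * enn2real ?Q"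
    using vi by (simp add: enn2real_mult)
  also have "\<dots> = (LINT y:{0..x}|Um i j. 1 / v i * (1 - exp (- c i * (x - y) / v i)) * (v i / c i))"
    using vi by (intro exit_term_LINT[symmetric]) auto
  also have "\<dots> = (LINT y:{0..x}|Um i j. (1 - exp (- c i * (x - y) / v i)) * (1 / c i))"
    using vi by (intro set_lebesgue_integral_cong) auto
  finally show ?thesis .
qed

text \<open>Integrability is that of \<open>Eh\<close> shifted by \<open>- w\<close>, restricted
  from \<open>{0..}\<close> to \<open>{w..}\<close>.\<close>

lemma matrix_integral_nonneg_eq:
  fixes w :: real and i j :: 's
  assumes KL: "KL_solution C D F v K L" and w: "0 \<le> w"
  defines "g \<equiv> matrix_integral {w..} (\<lambda>y. mexp ((y - w) *\<^sub>R K) ** I_L v L) (D_measure D F) $ i $ j"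
  shows "0 \<le> g"
    and "ennreal g = (\<Sum>k\<in>UNIV. \<integral>\<^sup>+u. indicator {w..} u * ennreal ((mexp ((u - w) *\<^sub>R K) ** I_L v L) $ i $ k) \<partial>Dm k j)"
proof -
  let ?h = "\<lambda>k u. indicator {w..} u *\<^sub>R (mexp ((u - w) *\<^sub>R K) ** I_L v L) $ i $ k"
  have h0: "0 \<le> ?h k u" for k u
    using Eh_nonneg[OF KL, of "u - w" i k] by (auto simp: indicator_def)
  have g: "g = (\<Sum>k\<in>UNIV. LINT u|Dm k j. ?h k u)"
    by (simp add: g_def matrix_integral_def set_lebesgue_integral_def)
  have "set_integrable (Dm k j) {0..} (\<lambda>u. (mexp ((- w + u) *\<^sub>R K) ** I_L v L) $ i $ k)" for k
    by (rule Eh_shift_integrable[OF KL])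
  then have "set_integrable (Dm k j) {w..} (\<lambda>u. (mexp ((- w + u) *\<^sub>R K) ** I_L v L) $ i $ k)" for k
    by (rule set_integrable_subset) (use w in auto)
  then have int: "integrable (Dm k j) (?h k)" for k
    by (simp add: set_integrable_def)
  show "0 \<le> g" unfolding g by (intro sum_nonneg Bochner_Integration.integral_nonneg h0)
  have "ennreal g = (\<Sum>k\<in>UNIV. ennreal (LINT u|Dm k j. ?h k u))"
    unfolding g by (intro sum_ennreal[symmetric] Bochner_Integration.integral_nonneg h0)
  also have "\<dots> = (\<Sum>k\<in>UNIV. \<integral>\<^sup>+u. ennreal (?h k u) \<partial>Dm k j)"
    by (intro sum.cong refl nn_integral_eq_integral[symmetric] int AE_I2 h0)
  also have "\<dots> = (\<Sum>k\<in>UNIV. \<integral>\<^sup>+u. indicator {w..} u * ennreal ((mexp ((u - w) *\<^sub>R K) ** I_L v L) $ i $ k) \<partial>Dm k j)"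
    by (intro sum.cong refl nn_integral_cong) (auto split: split_indicator)
  finally show "ennreal g = \<dots>" .
qed

lemma matrix_integral_LBINT:
  fixes i j :: 's
  assumes KL: "KL_solution C D F v K L"
  defines "g \<equiv> \<lambda>w. matrix_integral {w..} (\<lambda>y. mexp ((y - w) *\<^sub>R K) ** I_L v L) (D_measure D F) $ i $ j"
  shows "(LBINT w:{0..x}. g w) = enn2real (\<integral>\<^sup>+w. indicator {0..x} w * ennreal (g w) \<partial>lborel)"
proof -
  have [measurable]: "g \<in> borel_measurable borel"
  proof -
    interpret Dm: finite_measure "Dm k' j'" for k' j' by (rule finite_measure_Dm)
    \<comment> \<open>Written with \<open>if\<close>, the integrand is visibly measurable jointly in
      \<open>w\<close> and \<open>u\<close>.\<close>
    have "g = (\<lambda>w. \<Sum>k\<in>UNIV. LINT u|Dm k j. (if w \<le> u then (mexp ((u - w) *\<^sub>R K) ** I_L v L) $ i $ k else 0))"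
      unfolding g_def matrix_integral_def set_lebesgue_integral_def
      by (auto intro!: sum.cong Bochner_Integration.integral_cong simp: indicator_def fun_eq_iff)
    moreover have "(\<lambda>w. \<Sum>k\<in>UNIV. LINT u|Dm k j. (if w \<le> u then (mexp ((u - w) *\<^sub>R K) ** I_L v L) $ i $ k else 0)) \<in> borel_measurable borel"
      by (intro borel_measurable_sum Dm.borel_measurable_lebesgue_integral) measurable
    ultimately show ?thesis by simp
  qed
  have "(LBINT w:{0..x}. g w) = enn2real (\<integral>\<^sup>+w. ennreal (indicator {0..x} w *\<^sub>R g w) \<partial>lborel)"
    unfolding set_lebesgue_integral_def
  proof (rule integral_eq_nn_integral)
    have "0 \<le> indicator {0..x} w *\<^sub>R g w" for w
      using matrix_integral_nonneg_eq(1)[OF KL, of w i j] by (auto simp: g_def indicator_def)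
    then show "AE w in lborel. 0 \<le> indicator {0..x} w *\<^sub>R g w" by simp
  qed simp
  also have "(\<integral>\<^sup>+w. ennreal (indicator {0..x} w *\<^sub>R g w) \<partial>lborel) = (\<integral>\<^sup>+w. indicator {0..x} w * ennreal (g w) \<partial>lborel)"
    by (intro nn_integral_cong) (auto split: split_indicator)
  finally show ?thesis .
qed

text \<open>Depths \<open>z > 0\<close> contribute the \<open>D\<close>-part through
  \<open>below_integral\<close>. For \<open>z < 0\<close> only rising states count, and
  \<open>total_occ_above\<close> reduces them to the value at \<open>0\<close>, which is
  \<open>L $ i $ k / \<bar>v i\<bar>\<close>.\<close>

lemma exit_prob_start_neg:
  assumes min: "minimal_KL_solution C D F v K L" and vi: "v i < 0"
  shows "exit_prob i j x = ennreal (1 / \<bar>v i\<bar>) *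
    ((\<integral>\<^sup>+w. indicator {0..x} w * ennreal (matrix_integral {w..} (\<lambda>y. mexp ((y - w) *\<^sub>R K) ** I_L v L) (D_measure D F) $ i $ j) \<partial>lborel)
     + (\<Sum>k | v k > 0. ennreal (L $ i $ k) *
          (\<integral>\<^sup>+u. ennreal ((1 - exp (- c k * (x - u) / v k)) * (v k / c k)) * indicator {0..x} u \<partial>Um k j)))"
proof -
  interpret U: finite_measure "Um k' j'" for k' j' by (rule finite_measure_Um)
  interpret Dm: finite_measure "Dm k' j'" for k' j' by (rule finite_measure_Dm)
  have KL: "KL_solution C D F v K L" using min by (simp add: minimal_KL_solution_def)
  let ?E = "\<lambda>k z. ennreal ((mexp (z *\<^sub>R K) ** I_L v L) $ i $ k)"
  let ?Q = "\<lambda>k. \<integral>\<^sup>+u. ennreal ((1 - exp (- c k * (x - u) / v k)) * (v k / c k)) * indicator {0..x} u \<partial>Um k j"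
  let ?V = "\<lambda>k z. \<integral>\<^sup>+u. indicator {0..x} (u - z) \<partial>Um k j"
  let ?a = "ennreal (1 / \<bar>v i\<bar>)"
  have tot: "total_occ i k z = ?a * ?E k z" if "0 \<le> z" for k z
    using total_occ_eq_Eh[OF min vi that] Eh_nonneg[OF KL that, of i k] by (simp flip: ennreal_mult)
  have tot0: "total_occ i k 0 = ?a * ennreal (L $ i $ k)" if "0 < v k" for k
    using tot[of 0 k] that vi by (simp add: I_L_def)
  have "(\<integral>\<^sup>+z. total_occ i k z * ?V k z \<partial>lborel)
      = ?a * (\<integral>\<^sup>+w. indicator {0..x} w * (\<integral>\<^sup>+u. indicator {w..} u * ?E k (u - w) \<partial>Dm k j) \<partial>lborel)
        + (if 0 < v k then ?a * (ennreal (L $ i $ k) * ?Q k) else 0)" for k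
  proof -
    have "(\<integral>\<^sup>+z. total_occ i k z * ?V k z \<partial>lborel)
        = (\<integral>\<^sup>+z. ?a * (?E k z * indicator {0..} z * ?V k z)
          + (if 0 < v k then total_occ i k 0 else 0) * (ennreal (exp (c k * z / v k)) * indicator {..0} z * ?V k z) \<partial>lborel)"
    proof (intro nn_integral_cong_AE eventually_mono[OF AE_lborel_singleton[of 0]])
      fix z :: real assume "z \<noteq> 0"
      then consider "z < 0" | "0 < z" by linarith
      then show "total_occ i k z * ?V k z = ?a * (?E k z * indicator {0..} z * ?V k z)
          + (if 0 < v k then total_occ i k 0 else 0) * (ennreal (exp (c k * z / v k)) * indicator {..0} z * ?V k z)"
      proof cases
        case 1
        then show ?thesis using total_occ_above[OF vi 1, of k] by (simp add: mult_ac)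
      next
        case 2
        then show ?thesis using tot[of z k] by (simp add: mult_ac)
      qed
    qed
    also have "\<dots> = ?a * (\<integral>\<^sup>+z. ?E k z * indicator {0..} z * ?V k z \<partial>lborel)
        + (if 0 < v k then total_occ i k 0 else 0) * (\<integral>\<^sup>+z. ennreal (exp (c k * z / v k)) * indicator {..0} z * ?V k z \<partial>lborel)"
      by (simp add: nn_integral_add nn_integral_cmult)
    also have "(\<integral>\<^sup>+z. ?E k z * indicator {0..} z * ?V k z \<partial>lborel)
        = (\<integral>\<^sup>+w. indicator {0..x} w * (\<integral>\<^sup>+u. indicator {w..} u * ?E k (u - w) \<partial>Dm k j) \<partial>lborel)"
      by (rule below_integral) measurable
    also have "(if 0 < v k then total_occ i k 0 else 0) * (\<integral>\<^sup>+z. ennreal (exp (c k * z / v k)) * indicator {..0} z * ?V k z \<partial>lborel)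
        = (if 0 < v k then ?a * (ennreal (L $ i $ k) * ?Q k) else 0)"
      using exit_integral[where k = k and x = x and j = j] tot0[of k] by (simp add: mult.assoc)
    finally show ?thesis .
  qed
  then have "exit_prob i j x = (\<Sum>k\<in>UNIV. ?a * (\<integral>\<^sup>+w. indicator {0..x} w * (\<integral>\<^sup>+u. indicator {w..} u * ?E k (u - w) \<partial>Dm k j) \<partial>lborel)
        + (if 0 < v k then ?a * (ennreal (L $ i $ k) * ?Q k) else 0))"
    unfolding exit_prob_def by simp
  also have "\<dots> = ?a * ((\<Sum>k\<in>UNIV. \<integral>\<^sup>+w. indicator {0..x} w * (\<integral>\<^sup>+u. indicator {w..} u * ?E k (u - w) \<partial>Dm k j) \<partial>lborel)
        + (\<Sum>k | v k > 0. ennreal (L $ i $ k) * ?Q k))"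
    by (simp add: sum.distrib sum_distrib_left distrib_left sum.If_cases)
  also have "(\<Sum>k\<in>UNIV. \<integral>\<^sup>+w. indicator {0..x} w * (\<integral>\<^sup>+u. indicator {w..} u * ?E k (u - w) \<partial>Dm k j) \<partial>lborel)
      = (\<integral>\<^sup>+w. (\<Sum>k\<in>UNIV. indicator {0..x} w * (\<integral>\<^sup>+u. indicator {w..} u * ?E k (u - w) \<partial>Dm k j)) \<partial>lborel)"
  proof (rule nn_integral_sum[symmetric])
    fix k
    have "(\<lambda>w. \<integral>\<^sup>+u. (if w \<le> u then 1 else 0) * ?E k (u - w) \<partial>Dm k j) \<in> borel_measurable lborel" by measurable
    moreover have "(\<lambda>w. \<integral>\<^sup>+u. (if w \<le> u then 1 else 0) * ?E k (u - w) \<partial>Dm k j) = (\<lambda>w. \<integral>\<^sup>+u. indicator {w..} u * ?E k (u - w) \<partial>Dm k j)"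
      by (intro ext nn_integral_cong) (auto split: split_indicator)
    ultimately show "(\<lambda>w. indicator {0..x} w * (\<integral>\<^sup>+u. indicator {w..} u * ?E k (u - w) \<partial>Dm k j)) \<in> borel_measurable lborel"
      by simp
  qed
  also have "\<dots> = (\<integral>\<^sup>+w. indicator {0..x} w * ennreal (matrix_integral {w..} (\<lambda>y. mexp ((y - w) *\<^sub>R K) ** I_L v L) (D_measure D F) $ i $ j) \<partial>lborel)"
    by (intro nn_integral_cong) (auto simp: matrix_integral_nonneg_eq(2)[OF KL] split: split_indicator)
  finally show ?thesis .
qed

text \<open>\<open>enn2real\<close> is additive only on finite values; finiteness of each summand
  follows from that of \<open>exit_prob\<close>.\<close>

lemma exit_prob_start_neg_real:
  assumes min: "minimal_KL_solution C D F v K L" and vi: "v i < 0" and fin: "exit_prob i j x < \<infinity>"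
  shows "enn2real (exit_prob i j x) = 1 / (- v i) *
    ((LBINT w:{0..x}. matrix_integral {w..} (\<lambda>y. mexp ((y - w) *\<^sub>R K) ** I_L v L) (D_measure D F) $ i $ j)
     + (\<Sum>k | v k > 0. LINT y:{0..x}|Um k j. L $ i $ k * (1 - exp (- c k * (x - y) / v k)) * (v k / c k)))"
proof -
  have KL: "KL_solution C D F v K L" using min by (simp add: minimal_KL_solution_def)
  then have L: "0 \<le> L $ i $ k" for k by (simp add: KL_solution_def)
  let ?A = "\<integral>\<^sup>+w. indicator {0..x} w * ennreal (matrix_integral {w..} (\<lambda>y. mexp ((y - w) *\<^sub>R K) ** I_L v L) (D_measure D F) $ i $ j) \<partial>lborel"
  let ?Q = "\<lambda>k. \<integral>\<^sup>+u. ennreal ((1 - exp (- c k * (x - u) / v k)) * (v k / c k)) * indicator {0..x} u \<partial>Um k j"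
  let ?S = "\<Sum>k | v k > 0. ennreal (L $ i $ k) * ?Q k"
  note eq = exit_prob_start_neg[OF min vi, of j x]
  have "B < \<infinity>" if "ennreal (1 / \<bar>v i\<bar>) * B < \<infinity>" for B
    using that vi by (auto simp: ennreal_mult_less_top)
  from this[of "?A + ?S"] have "?A + ?S < \<infinity>" using fin unfolding eq .
  then have fA: "?A < \<top>" and fS: "?S < \<top>" by simp_all
  have "enn2real (exit_prob i j x) = 1 / (- v i) * enn2real (?A + ?S)"
    unfolding eq enn2real_mult using vi by simp
  also have "enn2real (?A + ?S) = enn2real ?A + enn2real ?S" by (rule enn2real_plus[OF fA fS])
  also have "enn2real ?S = (\<Sum>k | v k > 0. enn2real (ennreal (L $ i $ k) * ?Q k))"
  proof (subst enn2real_sum)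
    fix k assume "k \<in> {k. 0 < v k}"
    then show "ennreal (L $ i $ k) * ?Q k < \<top>"
      by (intro le_less_trans[OF member_le_sum[where f = "\<lambda>k. ennreal (L $ i $ k) * ?Q k"] fS]) auto
  qed (simp add: o_def)
  also have "\<dots> = (\<Sum>k | v k > 0. LINT y:{0..x}|Um k j. L $ i $ k * (1 - exp (- c k * (x - y) / v k)) * (v k / c k))"
    using L by (intro sum.cong refl) (subst exit_term_LINT, auto simp: enn2real_mult)
  also have "enn2real ?A = (LBINT w:{0..x}. matrix_integral {w..} (\<lambda>y. mexp ((y - w) *\<^sub>R K) ** I_L v L) (D_measure D F) $ i $ j)"
    by (rule matrix_integral_LBINT[OF KL, symmetric])
  finally show ?thesis .
qed

end

theorem theorem4p1:
  fixes C D K L :: "real ^ 's ^ ('s::finite)"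
    and F :: "'s \<Rightarrow> 's \<Rightarrow> real measure"
    and v :: "'s \<Rightarrow> real"
    and \<pi> :: "real ^ 's"
    and P :: "'a measure"
    and M :: "real \<Rightarrow> 'a \<Rightarrow> 's"
    and Y :: "real \<Rightarrow> 'a \<Rightarrow> real"
    and T :: "nat \<Rightarrow> 'a \<Rightarrow> real"
    and E :: "nat \<Rightarrow> 'a \<Rightarrow> transition_type"
    and i j :: 's
    and x :: real
  assumes "markov_additive_process C D F v \<pi> P M Y T E"
    and "minimal_KL_solution C D F v K L"
    and "\<P>(\<omega> in P. M 0 \<omega> = i) > 0"
    and "x \<ge> 0"
  shows "(v i < 0 \<longrightarrow> H P M Y T i j x =
           1 / (- v i) *
            ((LBINT w:{0..x}.
                matrix_integral {w..} (\<lambda>y. mexp ((y - w) *\<^sub>R K) ** I_L v L) (D_measure D F) $ i $ j)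
             + (\<Sum>k | v k > 0. LINT y:{0..x}|U_measure C D F k j.
                  L $ i $ k * (1 - exp (- total_rate C D k * (x - y) / v k)) * (v k / total_rate C D k)))) \<and>
         (v i > 0 \<longrightarrow> H P M Y T i j x =
           (LINT y:{0..x}|U_measure C D F i j.
              (1 - exp (- total_rate C D i * (x - y) / v i)) * (1 / total_rate C D i)))"
proof -
  interpret markov_additive_process C D F v \<pi> P M Y T E by (rule assms(1))
  note H_eq = H_eq_exit_prob[OF assms(3), of j x]
  show ?thesis
    using exit_prob_start_neg_real[OF assms(2) _ H_eq(2)] exit_prob_start_pos[of i j x]
    unfolding H_eq(1) by blast
qed

end
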